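(* Let $E/\mathbf{Q}$ be an elliptic curve given by a Weierstrass equation $y^2 + a_1 xy + a_3 y = x^3 + a_2 x^2 + a_4 x + a_6$ with integer coefficients, let $p \geq 5$ be a prime at which $E$ has good ordinary reduction, and let $N \geq 4$. Given the value of $\mathbf{E}_2(E, \omega)$ modulo $p^{N-3}$, the $p$-adic sigma function $\sigma_p(t)$ may be computed modulo the ideal $I_N$ in time $\widetilde{O}(N^2 \log p)$.
   Context: Here $\omega = dx/(2y + a_1x + a_3)$ is the invariant differential and $\mathbf{E}_2(E,\omega)\in\mathbf{Z}_p$ is the value of Katz's $p$-adic weight-two Eisenstein series at $(E,\omega)$. Let $t = -x/y$ be the formal group parameter at the origin, and let $x(t)\in \mathbf{Z}_p((t))$ be the Laurent expansion of $x$ in $t$, and $\omega(t)$ the power series with $\omega = \omega(t)\,dt$. Set $c = (a_1^2 + 4a_2 - \mathbf{E}_2(E,\omega))/12$. The $p$-adic sigma function $\sigma_p(t) = t + c_2t^2 + c_3 t^3 + \cdots \in \mathbf{Z}_p[[t]]$ is the unique odd function (i.e. $\sigma_p(i(t)) = -\sigma_p(t)$, where $i(t)$ is the formal group inverse) of the form $t + \cdots$ satisfying $x(t) + c = -\frac{1}{\omega(t)}\frac{d}{dt}\left(\frac{1}{\omega(t)\sigma_p(t)}\frac{d\sigma_p}{dt}\right)$. For $r \geq 1$, $I_r$ is the ideal $(p^r, p^{r-1}t, \ldots, p t^{r-1}, t^r)$ of $\mathbf{Z}_p[[t]]$; computing $\sigma_p$ modulo $I_N$ means computing the coefficient of $t^k$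 modulo $p^{N-k}$ for $k = 1,\ldots,N-1$. The curve $E$ is treated as fixed for running-time estimates; $\widetilde{O}(X)$ means $O(X(\log X)^k)$ for some $k\ge 0$. Asymptotically fast polynomial arithmetic is assumed: multiplication and division of polynomials of degree $d$ over $\mathbf{Z}/p^r\mathbf{Z}$ take time $\widetilde{O}(dr\log p)$. *)

theory Defs
  imports
    "HOL-Computational_Algebra.Computational_Algebra"
    "HOL-Number_Theory.Cong"
    "HOL-Library.Landau_Symbols"
    "HOL-Library.Log_Nat"
    Complex_Main
begin

section \<open>Weierstrass equations\<close>

datatype weierstrass =
  Weierstrass (a1: int) (a2: int) (a3: int) (a4: int) (a6: int)

definition b2 :: "weierstrass \<Rightarrow> int" where
  "b2 E = (a1 E)^2 + 4 * a2 E"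

definition b4 :: "weierstrass \<Rightarrow> int" where
  "b4 E = 2 * a4 E + a1 E * a3 E"

definition b6 :: "weierstrass \<Rightarrow> int" where
  "b6 E = (a3 E)^2 + 4 * a6 E"

definition b8 :: "weierstrass \<Rightarrow> int" where
  "b8 E = (a1 E)^2 * a6 E + 4 * a2 E * a6 E - a1 E * a3 E * a4 E
          + a2 E * (a3 E)^2 - (a4 E)^2"

definition c4 :: "weierstrass \<Rightarrow> int" where
  "c4 E = (b2 E)^2 - 24 * b4 E"

definition c6 :: "weierstrass \<Rightarrow> int" where
  "c6 E = - ((b2 E)^3) + 36 * b2 E * b4 E - 216 * b6 E"

definition discr :: "weierstrass \<Rightarrow> int" where
  "discr E = - ((b2 E)^2 * b8 E) - 8 * (b4 E)^3 - 27 * (b6 E)^2 + 9 * b2 E * b4 E * b6 E"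

text \<open>
  The equations E and E' are related by the substitution
  x = u^2 x' + r, y = u^3 y' + u^2 s x' + v over the rationals.  The invariant differentials
  are then related by \<omega>' = u \<omega>.
\<close>

definition change_vars ::
    "rat \<Rightarrow> rat \<Rightarrow> rat \<Rightarrow> rat \<Rightarrow> weierstrass \<Rightarrow> weierstrass \<Rightarrow> bool" where
  "change_vars u r s v E E' \<longleftrightarrow>
     u \<noteq> 0 \<and>
     u * of_int (a1 E') = of_int (a1 E) + 2 * s \<and>
     u^2 * of_int (a2 E') = of_int (a2 E) - s * of_int (a1 E) + 3 * r - s^2 \<and>
     u^3 * of_int (a3 E') = of_int (a3 E) + r * of_int (a1 E) + 2 * v \<and>
     u^4 * of_int (a4 E') = of_int (a4 E) - s * of_int (a3 E) + 2 * r * of_int (a2 E)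
        - (v + r * s) * of_int (a1 E) + 3 * r^2 - 2 * s * v \<and>
     u^6 * of_int (a6 E') = of_int (a6 E) + r * of_int (a4 E) + r^2 * of_int (a2 E) + r^3
        - v * of_int (a3 E) - v^2 - r * v * of_int (a1 E)"

text \<open>
  The trace of Frobenius p + 1 - #E(F_p); the point at infinity cancels the 1.
\<close>

definition frob_trace :: "nat \<Rightarrow> weierstrass \<Rightarrow> int" where
  "frob_trace p E = int p - int (card {(x, y). x \<in> {0..<int p} \<and> y \<in> {0..<int p} \<and>
      [y^2 + a1 E * x * y + a3 E * y = x^3 + a2 E * x^2 + a4 E * x + a6 E] (mod int p)})"

text \<open>
  Good reduction is a property of the curve, not of the given equation, which may fail to be
  minimal at p.  An integral model that is nonsingular modulo p exists whenever the reduction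
  at p is good, for instance a global minimal model.
\<close>

definition good_ordinary :: "nat \<Rightarrow> weierstrass \<Rightarrow> bool" where
  "good_ordinary p E \<longleftrightarrow>
     (\<exists>E' u r s v. change_vars u r s v E E' \<and>
        \<not> int p dvd discr E' \<and> \<not> int p dvd frob_trace p E')"


section \<open>Expansions at the origin\<close>

text \<open>
  With t = - x/y and w = - 1/y the Weierstrass equation becomes the equation below, and w is its
  unique solution in power series without constant term.
\<close>

definition w_equation :: "weierstrass \<Rightarrow> rat fps \<Rightarrow> bool" where
  "w_equation E w \<longleftrightarrow> fps_nth w 0 = 0 \<and>
     w = fps_X^3 + of_int (a1 E) * fps_X * w + of_int (a2 E) * fps_X^2 * w
         + of_int (a3 E) * w^2 + of_int (a4 E) * fps_X * w^2 + of_int (a6 E) * w^3"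

definition w_series :: "weierstrass \<Rightarrow> rat fps" where
  "w_series E = (THE w. w_equation E w)"

lemma fps_X_power_dvd_iff:
  "fps_X ^ n dvd (f :: rat fps) \<longleftrightarrow> (\<forall>m<n. fps_nth f m = 0)"
proof
  assume *: "\<forall>m<n. fps_nth f m = 0"
  have "f = fps_X ^ n * fps_shift n f"
    by (rule fps_ext) (use * in \<open>simp add: fps_X_power_mult_nth\<close>)
  thus "fps_X ^ n dvd f" by (rule dvdI)
qed (auto simp: dvd_def fps_X_power_mult_nth)

lemma w_equation_unique:
  assumes "w_equation E w" "w_equation E v"
  shows "w = v"
proof -
  define h where "h = of_int (a1 E) * fps_X + of_int (a2 E) * fps_X^2
      + of_int (a3 E) * (w + v) + of_int (a4 E) * fps_X * (w + v)
      + of_int (a6 E) * (w^2 + w * v + v^2)"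
  have w: "w = fps_X^3 + of_int (a1 E) * fps_X * w + of_int (a2 E) * fps_X^2 * w
         + of_int (a3 E) * w^2 + of_int (a4 E) * fps_X * w^2 + of_int (a6 E) * w^3"
    and v: "v = fps_X^3 + of_int (a1 E) * fps_X * v + of_int (a2 E) * fps_X^2 * v
         + of_int (a3 E) * v^2 + of_int (a4 E) * fps_X * v^2 + of_int (a6 E) * v^3"
    and 0: "fps_nth w 0 = 0" "fps_nth v 0 = 0"
    using assms by (auto simp: w_equation_def)
  have "w - v = (w - v) * h"
    by (subst (1) w, subst (1) v)
       (simp add: h_def algebra_simps power2_eq_square power3_eq_cube)
  hence "(w - v) * (1 - h) = 0"
    by (simp add: algebra_simps)
  moreover have "fps_nth h 0 = 0"
    by (simp add: h_def 0 power2_eq_square)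
  hence "1 - h \<noteq> 0"
    by (metis eq_iff_diff_eq_0 fps_one_nth zero_neq_one)
  ultimately show ?thesis by simp
qed

lemma w_equation_exists: "\<exists>w. w_equation E w"
proof -
  define F :: "rat fps \<Rightarrow> rat fps" where
    "F w = fps_X^3 + of_int (a1 E) * fps_X * w + of_int (a2 E) * fps_X^2 * w
         + of_int (a3 E) * w^2 + of_int (a4 E) * fps_X * w^2 + of_int (a6 E) * w^3" for w
  have X0: "fps_X dvd f \<longleftrightarrow> fps_nth f 0 = 0" for f :: "rat fps"
    using fps_X_power_dvd_iff[of 1 f] by auto
  have contr: "fps_X ^ Suc n dvd F w - F v"
    if "fps_X ^ n dvd w - v" "fps_nth w 0 = 0" "fps_nth v 0 = 0" for n w v
  proof -
    define h where "h = of_int (a1 E) * fps_X + of_int (a2 E) * fps_X^2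
      + of_int (a3 E) * (w + v) + of_int (a4 E) * fps_X * (w + v)
      + of_int (a6 E) * (w^2 + w * v + v^2)"
    have "F w - F v = (w - v) * h"
      by (simp add: F_def h_def algebra_simps power2_eq_square power3_eq_cube)
    moreover have "fps_X dvd h"
      by (simp add: X0 h_def that power2_eq_square)
    ultimately show ?thesis
      using mult_dvd_mono[OF that(1)] by (metis power_Suc2)
  qed
  have F0: "fps_nth (F w) 0 = 0" if "fps_nth w 0 = 0" for w
    using that by (simp add: F_def power2_eq_square power3_eq_cube)
  define g where "g n = (F ^^ n) 0" for n
  have g0: "fps_nth (g n) 0 = 0" for n
    by (induction n) (auto simp: g_def F0)
  have gSuc: "g (Suc n) = F (g n)" for n
    by (simp add: g_def)
  have step: "fps_X ^ n dvd g (Suc n) - g n" for n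
  proof (induction n)
    case (Suc n)
    show ?case using contr[OF Suc g0 g0] by (simp add: gSuc)
  qed auto
  have far: "fps_X ^ n dvd g (n + k) - g n" for n k
  proof (induction k)
    case (Suc k)
    have "fps_X ^ n dvd g (Suc (n + k)) - g (n + k)"
      using step[of "n + k"] by (meson dvd_trans le_add1 le_imp_power_dvd)
    from dvd_add[OF this Suc] show ?case by simp
  qed auto
  define w where "w = Abs_fps (\<lambda>n. fps_nth (g (Suc n)) n)"
  have near: "fps_X ^ n dvd w - g n" for n
    unfolding fps_X_power_dvd_iff
  proof (intro allI impI)
    fix m assume "m < n"
    then obtain k where k: "n = Suc m + k" using less_iff_Suc_add by auto
    have "fps_nth (g (Suc m + k) - g (Suc m)) m = 0"
      using far[of "Suc m" k] unfolding fps_X_power_dvd_iff by auto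
    thus "fps_nth (w - g n) m = 0" by (simp add: w_def k)
  qed
  have w0: "fps_nth w 0 = 0" by (simp add: w_def g0)
  have "fps_nth w n = fps_nth (F w) n" for n
  proof -
    have "fps_X ^ Suc n dvd F w - g (Suc n)"
      using contr[OF near w0 g0, of n] by (simp add: gSuc)
    moreover have "fps_X ^ Suc n dvd w - g (Suc n)" by (rule near)
    ultimately show ?thesis unfolding fps_X_power_dvd_iff by auto
  qed
  hence "w = F w" by (simp add: fps_eq_iff)
  with w0 have "w_equation E w" unfolding w_equation_def F_def by blast
  thus ?thesis by blast
qed

lemma w_series: "w_equation E (w_series E)"
  unfolding w_series_def
  using w_equation_exists w_equation_unique by (metis theI)

definition x_series :: "weierstrass \<Rightarrow> rat fls" where
  "x_series E = fls_X / fps_to_fls (w_series E)"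

definition y_series :: "weierstrass \<Rightarrow> rat fls" where
  "y_series E = - 1 / fps_to_fls (w_series E)"

definition omega_series :: "weierstrass \<Rightarrow> rat fls" where
  "omega_series E = fls_deriv (x_series E) /
     (2 * y_series E + of_int (a1 E) * x_series E + of_int (a3 E))"

text \<open>
  Since -(x, y) = (x, - y - a1 x - a3), the formal inverse is the value of - x/y at this point.
\<close>

definition formal_inverse :: "weierstrass \<Rightarrow> rat fps" where
  "formal_inverse E = fls_regpart
     (- x_series E / (- y_series E - of_int (a1 E) * x_series E - of_int (a3 E)))"


section \<open>p-adic integers\<close>

text \<open>
  A p-adic integer is its sequence of residues z n modulo p^n, i.e. an element of the inverse
  limit.  A power series over the p-adic integers is the sequence of its coefficients.
\<close>

definition Zp :: "nat \<Rightarrow> (nat \<Rightarrow> int) set" where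
  "Zp p = {z. \<forall>n. z n \<in> {0..<int p ^ n} \<and> z (Suc n) mod int p ^ n = z n}"

definition Zp_of_int :: "nat \<Rightarrow> int \<Rightarrow> nat \<Rightarrow> int" where
  "Zp_of_int p a = (\<lambda>n. a mod int p ^ n)"

definition p_integral :: "nat \<Rightarrow> rat \<Rightarrow> bool" where
  "p_integral p x \<longleftrightarrow> (\<exists>a b :: int. \<not> int p dvd b \<and> x = of_int a / of_int b)"

text \<open>Congruence modulo p^n in the localization of the integers at p.\<close>

definition rat_cong :: "nat \<Rightarrow> nat \<Rightarrow> rat \<Rightarrow> rat \<Rightarrow> bool" where
  "rat_cong p n x y \<longleftrightarrow> p_integral p ((x - y) / of_nat p ^ n)"

definition fls_cong :: "nat \<Rightarrow> nat \<Rightarrow> rat fls \<Rightarrow> rat fls \<Rightarrow> bool" where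
  "fls_cong p n f g \<longleftrightarrow> (\<forall>k. rat_cong p n (fls_nth f k) (fls_nth g k))"

definition fps_cong :: "nat \<Rightarrow> nat \<Rightarrow> rat fps \<Rightarrow> rat fps \<Rightarrow> bool" where
  "fps_cong p n f g \<longleftrightarrow> (\<forall>k. rat_cong p n (fps_nth f k) (fps_nth g k))"


section \<open>Katz's Eisenstein series of weight two\<close>

definition bernoulli_num :: "nat \<Rightarrow> rat" where
  "bernoulli_num k = fact k * fps_nth (fps_X / (fps_exp 1 - 1)) k"

text \<open>The q-expansion of the normalized Eisenstein series 1 - 2k/B_k q - ...\<close>

definition eisenstein :: "nat \<Rightarrow> rat fps" where
  "eisenstein k = Abs_fps (\<lambda>n. if n = 0 then 1 else
     - (2 * of_nat k / bernoulli_num k) * (\<Sum>d | d dvd n. of_nat d ^ (k - 1)))"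

text \<open>
  For p at least 5 the modular forms of level one and weight k over the localization of the
  integers at p are the polynomials F in E_4 and E_6, isobaric of weight k.  The form F has
  q-expansion F(E_4(q), E_6(q)), and its value at (E, \<omega>) is F(c4(E), - c6(E)): on the Tate curve
  with its canonical differential, c4 = E_4(q) and c6 = - E_6(q).
\<close>

definition isobaric :: "nat \<Rightarrow> (nat \<Rightarrow> nat \<Rightarrow> 'a) \<Rightarrow> 'a \<Rightarrow> 'a \<Rightarrow> 'a::comm_ring_1" where
  "isobaric k F Q R = (\<Sum>(i, j) \<in> {(i, j). 4 * i + 6 * j = k}. F i j * Q ^ i * R ^ j)"

definition mf_qexp :: "nat \<Rightarrow> (nat \<Rightarrow> nat \<Rightarrow> rat) \<Rightarrow> rat fps" where
  "mf_qexp k F = isobaric k (\<lambda>i j. fps_const (F i j)) (eisenstein 4) (eisenstein 6)"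

definition mf_value :: "nat \<Rightarrow> (nat \<Rightarrow> nat \<Rightarrow> rat) \<Rightarrow> weierstrass \<Rightarrow> rat" where
  "mf_value k F E = isobaric k F (of_int (c4 E)) (of_int (- c6 E))"

definition p_integral_form :: "nat \<Rightarrow> (nat \<Rightarrow> nat \<Rightarrow> rat) \<Rightarrow> bool" where
  "p_integral_form p F \<longleftrightarrow> (\<forall>i j. p_integral p (F i j))"

text \<open>
  Katz's p-adic modular form of weight two with q-expansion E_2(q) is a limit of quotients
  F / E_(p-1)^a with F a classical form of weight 2 + a(p-1), the limit being taken p-adically on
  q-expansions; its value at (E, \<omega>), for an equation E with good ordinary reduction, is the limit
  of the values of these quotients.  The value of E_(p-1) at (E, \<omega>) is a p-adic unit because it
  lifts the Hasse invariant.
\<close>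

definition katz_E2_good :: "nat \<Rightarrow> weierstrass \<Rightarrow> (nat \<Rightarrow> int) \<Rightarrow> bool" where
  "katz_E2_good p E e \<longleftrightarrow> e \<in> Zp p \<and>
     (\<exists>A. p_integral_form p A \<and> mf_qexp (p - 1) A = eisenstein (p - 1) \<and>
       (\<forall>n. \<exists>a F. p_integral_form p F \<and>
          fps_cong p n (mf_qexp (2 + a * (p - 1)) F) (eisenstein 2 * eisenstein (p - 1) ^ a) \<and>
          rat_cong p n (mf_value (2 + a * (p - 1)) F E)
            (of_int (e n) * mf_value (p - 1) A E ^ a)))"

text \<open>
  Weight two means E_2(E, \<omega>) = u^2 E_2(E', \<omega>') if \<omega>' = u \<omega>; this gives the value for an equation
  that is not minimal at p.
\<close>

definition katz_E2 :: "nat \<Rightarrow> weierstrass \<Rightarrow> (nat \<Rightarrow> int) \<Rightarrow> bool" where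
  "katz_E2 p E e \<longleftrightarrow> e \<in> Zp p \<and>
     (\<exists>E' u r s v e'. change_vars u r s v E E' \<and>
        \<not> int p dvd discr E' \<and> \<not> int p dvd frob_trace p E' \<and> katz_E2_good p E' e' \<and>
        (\<forall>n. rat_cong p n (of_int (e n)) (u^2 * of_int (e' n))))"


section \<open>The p-adic sigma function\<close>

text \<open>
  An identity between power series or Laurent series over the p-adic integers holds iff it holds
  modulo p^n for every n.  For n at least 1 the representative of \<sigma> modulo p^n has integer
  coefficients and starts with t, so that dividing by it is compatible with reduction; c is
  p-integral since p does not divide 12.
\<close>

definition series_mod :: "(nat \<Rightarrow> nat \<Rightarrow> int) \<Rightarrow> nat \<Rightarrow> rat fps" where
  "series_mod \<sigma> n = Abs_fps (\<lambda>k. of_int (\<sigma> k n))"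

definition is_padic_sigma ::
    "nat \<Rightarrow> weierstrass \<Rightarrow> (nat \<Rightarrow> int) \<Rightarrow> (nat \<Rightarrow> nat \<Rightarrow> int) \<Rightarrow> bool" where
  "is_padic_sigma p E e \<sigma> \<longleftrightarrow>
     (\<forall>k. \<sigma> k \<in> Zp p) \<and> \<sigma> 0 = Zp_of_int p 0 \<and> \<sigma> 1 = Zp_of_int p 1 \<and>
     (\<forall>n. fps_cong p n (series_mod \<sigma> n oo formal_inverse E) (- series_mod \<sigma> n)) \<and>
     (\<forall>n. let s = fps_to_fls (series_mod \<sigma> n);
              \<omega> = omega_series E;
              c = (of_int ((a1 E)^2 + 4 * a2 E - e n) / 12 :: rat)
          in fls_cong p n (x_series E + fls_const c)
               (- (1 / \<omega>) * fls_deriv (1 / (\<omega> * s) * fls_deriv s)))"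


section \<open>Machine model\<close>

text \<open>
  Structured programs on a random access machine with finitely many integer variables and
  finitely many arrays of integers; cost counts bit operations, so each instruction is charged
  according to the binary lengths of its operands and addresses.  Integer multiplication and
  division are charged by a function tI of the total length of the operands.  Multiplication, and
  division with remainder by a polynomial with unit leading coefficient, of polynomials over Z/p^r
  (arrays of coefficients in ascending order, given by residues) are charged tM d p r and tD d p r,
  where d is the larger number of coefficients of the operands.
\<close>

datatype com =
    Skip
  | Load nat int
  | Plus nat nat nat
  | Minus nat nat nat
  | Times nat nat nat
  | Quot nat nat nat
  | Rem nat nat nat
  | Len nat nat
  | Get nat nat nat
  | Put nat nat nat
  | Push nat nat
  | Clear nat
  | PolyTimes nat nat nat nat nat
  | PolyDiv nat nat nat nat nat nat
  | Seq com com
  | IfPos nat com com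
  | WhilePos nat com

type_synonym state = "(nat \<Rightarrow> int) \<times> (nat \<Rightarrow> int list)"

definition ilen :: "int \<Rightarrow> nat" where
  "ilen x = 1 + nat (bitlen \<bar>x\<bar>)"

definition residues_list :: "nat \<Rightarrow> nat \<Rightarrow> int list \<Rightarrow> bool" where
  "residues_list p r A \<longleftrightarrow> set A \<subseteq> {0..<int p ^ r}"

definition poly_times :: "nat \<Rightarrow> nat \<Rightarrow> int list \<Rightarrow> int list \<Rightarrow> int list" where
  "poly_times p r A B =
     map (\<lambda>i. coeff (Poly A * Poly B) i mod int p ^ r) [0..<length A + length B - 1]"

definition is_poly_div ::
    "nat \<Rightarrow> nat \<Rightarrow> int list \<Rightarrow> int list \<Rightarrow> int list \<Rightarrow> int list \<Rightarrow> bool" where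
  "is_poly_div p r A B Q R \<longleftrightarrow>
     B \<noteq> [] \<and> coprime (last B) (int p) \<and>
     residues_list p r Q \<and> residues_list p r R \<and>
     length Q = length A + 1 - length B \<and> length R = length B - 1 \<and>
     (\<forall>i. [coeff (Poly A) i = coeff (Poly Q * Poly B + Poly R) i] (mod int p ^ r))"

inductive exec ::
    "(nat \<Rightarrow> nat) \<Rightarrow> (nat \<Rightarrow> nat \<Rightarrow> nat \<Rightarrow> nat) \<Rightarrow> (nat \<Rightarrow> nat \<Rightarrow> nat \<Rightarrow> nat) \<Rightarrow>
     com \<Rightarrow> state \<Rightarrow> nat \<Rightarrow> state \<Rightarrow> bool"
  for tI :: "nat \<Rightarrow> nat" and tM tD :: "nat \<Rightarrow> nat \<Rightarrow> nat \<Rightarrow> nat" where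
  exec_Skip: "exec tI tM tD Skip st 1 st"
| exec_Load: "exec tI tM tD (Load x c) (s, l) (ilen c) (s(x := c), l)"
| exec_Plus: "exec tI tM tD (Plus x y z) (s, l) (ilen (s y) + ilen (s z)) (s(x := s y + s z), l)"
| exec_Minus: "exec tI tM tD (Minus x y z) (s, l) (ilen (s y) + ilen (s z)) (s(x := s y - s z), l)"
| exec_Times:
    "exec tI tM tD (Times x y z) (s, l) (tI (ilen (s y) + ilen (s z))) (s(x := s y * s z), l)"
| exec_Quot:
    "exec tI tM tD (Quot x y z) (s, l) (tI (ilen (s y) + ilen (s z))) (s(x := s y div s z), l)"
| exec_Rem:
    "exec tI tM tD (Rem x y z) (s, l) (tI (ilen (s y) + ilen (s z))) (s(x := s y mod s z), l)"
| exec_Len: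
    "exec tI tM tD (Len x A) (s, l) (ilen (int (length (l A)))) (s(x := int (length (l A))), l)"
| exec_Get: "0 \<le> s y \<Longrightarrow> nat (s y) < length (l A) \<Longrightarrow>
    exec tI tM tD (Get x A y) (s, l) (ilen (s y) + ilen (l A ! nat (s y)))
      (s(x := l A ! nat (s y)), l)"
| exec_Put: "0 \<le> s y \<Longrightarrow> nat (s y) < length (l A) \<Longrightarrow>
    exec tI tM tD (Put A y x) (s, l) (ilen (s y) + ilen (s x))
      (s, l(A := (l A)[nat (s y) := s x]))"
| exec_Push:
    "exec tI tM tD (Push A x) (s, l) (ilen (int (length (l A))) + ilen (s x))
      (s, l(A := l A @ [s x]))"
| exec_Clear: "exec tI tM tD (Clear A) (s, l) 1 (s, l(A := []))"
| exec_PolyTimes: "p = nat (s x) \<Longrightarrow> r = nat (s y) \<Longrightarrow> prime p \<Longrightarrow> 1 \<le> r \<Longrightarrow>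
    residues_list p r (l A) \<Longrightarrow> residues_list p r (l B) \<Longrightarrow>
    exec tI tM tD (PolyTimes C A B x y) (s, l) (tM (max (length (l A)) (length (l B))) p r)
      (s, l(C := poly_times p r (l A) (l B)))"
| exec_PolyDiv: "p = nat (s x) \<Longrightarrow> r = nat (s y) \<Longrightarrow> prime p \<Longrightarrow> 1 \<le> r \<Longrightarrow>
    residues_list p r (l A) \<Longrightarrow> residues_list p r (l B) \<Longrightarrow> is_poly_div p r (l A) (l B) Q R \<Longrightarrow>
    exec tI tM tD (PolyDiv C D A B x y) (s, l) (tD (max (length (l A)) (length (l B))) p r)
      (s, l(C := Q, D := R))"
| exec_Seq: "exec tI tM tD c st t st' \<Longrightarrow> exec tI tM tD d st' t' st'' \<Longrightarrow>
    exec tI tM tD (Seq c d) st (t + t') st''"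
| exec_IfPos_true: "fst st x > 0 \<Longrightarrow> exec tI tM tD c st t st' \<Longrightarrow>
    exec tI tM tD (IfPos x c d) st (1 + t) st'"
| exec_IfPos_false: "fst st x \<le> 0 \<Longrightarrow> exec tI tM tD d st t st' \<Longrightarrow>
    exec tI tM tD (IfPos x c d) st (1 + t) st'"
| exec_WhilePos_true: "fst st x > 0 \<Longrightarrow> exec tI tM tD c st t st' \<Longrightarrow>
    exec tI tM tD (WhilePos x c) st' t' st'' \<Longrightarrow>
    exec tI tM tD (WhilePos x c) st (1 + t + t') st''"
| exec_WhilePos_false: "fst st x \<le> 0 \<Longrightarrow> exec tI tM tD (WhilePos x c) st 1 st"

lemma residues_list_eqI:
  assumes "residues_list p r Q" "residues_list p r Q'" "length Q = length Q'"
    and "\<And>i. int p ^ r dvd coeff (Poly Q - Poly Q') i"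
  shows "Q = Q'"
proof (rule nth_equalityI)
  fix i assume i: "i < length Q"
  have "Q ! i \<in> {0..<int p ^ r}" "Q' ! i \<in> {0..<int p ^ r}"
    using assms(1-3) i by (auto simp: residues_list_def subset_iff)
  moreover have "int p ^ r dvd Q ! i - Q' ! i"
    using assms(4)[of i] i assms(3) by (simp add: nth_default_def)
  ultimately show "Q ! i = Q' ! i"
    by (metis atLeastLessThan_iff mod_eq_dvd_iff mod_pos_pos_trivial)
qed fact

lemma is_poly_div_unique:
  assumes "is_poly_div p r A B Q R" "is_poly_div p r A B Q' R'"
  shows "Q = Q' \<and> R = R'"
proof -
  let ?m = "int p ^ r"
  define G where "G = Poly Q - Poly Q'"
  define H where "H = Poly R' - Poly R"
  define b where "b = length B - 1"
  note d = assms[unfolded is_poly_div_def]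
  have lead: "coeff (Poly B) b = last B" and B: "B \<noteq> []"
    using d by (auto simp: b_def nth_default_def last_conv_nth)
  have GH: "?m dvd coeff (G * Poly B) i - coeff H i" for i
  proof -
    have "[coeff (Poly Q * Poly B + Poly R) i = coeff (Poly Q' * Poly B + Poly R') i] (mod ?m)"
      using d by (meson cong_sym cong_trans)
    thus ?thesis
      unfolding cong_iff_dvd_diff by (simp add: G_def H_def algebra_simps)
  qed
  have G: "?m dvd coeff G i" for i
  proof (rule ccontr)
    assume "\<not> ?m dvd coeff G i"
    define S where "S = {i. \<not> ?m dvd coeff G i}"
    have "S \<subseteq> {..degree G}" by (auto simp: S_def intro: le_degree)
    hence fin: "finite S" using finite_subset by blast
    moreover have "i \<in> S" using \<open>\<not> ?m dvd coeff G i\<close> by (simp add: S_def)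
    ultimately have k: "Max S \<in> S" by (intro Max_in) auto
    define k where "k = Max S"
    have big: "?m dvd coeff G j" if "j > k" for j
    proof (rule ccontr)
      assume "\<not> ?m dvd coeff G j"
      hence "j \<le> k" unfolding k_def using fin by (intro Max_ge) (simp_all add: S_def)
      with that show False by simp
    qed
    have "coeff (G * Poly B) (k + b) = (\<Sum>j\<le>k+b. coeff G j * coeff (Poly B) (k + b - j))"
      by (simp add: coeff_mult)
    also have "\<dots> = coeff G k * last B
        + (\<Sum>j\<in>{..k+b}-{k}. coeff G j * coeff (Poly B) (k + b - j))"
      by (subst sum.remove[of _ k]) (use lead in auto)
    finally have eq: "coeff (G * Poly B) (k + b) = \<dots>" .
    have "?m dvd (\<Sum>j\<in>{..k+b}-{k}. coeff G j * coeff (Poly B) (k + b - j))"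
    proof (rule dvd_sum)
      fix j assume j: "j \<in> {..k+b}-{k}"
      show "?m dvd coeff G j * coeff (Poly B) (k + b - j)"
      proof (cases "j > k")
        case True thus ?thesis using big by simp
      next
        case False
        hence "k + b - j \<ge> length B" using j B by (auto simp: b_def)
        thus ?thesis by (simp add: nth_default_def)
      qed
    qed
    moreover have "coeff H (k + b) = 0"
      using d by (simp add: H_def nth_default_def b_def)
    hence "?m dvd coeff (G * Poly B) (k + b)" using GH[of "k + b"] by simp
    ultimately have "?m dvd coeff G k * last B"
      unfolding eq by (simp add: dvd_add_left_iff)
    moreover have "coprime ?m (last B)"
      using d by (simp add: coprime_commute)
    ultimately have "?m dvd coeff G k"
      by (simp add: coprime_dvd_mult_left_iff)
    with k show False by (simp add: S_def k_def)
  qed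
  have GB: "?m dvd coeff (G * Poly B) i" for i
    using G by (auto simp: coeff_mult intro!: dvd_sum dvd_mult2)
  have H: "?m dvd coeff H i" for i
    using dvd_diff[OF GB[of i] GH[of i]] by simp
  have "Q = Q'"
    using d G by (intro residues_list_eqI[of p r]) (auto simp: G_def)
  moreover have "R' = R"
    using d H by (intro residues_list_eqI[of p r]) (auto simp: H_def)
  ultimately show ?thesis by simp
qed

lemma exec_deterministic:
  "exec tI tM tD c st t st' \<Longrightarrow> exec tI tM tD c st u st'' \<Longrightarrow> t = u \<and> st' = st''"
proof (induction arbitrary: u st'' rule: exec.induct)
  case (exec_PolyDiv p s x r y l A B Q R C D)
  from exec_PolyDiv.prems exec_PolyDiv.hyps show ?case
    by cases (auto dest: is_poly_div_unique)
next
  case (exec_Seq c st t st' d t' stf)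
  from exec_Seq.prems
  obtain t1 st1 t2 where *: "u = t1 + t2" "exec tI tM tD c st t1 st1" "exec tI tM tD d st1 t2 st''"
    by cases auto
  from exec_Seq.IH(1)[OF *(2)] have 1: "t = t1" "st' = st1" by auto
  from exec_Seq.IH(2)[of t2 st''] *(3) 1 have "t' = t2 \<and> stf = st''" by simp
  with 1 *(1) show ?case by simp
next
  case (exec_WhilePos_true st x c t st' t' stf)
  from exec_WhilePos_true.prems exec_WhilePos_true.hyps(1)
  obtain t1 st1 t2 where *: "u = 1 + t1 + t2" "exec tI tM tD c st t1 st1"
      "exec tI tM tD (WhilePos x c) st1 t2 st''"
    by cases auto
  from exec_WhilePos_true.IH(1)[OF *(2)] have 1: "t = t1" "st' = st1" by auto
  from exec_WhilePos_true.IH(2)[of t2 st''] *(3) 1 have "t' = t2 \<and> stf = st''" by simp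
  with 1 *(1) show ?case by simp
next
  case (exec_IfPos_true st x c t st' d)
  from exec_IfPos_true.prems show ?case
    by cases (use exec_IfPos_true.IH[of "u - 1" st''] exec_IfPos_true.hyps(1) in auto)
next
  case (exec_IfPos_false st x d t st' c)
  from exec_IfPos_false.prems show ?case
    by cases (use exec_IfPos_false.IH[of "u - 1" st''] exec_IfPos_false.hyps(1) in auto)
qed (auto elim: exec.cases)


section \<open>Input, output and running time\<close>

definition input_state :: "nat \<Rightarrow> nat \<Rightarrow> weierstrass \<Rightarrow> int \<Rightarrow> state" where
  "input_state p N E e =
     ((\<lambda>_. 0)(0 := int p, 1 := int N, 2 := a1 E, 3 := a2 E, 4 := a3 E, 5 := a4 E, 6 := a6 E,
              7 := e),
      \<lambda>_. [])"

text \<open>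
  A series without constant term modulo the ideal (p^N, p^(N-1) t, ..., t^N): the coefficient of
  t^k modulo p^(N-k) for k = 1, ..., N-1.
\<close>

definition mod_I :: "nat \<Rightarrow> (nat \<Rightarrow> nat \<Rightarrow> int) \<Rightarrow> int list" where
  "mod_I N \<sigma> = map (\<lambda>k. \<sigma> k (N - k)) [1..<N]"

text \<open>
  Principal filter: the bound holds on all of S, uniformly in all parameters.
\<close>

definition soft_O :: "'a set \<Rightarrow> ('a \<Rightarrow> nat) \<Rightarrow> ('a \<Rightarrow> real) \<Rightarrow> bool" where
  "soft_O S f g \<longleftrightarrow>
     (\<exists>k::nat. (\<lambda>x. real (f x)) \<in> O[principal S](\<lambda>x. g x * ln (g x) ^ k))"

end

theory Submission
  imports Defs
begin

text \<open>
  Write w = t^3 h.  Then \<omega> = dt / D with D a polynomial in t and h, and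
  t \<zeta>(t) = 1 - (a1 / 2) t + ... is obtained by integrating (x + c) \<omega> termwise; finally \<sigma> = t g where
  t g' = C g and 1 + C = t \<zeta> / D.  Both h and g are computed by Newton iterations on series with N - 1
  terms modulo \<open>p^(16 N)\<close>.  Each iteration needs a constant number of polynomial operations and, for g,
  termwise divisions by exponents, which lose only O(N) digits in total as the number of correct terms doubles.

  Replacing the Eisenstein value by its residue modulo \<open>p^(N-3)\<close> multiplies \<sigma> by exp V, where the
  coefficient of t^k in V is divisible by \<open>p^(N-1-k)\<close>, because the double integral costs at most
  k - 2 digits.  So the exact solution over the rationals for this residue is congruent to \<sigma> modulo the
  ideal, and in particular its coefficients are integral at p, which is what makes the divisions in
  the Newton iteration for g possible modulo a power of p.
\<close>

section \<open>Congruences between truncated power series\<close>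

text \<open>The obstacle is division by exponents: in \<open>Z/p^M\<close> it makes sense only if
  the dividend is known to enough digits to be a multiple of the divisor, and the quotient is then
  known to fewer digits. So every array is described by two numbers, how many coefficients are right
  and to how many digits (\<open>approx\<close>). The \<open>16 N\<close> digits are spent as
  follows: 12 on the constant \<open>c\<close>, fewer than \<open>N\<close> on the integration that
  gives zeta, and \<open>2 j\<close> on each passage from \<open>j\<close> to \<open>2 j\<close>
  terms of sigma, less than \<open>4 N\<close> in all; what remains covers the answer.

  All estimates concern rational power series. There the exact solution is the exponential of an
  integral, and the given sigma enters through its residues.

  For the running time, a pass over \<open>N\<close> coefficients with operations on
  \<open>O(N log p)\<close> bits already costs about \<open>N^2 log p\<close>. The search inside a
  division may take about \<open>N\<close> rounds for each of \<open>N\<close> coefficients, so its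
  rounds must handle only numbers of size \<open>O(N)\<close>.\<close>

lemma p_integral_of_int [simp]: "prime p \<Longrightarrow> p_integral p (of_int a)"
  unfolding p_integral_def by (rule exI[of _ a], rule exI[of _ 1]) (auto dest: prime_gt_1_nat)

lemma p_integral_of_nat [simp]: "prime p \<Longrightarrow> p_integral p (of_nat a)"
  using p_integral_of_int[of p "int a"] by simp

lemma p_integral_0 [simp]: "prime p \<Longrightarrow> p_integral p 0"
  using p_integral_of_int[of p 0] by simp

lemma p_integral_1 [simp]: "prime p \<Longrightarrow> p_integral p 1"
  using p_integral_of_int[of p 1] by simp

lemma p_integral_numeral [simp]: "prime p \<Longrightarrow> p_integral p (numeral n)"
  using p_integral_of_int[of p "numeral n"] by simp

lemma p_integral_add:
  assumes "prime p" "p_integral p x" "p_integral p y"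
  shows "p_integral p (x + y)"
proof -
  obtain a b c d where *: "\<not> int p dvd b" "x = of_int a / of_int b"
    "\<not> int p dvd d" "y = of_int c / of_int d"
    using assms unfolding p_integral_def by blast
  have "b \<noteq> 0" "d \<noteq> 0" using * by auto
  hence "x + y = of_int (a * d + c * b) / of_int (b * d)"
    using * by (simp add: field_simps)
  moreover have "\<not> int p dvd b * d" using * assms(1) by (simp add: prime_dvd_mult_iff)
  ultimately show ?thesis unfolding p_integral_def by blast
qed

lemma p_integral_mult:
  assumes "prime p" "p_integral p x" "p_integral p y"
  shows "p_integral p (x * y)"
proof -
  obtain a b c d where *: "\<not> int p dvd b" "x = of_int a / of_int b"
    "\<not> int p dvd d" "y = of_int c / of_int d"
    using assms unfolding p_integral_def by blast
  have "x * y = of_int (a * c) / of_int (b * d)"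
    using * by simp
  moreover have "\<not> int p dvd b * d" using * assms(1) by (simp add: prime_dvd_mult_iff)
  ultimately show ?thesis unfolding p_integral_def by blast
qed

lemma p_integral_minus: "prime p \<Longrightarrow> p_integral p x \<Longrightarrow> p_integral p (- x)"
  using p_integral_mult[of p "-1" x] p_integral_of_int[of p "-1"] by simp

lemma p_integral_diff:
  "prime p \<Longrightarrow> p_integral p x \<Longrightarrow> p_integral p y \<Longrightarrow> p_integral p (x - y)"
  using p_integral_add[of p x "- y"] p_integral_minus[of p y] by simp

lemma p_integral_power: "prime p \<Longrightarrow> p_integral p x \<Longrightarrow> p_integral p (x ^ n)"
  by (induction n) (auto intro: p_integral_mult)

lemma p_integral_sum:
  "prime p \<Longrightarrow> (\<And>i. i \<in> A \<Longrightarrow> p_integral p (f i)) \<Longrightarrow> p_integral p (sum f A)"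
  by (induction A rule: infinite_finite_induct) (auto intro: p_integral_add)

lemma p_integral_inverse_int: "\<not> int p dvd d \<Longrightarrow> p_integral p (1 / of_int d)"
  unfolding p_integral_def by (rule exI[of _ 1], rule exI[of _ d]) simp

text \<open>Bridge to integer congruences: clearing the denominator gives
  \<open>a * d = c * p^n\<close> with \<open>d\<close> prime to \<open>p\<close>, and coprimality
  moves \<open>p^n\<close> into \<open>a\<close>.\<close>

lemma p_integral_of_int_div_iff:
  assumes "prime p"
  shows "p_integral p (of_int a / of_nat p ^ n) \<longleftrightarrow> int p ^ n dvd a"
proof
  assume "p_integral p (of_int a / of_nat p ^ n)"
  then obtain c d where *: "\<not> int p dvd d" "(of_int a / of_nat p ^ n :: rat) = of_int c / of_int d"
    unfolding p_integral_def by blast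
  have "d \<noteq> 0" "p \<noteq> 0" using * assms by (auto dest: prime_gt_0_nat)
  hence "(of_int a * of_int d :: rat) = of_int c * of_nat p ^ n"
    using *(2) by (simp add: field_simps)
  hence "(of_int (a * d) :: rat) = of_int (c * int p ^ n)" by simp
  hence "a * d = c * int p ^ n" by (simp only: of_int_eq_iff)
  hence "int p ^ n dvd a * d" by simp
  moreover have "coprime (int p ^ n) d"
    using * assms by (simp add: prime_imp_coprime)
  ultimately show "int p ^ n dvd a"
    by (simp add: coprime_dvd_mult_left_iff)
next
  assume "int p ^ n dvd a"
  then obtain c where "a = int p ^ n * c" by blast
  moreover have "p \<noteq> 0" using assms by (auto dest: prime_gt_0_nat)
  ultimately have "(of_int a / of_nat p ^ n :: rat) = of_int c" by simp
  thus "p_integral p (of_int a / of_nat p ^ n)" using assms by simp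
qed

lemma p_integral_div_weaken:
  assumes "prime p" "p_integral p (x / of_nat p ^ m)" "n \<le> m"
  shows "p_integral p (x / of_nat p ^ n)"
proof -
  have "p \<noteq> 0" using assms by (auto dest: prime_gt_0_nat)
  hence "x / of_nat p ^ n = x / of_nat p ^ m * of_nat p ^ (m - n)"
    using assms by (simp add: power_diff)
  moreover have "p_integral p \<dots>"
    using assms by (intro p_integral_mult p_integral_power) auto
  ultimately show ?thesis by simp
qed

lemma rat_cong_sym: "prime p \<Longrightarrow> rat_cong p n x y \<Longrightarrow> rat_cong p n y x"
  unfolding rat_cong_def using p_integral_minus[of p "(x - y) / of_nat p ^ n"]
  by (simp add: field_simps minus_divide_left)

lemma rat_cong_trans:
  "prime p \<Longrightarrow> rat_cong p n x y \<Longrightarrow> rat_cong p n y z \<Longrightarrow> rat_cong p n x z"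
  unfolding rat_cong_def
  using p_integral_add[of p "(x - y) / of_nat p ^ n" "(y - z) / of_nat p ^ n"]
  by (simp add: diff_divide_distrib)

lemma rat_cong_weaken: "prime p \<Longrightarrow> rat_cong p m x y \<Longrightarrow> n \<le> m \<Longrightarrow> rat_cong p n x y"
  unfolding rat_cong_def by (rule p_integral_div_weaken)

lemma rat_cong_of_int_iff:
  "prime p \<Longrightarrow> rat_cong p n (of_int a) (of_int b) \<longleftrightarrow> [a = b] (mod int p ^ n)"
  unfolding rat_cong_def cong_iff_dvd_diff
  using p_integral_of_int_div_iff[of p "a - b" n] by simp

text \<open>The bounds are independent: \<open>j\<close> counts coefficients, \<open>m\<close>
  counts p-adic digits. With \<open>m = 0\<close> the predicate says that the first \<open>j\<close>
  coefficients are integral, so one notion serves for errors and for integrality.\<close>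

definition fps_small :: "nat \<Rightarrow> nat \<Rightarrow> nat \<Rightarrow> rat fps \<Rightarrow> bool" where
  "fps_small p j m f \<longleftrightarrow> (\<forall>k<j. p_integral p (fps_nth f k / of_nat p ^ m))"

lemma fps_smallD: "fps_small p j m f \<Longrightarrow> k < j \<Longrightarrow> p_integral p (fps_nth f k / of_nat p ^ m)"
  by (auto simp: fps_small_def)

lemma fps_small_0I: "prime p \<Longrightarrow> (\<And>k. k < j \<Longrightarrow> fps_nth f k = 0) \<Longrightarrow> fps_small p j m f"
  by (simp add: fps_small_def)

lemma fps_small_mono:
  "prime p \<Longrightarrow> fps_small p j m f \<Longrightarrow> j' \<le> j \<Longrightarrow> m' \<le> m \<Longrightarrow> fps_small p j' m' f"
  unfolding fps_small_def by (meson order_less_le_trans p_integral_div_weaken)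

lemma fps_small_add:
  "prime p \<Longrightarrow> fps_small p j m f \<Longrightarrow> fps_small p j m g \<Longrightarrow> fps_small p j m (f + g)"
  by (auto simp: fps_small_def add_divide_distrib intro: p_integral_add)

lemma fps_small_diff:
  "prime p \<Longrightarrow> fps_small p j m f \<Longrightarrow> fps_small p j m g \<Longrightarrow> fps_small p j m (f - g)"
  by (auto simp: fps_small_def diff_divide_distrib intro: p_integral_diff)

lemma fps_small_minus: "prime p \<Longrightarrow> fps_small p j m f \<Longrightarrow> fps_small p j m (- f)"
  using fps_small_diff[of p j m 0 f] by (simp add: fps_small_0I)

lemma fps_small_mult:
  assumes "prime p" "fps_small p j m f" "fps_small p j n g"
  shows "fps_small p j (m + n) (f * g)"
  unfolding fps_small_def
proof (intro allI impI)
  fix k assume "k < j"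
  have "fps_nth (f * g) k / of_nat p ^ (m + n) =
      (\<Sum>i=0..k. (fps_nth f i / of_nat p ^ m) * (fps_nth g (k - i) / of_nat p ^ n))"
    by (simp add: fps_mult_nth sum_divide_distrib power_add)
  also have "p_integral p \<dots>"
    using assms \<open>k < j\<close> by (intro p_integral_sum p_integral_mult) (auto simp: fps_small_def)
  finally show "p_integral p (fps_nth (f * g) k / of_nat p ^ (m + n))" .
qed

lemma fps_small_mult_left:
  "prime p \<Longrightarrow> fps_small p j 0 f \<Longrightarrow> fps_small p j m g \<Longrightarrow> fps_small p j m (f * g)"
  using fps_small_mult[of p j 0 f m g] by simp

lemma fps_small_mult_right:
  "prime p \<Longrightarrow> fps_small p j m f \<Longrightarrow> fps_small p j 0 g \<Longrightarrow> fps_small p j m (f * g)"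
  using fps_small_mult[of p j m f 0 g] by simp

lemma fps_small_const:
  "prime p \<Longrightarrow> p_integral p (x / of_nat p ^ m) \<Longrightarrow> fps_small p j m (fps_const x)"
  by (simp add: fps_small_def)

lemma fps_small_of_int [simp]: "prime p \<Longrightarrow> fps_small p j 0 (of_int a)"
  using fps_small_const[of p "of_int a" 0 j] by (simp add: fps_of_int)

lemma fps_small_one [simp]: "prime p \<Longrightarrow> fps_small p j 0 1"
  using fps_small_of_int[of p j 1] by simp

lemma fps_small_numeral [simp]: "prime p \<Longrightarrow> fps_small p j 0 (numeral n)"
  using fps_small_of_int[of p j "numeral n"] by simp

lemma fps_small_X [simp]: "prime p \<Longrightarrow> fps_small p j 0 fps_X"
  by (simp add: fps_small_def fps_X_def)

lemma fps_small_power: "prime p \<Longrightarrow> fps_small p j 0 f \<Longrightarrow> fps_small p j 0 (f ^ n)"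
  by (induction n) (auto intro: fps_small_mult_left)

lemma fps_small_X_mult:
  "prime p \<Longrightarrow> fps_small p j m f \<Longrightarrow> fps_small p (Suc j) m (fps_X * f)"
  by (auto simp: fps_small_def less_Suc_eq_0_disj)

text \<open>The Euler operator multiplies the coefficient of \<open>t^k\<close> by \<open>k\<close>;
  unlike the plain derivative it does not shift the window of controlled coefficients. The
  differential equations for sigma are therefore written with
  \<open>fps_X * fps_deriv\<close>.\<close>

lemma fps_small_deriv:
  assumes "prime p" "fps_small p j m f"
  shows "fps_small p j m (fps_X * fps_deriv f)"
  unfolding fps_small_def
proof (intro allI impI)
  fix k assume "k < j"
  have "fps_nth (fps_X * fps_deriv f) k / of_nat p ^ m = of_nat k * (fps_nth f k / of_nat p ^ m)"
    by (cases k) simp_all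
  also have "p_integral p \<dots>"
    using assms \<open>k < j\<close> by (intro p_integral_mult) (auto simp: fps_small_def)
  finally show "p_integral p (fps_nth (fps_X * fps_deriv f) k / of_nat p ^ m)" .
qed

text \<open>A factor with constant coefficient 1 is removed by a triangular recursion that involves
  no division.\<close>

lemma fps_small_cancel:
  assumes p: "prime p" and d: "fps_small p j 0 d" "fps_nth d 0 = 1"
    and fd: "fps_small p j m (f * d)"
  shows "fps_small p j m f"
proof -
  have "k < j \<longrightarrow> p_integral p (fps_nth f k / of_nat p ^ m)" for k
  proof (induction k rule: less_induct)
    case (less k)
    show ?case
    proof
      assume k: "k < j"
      have "fps_nth (f * d) k = (\<Sum>i<k. fps_nth f i * fps_nth d (k - i)) + fps_nth f k"
        by (simp add: fps_mult_nth atLeast0AtMost d(2) flip: lessThan_Suc_atMost)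
      hence "fps_nth f k / of_nat p ^ m = fps_nth (f * d) k / of_nat p ^ m -
          (\<Sum>i<k. fps_nth f i / of_nat p ^ m * fps_nth d (k - i))"
        by (simp add: add_divide_distrib sum_divide_distrib)
      also have "p_integral p \<dots>"
        using p d(1) fd k less
        by (intro p_integral_diff p_integral_sum p_integral_mult) (auto simp: fps_small_def)
      finally show "p_integral p (fps_nth f k / of_nat p ^ m)" .
    qed
  qed
  thus ?thesis by (simp add: fps_small_def)
qed

lemma fps_small_inverse:
  assumes "prime p" "fps_small p j 0 d" "fps_nth d 0 = 1"
  shows "fps_small p j 0 (inverse d)"
  using assms by (intro fps_small_cancel[of p j d 0 "inverse d"])
    (simp_all add: inverse_mult_eq_1)

text \<open>In every term of the Cauchy product one index is below j.  This is what makes the Newton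
  iterations quadratic.\<close>

lemma fps_small_square:
  assumes p: "prime p" and f: "fps_small p j m f" "fps_small p n 0 f"
    and g: "fps_small p j m g" "fps_small p n 0 g"
  shows "fps_small p (min (2 * j) n) m (f * g)"
  unfolding fps_small_def
proof (intro allI impI)
  fix k assume k: "k < min (2 * j) n"
  have "fps_nth (f * g) k / of_nat p ^ m = (\<Sum>i=0..k. fps_nth f i * fps_nth g (k - i) / of_nat p ^ m)"
    by (simp add: fps_mult_nth sum_divide_distrib)
  also have "p_integral p \<dots>"
  proof (rule p_integral_sum[OF p])
    fix i assume i: "i \<in> {0..k}"
    show "p_integral p (fps_nth f i * fps_nth g (k - i) / of_nat p ^ m)"
    proof (cases "i < j")
      case True
      have "p_integral p (fps_nth f i / of_nat p ^ m * fps_nth g (k - i))"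
        using True i k fps_smallD[OF f(1) True] fps_smallD[OF g(2), of "k - i"]
        by (intro p_integral_mult[OF p]) auto
      thus ?thesis by simp
    next
      case False
      hence "k - i < j" using k i by auto
      hence "p_integral p (fps_nth f i * (fps_nth g (k - i) / of_nat p ^ m))"
        using i k fps_smallD[OF g(1), of "k - i"] fps_smallD[OF f(2), of i]
        by (intro p_integral_mult[OF p]) auto
      thus ?thesis by simp
    qed
  qed
  finally show "p_integral p (fps_nth (f * g) k / of_nat p ^ m)" .
qed

text \<open>Collecting the multiples of \<open>p\<close> among \<open>1, ..., j\<close> gives
  \<open>j! = p^q q! u\<close> with \<open>q = j div p\<close> and \<open>u\<close> prime to
  \<open>p\<close>. As \<open>2 q \<le> j\<close>, the quotient for \<open>j\<close> is an integral
  multiple of the one for \<open>q\<close>, which closes the strong induction.\<close>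

lemma p_integral_pow_div_fact:
  assumes p: "prime p"
  shows "p_integral p (of_nat p ^ j / fact j)"
proof (induction j rule: less_induct)
  case (less j)
  have legendre: "\<exists>u. \<not> int p dvd u \<and> fact j = int p ^ (j div p) * fact (j div p) * u" for j
  proof (induction j)
    case 0
    show ?case using p by (intro exI[of _ 1]) (auto dest: prime_gt_1_nat)
  next
    case (Suc j)
    then obtain u where u: "\<not> int p dvd u" "fact j = int p ^ (j div p) * fact (j div p) * u"
      by blast
    show ?case
    proof (cases "p dvd Suc j")
      case True
      hence "Suc j div p = Suc (j div p)" by (simp add: div_Suc mod_eq_0_iff_dvd)
      moreover have "Suc j = p * (Suc j div p)" using True by simp
      ultimately have "int (Suc j) = int p * int (Suc (j div p))"
        by (metis of_nat_mult)
      hence "fact (Suc j) = int p ^ (Suc j div p) * fact (Suc j div p) * u"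
        using u(2) \<open>Suc j div p = _\<close> by (simp add: algebra_simps flip: of_nat_Suc)
      thus ?thesis using u by blast
    next
      case False
      hence "Suc j div p = j div p" by (simp add: div_Suc mod_eq_0_iff_dvd)
      hence "fact (Suc j) = int p ^ (Suc j div p) * fact (Suc j div p) * (u * int (Suc j))"
        using u(2) by (simp add: algebra_simps)
      moreover have "\<not> int p dvd int (Suc j)" using False int_dvd_int_iff by blast
      hence "\<not> int p dvd u * int (Suc j)" using u p by (simp add: prime_dvd_mult_iff del: of_nat_Suc)
      ultimately show ?thesis by blast
    qed
  qed
  show ?case
  proof (cases "j = 0")
    case True
    thus ?thesis using p by simp
  next
    case False
    define q where "q = j div p"
    have p2: "p \<ge> 2" using p by (rule prime_ge_2_nat)
    have "q < j" using False p2 by (simp add: q_def)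
    have "p * q \<le> j" by (simp add: q_def)
    moreover have "2 * q \<le> p * q" using p2 by simp
    ultimately have "2 * q \<le> j" by linarith
    obtain u where u: "\<not> int p dvd u" "fact j = int p ^ q * fact q * u"
      using legendre[of j] by (auto simp: q_def)
    have "(fact j :: rat) = of_int (fact j)" by simp
    also have "\<dots> = of_nat p ^ q * fact q * of_int u" by (simp add: u)
    finally have "(of_nat p ^ j / fact j :: rat) =
        of_nat p ^ (j - 2 * q) * (of_nat p ^ q / fact q) * (1 / of_int u)"
      using \<open>2 * q \<le> j\<close> p2 by (simp add: power_diff power2_eq_square power_mult mult_2 power_add)
    also have "p_integral p \<dots>"
      using p less[OF \<open>q < j\<close>] u
      by (intro p_integral_mult p_integral_power p_integral_inverse_int) auto
    finally show ?thesis .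
  qed
qed

text \<open>Division by k costs at most k p-adic digits; this crude bound is all that is needed.\<close>

lemma p_part_exists:
  assumes p: "prime p" and k: "0 < k"
  obtains v u :: nat where "k = p ^ v * u" "\<not> p dvd u" "v < k"
proof -
  define v where "v = multiplicity p k"
  obtain u where u: "k = p ^ v * u" "\<not> p dvd u"
    using multiplicity_decompose'[of k p] k p unfolding v_def
    by (metis not_prime_unit neq0_conv)
  have "v < p ^ v" using p by (intro less_exp[THEN order_less_le_trans] power_mono)
      (auto dest: prime_ge_2_nat)
  also have "\<dots> \<le> k" using k u by (metis dvd_imp_le dvd_triv_left)
  finally show ?thesis using u that by blast
qed

lemma p_integral_pow_div:
  assumes "prime p" "0 < k" "k \<le> n"
  shows "p_integral p (of_nat p ^ n / of_nat k)"
proof -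
  obtain v u where *: "k = p ^ v * u" "\<not> p dvd u" "v < k" using p_part_exists assms by metis
  hence "v \<le> n" using assms(3) by linarith
  moreover have "p \<noteq> 0" using assms by (auto dest: prime_gt_0_nat)
  moreover have "(of_nat k :: rat) = of_nat p ^ v * of_nat u" by (subst *(1)) simp
  ultimately have "(of_nat p ^ n / of_nat k :: rat) = of_nat p ^ (n - v) * (1 / of_int (int u))"
    by (simp add: power_diff)
  also have "p_integral p \<dots>"
    using assms(1) *(2) by (intro p_integral_mult p_integral_power p_integral_inverse_int) auto
  finally show ?thesis .
qed

section \<open>The formal expansions as power series\<close>

text \<open>The equation of w_series is divided by t^3, so that only units remain: w = t^3 (1 + ...), and
  the invariant differential is dt / omega_inv, the denominator being the w-derivative of the
  equation.\<close>

definition w_unit :: "weierstrass \<Rightarrow> rat fps" where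
  "w_unit E = fps_shift 3 (w_series E)"

definition omega_inv :: "weierstrass \<Rightarrow> rat fps" where
  "omega_inv E = 1 - of_int (a1 E) * fps_X - of_int (a2 E) * fps_X^2
     - 2 * (of_int (a3 E) * fps_X^3 + of_int (a4 E) * fps_X^4) * w_unit E
     - 3 * of_int (a6 E) * fps_X^6 * (w_unit E)^2"

text \<open>Moving every term that contains \<open>w\<close> to the left turns the equation into
  \<open>w * u = t^3\<close> with \<open>u\<close> a unit.\<close>

lemma w_series_eq: "w_series E = fps_X^3 * w_unit E"
proof -
  define u where "u = 1 - of_int (a1 E) * fps_X - of_int (a2 E) * fps_X^2 - of_int (a3 E) * w_series E
     - of_int (a4 E) * fps_X * w_series E - of_int (a6 E) * (w_series E)^2"
  have w: "w_series E $ 0 = 0"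
    "w_series E = fps_X^3 + of_int (a1 E) * fps_X * w_series E + of_int (a2 E) * fps_X^2 * w_series E
         + of_int (a3 E) * (w_series E)^2 + of_int (a4 E) * fps_X * (w_series E)^2
         + of_int (a6 E) * (w_series E)^3"
    using w_series[of E] by (auto simp: w_equation_def)
  have "u $ 0 = 1" by (simp add: u_def w(1) power2_eq_square)
  have "w_series E * u = fps_X ^ 3"
    using w(2) unfolding u_def by algebra
  hence "w_series E * (u * inverse u) = fps_X ^ 3 * inverse u" by (simp add: mult.assoc)
  moreover have "u * inverse u = 1"
    using \<open>u $ 0 = 1\<close> by (simp add: inverse_mult_eq_1')
  ultimately have *: "w_series E = fps_X ^ 3 * inverse u" by simp
  have "w_unit E = inverse u"
    unfolding w_unit_def * by (rule fps_ext) (simp add: fps_X_power_mult_nth)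
  with * show ?thesis by simp
qed

lemma w_unit_eq:
  "w_unit E = 1 + of_int (a1 E) * fps_X * w_unit E + of_int (a2 E) * fps_X^2 * w_unit E
     + (of_int (a3 E) * fps_X^3 + of_int (a4 E) * fps_X^4) * (w_unit E)^2
     + of_int (a6 E) * fps_X^6 * (w_unit E)^3"
proof -
  let ?h = "w_unit E"
  have "fps_X^3 * ?h = fps_X^3 + of_int (a1 E) * fps_X * (fps_X^3 * ?h)
         + of_int (a2 E) * fps_X^2 * (fps_X^3 * ?h)
         + of_int (a3 E) * (fps_X^3 * ?h)^2 + of_int (a4 E) * fps_X * (fps_X^3 * ?h)^2
         + of_int (a6 E) * (fps_X^3 * ?h)^3"
    using w_series[of E] unfolding w_equation_def w_series_eq by blast
  hence "fps_X^3 * ?h = fps_X^3 * (1 + of_int (a1 E) * fps_X * ?h + of_int (a2 E) * fps_X^2 * ?h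
     + (of_int (a3 E) * fps_X^3 + of_int (a4 E) * fps_X^4) * ?h^2 + of_int (a6 E) * fps_X^6 * ?h^3)"
    by (simp add: algebra_simps power2_eq_square power3_eq_cube power4_eq_xxxx
        numeral_eq_Suc)
  thus ?thesis by (metis fps_X_neq_zero mult_left_cancel power_not_zero)
qed

lemma w_unit_nth_0 [simp]: "w_unit E $ 0 = 1"
  by (subst w_unit_eq) simp

lemma omega_inv_nth_0 [simp]: "omega_inv E $ 0 = 1"
  by (simp add: omega_inv_def)

text \<open>Apart from 1, every term of the recursion carries a factor \<open>t\<close>, so
  integrality of \<open>j\<close> coefficients yields one more.\<close>

lemma fps_small_w_unit:
  assumes "prime p"
  shows "fps_small p j 0 (w_unit E)"
proof (induction j)
  case 0
  show ?case by (simp add: fps_small_def)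
next
  case (Suc j)
  let ?h = "w_unit E"
  have "fps_small p (Suc j) 0 (1 + fps_X * (of_int (a1 E) * ?h + of_int (a2 E) * fps_X * ?h
     + (of_int (a3 E) * fps_X^2 + of_int (a4 E) * fps_X^3) * ?h^2
     + of_int (a6 E) * fps_X^5 * ?h^3))"
    using assms Suc
    by (intro fps_small_add fps_small_X_mult fps_small_mult_left fps_small_power) auto
  moreover have "1 + fps_X * (of_int (a1 E) * ?h + of_int (a2 E) * fps_X * ?h
     + (of_int (a3 E) * fps_X^2 + of_int (a4 E) * fps_X^3) * ?h^2
     + of_int (a6 E) * fps_X^5 * ?h^3) = ?h"
    using w_unit_eq[of E] by algebra
  ultimately show ?case by simp
qed

lemma fps_small_omega_inv: "prime p \<Longrightarrow> fps_small p j 0 (omega_inv E)"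
  unfolding omega_inv_def
  by (intro fps_small_diff fps_small_add fps_small_mult_left fps_small_power fps_small_w_unit) auto

lemma x_series_eq: "x_series E = fps_to_fls (inverse (w_unit E)) / fls_X ^ 2"
proof -
  have "fps_to_fls (w_unit E) * fps_to_fls (inverse (w_unit E)) = 1"
    by (simp add: fls_times_fps_to_fls[symmetric] inverse_mult_eq_1')
  moreover have "fps_to_fls (w_unit E) \<noteq> 0"
    using w_unit_nth_0[of E] by (metis fps_to_fls_eq_0_iff fps_zero_nth zero_neq_one)
  moreover have "fps_to_fls (fps_X ^ 3 * w_unit E) = fls_X ^ 3 * fps_to_fls (w_unit E)"
    by (simp add: fls_times_fps_to_fls fps_to_fls_power fps_X_to_fls)
  ultimately show ?thesis
    unfolding x_series_def w_series_eq
    by (simp add: field_simps power2_eq_square power3_eq_cube)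
qed

text \<open>From \<open>x = t/w\<close> and \<open>y = -1/w\<close> come
  \<open>dx = (w - t w') / w^2 dt\<close> and \<open>2y + a1 x + a3 = F / w\<close>. Implicit
  differentiation makes \<open>w' D\<close> a polynomial in \<open>t\<close> and \<open>w\<close>;
  with the curve equation this gives \<open>(w - t w') D = w F\<close>, and \<open>F\<close> and
  \<open>w\<close> cancel.\<close>

lemma omega_series_eq: "omega_series E = 1 / fps_to_fls (omega_inv E)"
proof -
  define W X D x where "W = fps_to_fls (w_series E)" and "X = (fls_X :: rat fls)"
    and "D = fps_to_fls (omega_inv E)" and "x = x_series E"
  define A1 A2 A3 A4 A6 :: "rat fls" where
    "A1 = of_int (a1 E)" "A2 = of_int (a2 E)" "A3 = of_int (a3 E)" "A4 = of_int (a4 E)"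
    "A6 = of_int (a6 E)"
  note A = A1_A2_A3_A4_A6_def
  have fls: "fps_to_fls (of_int a) = of_int a" for a by (rule fps_to_fls_of_int)
  have W: "W = X^3 + A1 * X * W + A2 * X^2 * W + A3 * W^2 + A4 * X * W^2 + A6 * W^3"
  proof -
    have "w_series E = fps_X^3 + of_int (a1 E) * fps_X * w_series E
        + of_int (a2 E) * fps_X^2 * w_series E + of_int (a3 E) * (w_series E)^2
        + of_int (a4 E) * fps_X * (w_series E)^2 + of_int (a6 E) * (w_series E)^3"
      using w_series[of E] by (simp add: w_equation_def)
    from arg_cong[OF this, of fps_to_fls] show ?thesis
      by (simp add: W_def X_def A fls fls_times_fps_to_fls fps_to_fls_power fps_X_to_fls)
  qed
  have D: "D = 1 - A1 * X - A2 * X^2 - 2 * A3 * W - 2 * A4 * X * W - 3 * A6 * W^2"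
    unfolding D_def omega_inv_def W_def w_series_eq
    by (simp add: X_def A fls fls_times_fps_to_fls fps_to_fls_power fps_X_to_fls
        algebra_simps power2_eq_square power3_eq_cube power4_eq_xxxx numeral_eq_Suc)
  define W' where "W' = fls_deriv W"
  have dW: "W' = 3 * X^2 + A1 * (W + X * W') + A2 * (2 * X * W + X^2 * W') + 2 * A3 * W * W'
      + A4 * (W^2 + 2 * X * W * W') + 3 * A6 * W^2 * W'"
  proof -
    have "W' = fls_deriv (X^3 + A1 * X * W + A2 * X^2 * W + A3 * W^2 + A4 * X * W^2 + A6 * W^3)"
      using W unfolding W'_def by (rule arg_cong)
    also have "\<dots> = 3 * X^2 + A1 * (W + X * W') + A2 * (2 * X * W + X^2 * W') + 2 * A3 * W * W'
      + A4 * (W^2 + 2 * X * W * W') + 3 * A6 * W^2 * W'"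
      by (simp add: A X_def W'_def algebra_simps power2_eq_square power3_eq_cube)
    finally show ?thesis .
  qed
  have "W \<noteq> 0"
    using w_unit_nth_0[of E] unfolding W_def w_series_eq
    by (metis fps_X_neq_zero fps_to_fls_eq_0_iff fps_zero_nth mult_eq_0_iff power_not_zero
        zero_neq_one)
  have x: "x = X / W" by (simp add: x_def x_series_def X_def W_def)
  have y: "y_series E = - 1 / W" by (simp add: y_series_def W_def)
  have dx: "fls_deriv x * W^2 = W - X * W'"
  proof -
    have "x * W = X" using \<open>W \<noteq> 0\<close> by (simp add: x)
    from arg_cong[OF this, of fls_deriv] have "x * W' + fls_deriv x * W = 1"
      by (simp add: X_def W'_def)
    hence "W * (x * W' + fls_deriv x * W) - (x * W) * W' = W - X * W'"
      using \<open>x * W = X\<close> by simp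
    thus ?thesis by (simp add: algebra_simps power2_eq_square)
  qed
  define F where "F = - 2 + A1 * X + A3 * W"
  have "F = fps_to_fls (- 2 + of_int (a1 E) * fps_X + of_int (a3 E) * w_series E)"
    by (simp add: F_def A W_def X_def fls fls_times_fps_to_fls fps_X_to_fls)
  moreover have "(- 2 + of_int (a1 E) * fps_X + of_int (a3 E) * w_series E) $ 0 \<noteq> 0"
    using w_series[of E] by (simp add: w_equation_def)
  ultimately have "F \<noteq> 0" by (metis fps_to_fls_eq_0_iff fps_zero_nth)
  have den: "2 * y_series E + of_int (a1 E) * x_series E + of_int (a3 E) = F / W"
    using \<open>W \<noteq> 0\<close> by (simp add: y flip: x_def) (simp add: x F_def A field_simps)
  have "(W - X * W') * D = W * D - X * (W' * D)"
    by (simp add: algebra_simps)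
  also have "W' * D = 3 * X^2 + A1 * W + 2 * A2 * X * W + A4 * W^2"
    unfolding D using dW by algebra
  \<comment> \<open>The left side is \<open>W + A1 * X * W + A3 * W^2\<close> minus three times the
    right side of the curve equation; that is the origin of the \<open>-2\<close> in
    \<open>F\<close>.\<close>
  also have "W * D - X * (3 * X^2 + A1 * W + 2 * A2 * X * W + A4 * W^2) = W * F"
    unfolding D F_def using W by algebra
  finally have key: "(W - X * W') * D = W * F" .
  have "D \<noteq> 0"
    using omega_inv_nth_0[of E] unfolding D_def
    by (metis fps_to_fls_eq_0_iff fps_zero_nth zero_neq_one)
  have "omega_series E = fls_deriv x / (F / W)"
    unfolding omega_series_def den x_def ..
  also have "\<dots> = (fls_deriv x * W^2) / (F * W)"
    using \<open>W \<noteq> 0\<close> \<open>F \<noteq> 0\<close> by (simp add: field_simps power2_eq_square)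
  also have "\<dots> = ((W - X * W') * D) / (F * W * D)"
    using \<open>D \<noteq> 0\<close> by (simp add: dx)
  also have "\<dots> = 1 / D"
    unfolding key using \<open>W \<noteq> 0\<close> \<open>F \<noteq> 0\<close> by simp
  finally show ?thesis by (simp add: D_def)
qed

text \<open>Multiplying numerator and denominator by \<open>w\<close> leaves \<open>-t / q\<close>
  with \<open>q\<close> a unit, so the Laurent quotient is a power series and its regular part is
  all of it.\<close>

lemma formal_inverse_eq:
  "formal_inverse E = - (fps_X * inverse (1 - of_int (a1 E) * fps_X - of_int (a3 E) * w_series E))"
proof -
  define W where "W = fps_to_fls (w_series E)"
  define q where "q = 1 - of_int (a1 E) * fps_X - of_int (a3 E) * w_series E"
  have "w_series E $ 0 = 0"
    using w_series[of E] by (simp add: w_equation_def)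
  hence q0: "q $ 0 = 1" by (simp add: q_def)
  have "W \<noteq> 0"
    using w_unit_nth_0[of E] unfolding W_def w_series_eq
    by (metis fps_X_neq_zero fps_to_fls_eq_0_iff fps_zero_nth mult_eq_0_iff power_not_zero
        zero_neq_one)
  have q: "fps_to_fls q = 1 - of_int (a1 E) * fls_X - of_int (a3 E) * W"
    by (simp add: q_def W_def fls_times_fps_to_fls fps_to_fls_of_int fps_X_to_fls)
  have qi: "fps_to_fls (inverse q) * fps_to_fls q = 1"
    by (simp add: fls_times_fps_to_fls[symmetric] inverse_mult_eq_1 q0)
  have "fps_to_fls q \<noteq> 0"
    using q0 by (metis fps_to_fls_eq_0_iff fps_zero_nth zero_neq_one)
  have "- y_series E - of_int (a1 E) * x_series E - of_int (a3 E) = fps_to_fls q / W"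
    using \<open>W \<noteq> 0\<close> by (simp add: q y_series_def x_series_def W_def[symmetric] field_simps)
  hence "- x_series E / (- y_series E - of_int (a1 E) * x_series E - of_int (a3 E)) =
      - fls_X / fps_to_fls q"
    using \<open>W \<noteq> 0\<close> by (simp add: x_series_def W_def[symmetric])
  also have "\<dots> = fps_to_fls (- (fps_X * inverse q))"
    using qi \<open>fps_to_fls q \<noteq> 0\<close>
    by (simp add: fls_times_fps_to_fls fps_X_to_fls field_simps)
  finally show ?thesis
    unfolding formal_inverse_def q_def[symmetric] by (metis fls_regpart_fps_trivial)
qed

text \<open>This is \<open>t^2 (x + c) \<omega> / dt\<close>; the factor \<open>t^2\<close> clears
  the double pole of \<open>x\<close>.\<close>

definition xc_series :: "weierstrass \<Rightarrow> rat \<Rightarrow> rat fps" where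
  "xc_series E c = (inverse (w_unit E) + fps_const c * fps_X^2) * inverse (omega_inv E)"

text \<open>The series \<open>zeta_series / t\<close> is the logarithmic derivative of sigma with respect to the invariant
  differential, and sigma is t times sigma_unit.  The constant of integration, the coefficient of t
  in zeta_series, is fixed by oddness.\<close>

definition zeta_series :: "weierstrass \<Rightarrow> rat \<Rightarrow> rat fps" where
  "zeta_series E c = Abs_fps (\<lambda>k. if k = 0 then 1 else if k = 1 then - of_int (a1 E) / 2
     else - (fps_nth (xc_series E c) k) / (of_nat k - 1))"

text \<open>For sigma \<open>= t g\<close> this is \<open>t g' / g\<close>: the quotient of
  \<open>zeta_series\<close> by \<open>omega_inv\<close> is \<open>t\<close> times the logarithmic
  derivative of sigma, and the factor \<open>t\<close> of sigma contributes 1 to it.\<close>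

definition dlog_series :: "weierstrass \<Rightarrow> rat \<Rightarrow> rat fps" where
  "dlog_series E c = zeta_series E c * inverse (omega_inv E) - 1"

text \<open>The exponential of an integral exists over the rationals for every \<open>c\<close>;
  integrality at \<open>p\<close> is a separate matter, settled by comparison with the p-adic
  sigma.\<close>

definition sigma_unit :: "weierstrass \<Rightarrow> rat \<Rightarrow> rat fps" where
  "sigma_unit E c = fps_exp 1 oo fps_integral0 (fps_shift 1 (dlog_series E c))"

lemma inverse_omega_inv: "omega_inv E * inverse (omega_inv E) = 1"
  by (simp add: inverse_mult_eq_1')

lemma sigma_unit_nth_0 [simp]: "sigma_unit E c $ 0 = 1"
  by (simp add: sigma_unit_def)

lemma dlog_series_nth_0 [simp]: "dlog_series E c $ 0 = 0"
  by (simp add: dlog_series_def zeta_series_def)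

lemma fps_exp_compose_deriv:
  fixes F :: "rat fps"
  shows "fps_deriv (fps_exp 1 oo fps_integral0 F) = F * (fps_exp 1 oo fps_integral0 F)"
  by (simp add: fps_compose_deriv fps_deriv_fps_integral mult.commute)

lemma sigma_unit_deriv: "fps_X * fps_deriv (sigma_unit E c) = dlog_series E c * sigma_unit E c"
proof -
  have "fps_X * fps_shift 1 (dlog_series E c) = dlog_series E c"
    by (rule fps_ext) auto
  thus ?thesis
    unfolding sigma_unit_def fps_exp_compose_deriv by (simp add: mult.assoc[symmetric])
qed

text \<open>Since \<open>u\<close> has no constant term, the equation in degree \<open>k\<close>
  expresses \<open>k\<close> times the coefficient of \<open>t^k\<close> by earlier coefficients,
  and \<open>k\<close> is invertible over the rationals.\<close>

lemma fps_X_deriv_unique: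
  fixes f g u :: "rat fps"
  assumes "fps_X * fps_deriv f = u * f" "fps_X * fps_deriv g = u * g"
    and "u $ 0 = 0" "f $ 0 = g $ 0"
  shows "f = g"
proof (rule fps_ext)
  fix k
  show "f $ k = g $ k"
  proof (induction k rule: less_induct)
    case (less k)
    show ?case
    proof (cases k)
      case (Suc j)
      have *: "of_nat k * h $ k = (\<Sum>i=0..j. h $ i * u $ (k - i))"
        if "fps_X * fps_deriv h = u * h" for h
      proof -
        have "of_nat k * h $ k = (fps_X * fps_deriv h) $ k" by (simp add: Suc)
        also have "\<dots> = (h * u) $ k" by (simp add: that mult.commute)
        also have "\<dots> = (\<Sum>i=0..j. h $ i * u $ (k - i))"
          by (simp add: fps_mult_nth Suc assms(3))
        finally show ?thesis .
      qed
      have "of_nat k * f $ k = of_nat k * g $ k"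
        unfolding *[OF assms(1)] *[OF assms(2)] using less Suc by (intro sum.cong) auto
      thus ?thesis using Suc by (simp del: of_nat_Suc)
    qed (use assms in auto)
  qed
qed

text \<open>The bound v(k) + v(l) \<le> k - 2 is what lets a perturbation of the Eisenstein value by p^n
  survive two integrations: it changes sigma only within the ideal.\<close>

lemma two_valuation_bound:
  assumes p: "5 \<le> p" and k: "k = p ^ v * u" "2 \<le> k"
  shows "2 * v + 2 \<le> k"
proof (cases v)
  case (Suc w)
  have "2 * w + 4 \<le> 5 ^ Suc w" by (induction w) auto
  also have "\<dots> \<le> p ^ v" unfolding Suc using p by (rule power_mono) auto
  also have "\<dots> \<le> k" using k by (metis dvd_imp_le dvd_triv_left less_le_trans pos2)
  finally show ?thesis using Suc by simp
qed (use k in auto)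

text \<open>The divisors are the exponents met in the two successive integrations. Each has
  valuation at most half of \<open>k - 2\<close>; for \<open>l = 1\<close> the valuation is
  0.\<close>

lemma p_integral_pow_div_div:
  assumes p: "prime p" "5 \<le> p" and l: "0 < l" "l < k"
  shows "p_integral p (of_nat p ^ (k - 2) / (of_nat l * of_nat k))"
proof -
  obtain v u where k: "k = p ^ v * u" "\<not> p dvd u" "v < k" using p_part_exists p l
    by (metis bot_nat_0.not_eq_extremum not_less_zero)
  obtain v' u' where l': "l = p ^ v' * u'" "\<not> p dvd u'" "v' < l" using p_part_exists p l by metis
  have "2 * v + 2 \<le> k" using two_valuation_bound[OF p(2) k(1)] l by simp
  moreover have "2 * v' + 2 \<le> k"
    using two_valuation_bound[OF p(2) l'(1)] l l'(3) by (cases "l = 1") auto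
  ultimately have le: "v + v' \<le> k - 2" by simp
  have "p \<noteq> 0" using p by auto
  have "k - 2 = (k - 2 - (v + v')) + v + v'" using le by simp
  hence "(of_nat p ^ (k - 2) :: rat) = of_nat p ^ (k - 2 - (v + v')) * of_nat p ^ v * of_nat p ^ v'"
    by (metis power_add)
  moreover have "(of_nat k :: rat) = of_nat p ^ v * of_nat u" by (subst k(1)) simp
  moreover have "(of_nat l :: rat) = of_nat p ^ v' * of_nat u'" by (subst l'(1)) simp
  ultimately have "(of_nat p ^ (k - 2) / (of_nat l * of_nat k) :: rat) =
      of_nat p ^ (k - 2 - (v + v')) * (1 / of_int (int u)) * (1 / of_int (int u'))"
    using \<open>p \<noteq> 0\<close> by simp
  also have "p_integral p \<dots>"
    using p k(2) l'(2) by (intro p_integral_mult p_integral_power p_integral_inverse_int) auto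
  finally show ?thesis .
qed

lemma
  assumes p: "prime p" "5 \<le> p"
  shows p_integral_half: "p_integral p (1 / 2)" and p_integral_twelfth: "p_integral p (1 / 12)"
proof -
  have "\<not> p dvd 2" using p(2) by (auto dest: dvd_imp_le)
  moreover have "\<not> p dvd 3" using p by (auto dest: dvd_imp_le)
  ultimately have "\<not> p dvd 2 * 2 * 3" using p(1) prime_dvd_mult_iff by blast
  hence "\<not> int p dvd 12" "\<not> int p dvd 2"
    using \<open>\<not> p dvd 2\<close> int_dvd_int_iff[of p 12] int_dvd_int_iff[of p 2] by simp_all
  thus "p_integral p (1 / 2)" "p_integral p (1 / 12)"
    using p_integral_inverse_int[of p 2] p_integral_inverse_int[of p 12] by simp_all
qed

text \<open>Substituting \<open>p t\<close> for \<open>t\<close> turns the sloped condition that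
  \<open>p^(n-k)\<close> divides the coefficient of \<open>t^k\<close> into uniform divisibility by
  \<open>p^n\<close>, to which the estimates for products and exponentials apply.\<close>

definition fps_dilate :: "nat \<Rightarrow> rat fps \<Rightarrow> rat fps" where
  "fps_dilate p f = f oo (fps_const (of_nat p) * fps_X)"

lemma fps_dilate_nth [simp]: "fps_dilate p f $ k = of_nat p ^ k * f $ k"
  by (simp add: fps_dilate_def fps_compose_linear)

lemma fps_dilate_mult: "fps_dilate p (f * g) = fps_dilate p f * fps_dilate p g"
  by (simp add: fps_dilate_def fps_compose_mult_distrib)

text \<open>The \<open>i\<close>-th term is divisible by \<open>p^(i m) / i!\<close>. Beyond
  \<open>p^m\<close> there is a surplus \<open>(i - 1) m\<close>, which for
  \<open>i, m \<ge> 2\<close> is at least \<open>i\<close> and so pays for the factorial.\<close>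

lemma fps_small_exp:
  assumes p: "prime p" and m: "2 \<le> m" and V: "V $ 0 = 0" "fps_small p j m V"
  shows "fps_small p j m ((fps_exp 1 oo V) - 1)"
  unfolding fps_small_def
proof (intro allI impI)
  fix k assume k: "k < j"
  have p0: "p \<noteq> 0" using p by (auto dest: prime_gt_0_nat)
  have pow: "fps_small p j (i * m) (V ^ i)" for i
  proof (induction i)
    case (Suc i)
    thus ?case using fps_small_mult[OF p V(2) Suc] by simp
  qed (use p in auto)
  have exp_term: "p_integral p (V ^ i $ k / fact i / of_nat p ^ m)" if i: "0 < i" for i
  proof -
    have "(i - 1) * 2 \<le> (i - 1) * m" using m by simp
    hence "i \<le> (i - 1) * m \<or> i = 1" using i by linarith
    hence int: "p_integral p (of_nat p ^ ((i - 1) * m) / fact i)"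
    proof
      assume le: "i \<le> (i - 1) * m"
      have "(of_nat p ^ ((i - 1) * m) / fact i :: rat) = of_nat p ^ ((i - 1) * m - i) * (of_nat p ^ i / fact i)"
        using le p0 by (simp add: power_diff)
      also have "p_integral p \<dots>"
        using p by (intro p_integral_mult p_integral_power p_integral_pow_div_fact) auto
      finally show ?thesis .
    qed (use p in auto)
    have "i * m = (i - 1) * m + m" using i by (cases i) auto
    hence "V ^ i $ k / fact i / of_nat p ^ m =
        (V ^ i $ k / of_nat p ^ (i * m)) * (of_nat p ^ ((i - 1) * m) / fact i)"
      using p0 by (simp add: power_add)
    also have "p_integral p \<dots>"
      using p int fps_smallD[OF pow k] by (intro p_integral_mult) auto
    finally show ?thesis .
  qed
  have "((fps_exp 1 oo V) - 1) $ k = (\<Sum>i\<in>{0..k} - {0}. V ^ i $ k / fact i)"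
    by (simp add: fps_compose_nth sum.remove[of "{0..k}" 0])
  hence "((fps_exp 1 oo V) - 1) $ k / of_nat p ^ m = (\<Sum>i\<in>{0..k} - {0}. V ^ i $ k / fact i / of_nat p ^ m)"
    by (simp add: sum_divide_distrib)
  also have "p_integral p \<dots>" using p exp_term by (intro p_integral_sum) auto
  finally show "p_integral p (((fps_exp 1 oo V) - 1) $ k / of_nat p ^ m)" .
qed


section \<open>Comparison of the p-adic sigma function with the rational solution\<close>

lemma Zp_cong:
  assumes "z \<in> Zp p" "m \<le> n"
  shows "[z n = z m] (mod int p ^ m)"
  using assms(2)
proof (induction n rule: dec_induct)
  case (step n)
  have "z (Suc n) mod int p ^ n = z n" using assms(1) by (simp add: Zp_def)
  moreover have "z n \<in> {0..<int p ^ n}" using assms(1) by (simp add: Zp_def)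
  ultimately have "[z (Suc n) = z n] (mod int p ^ n)"
    by (metis cong_def mod_mod_trivial)
  hence "[z (Suc n) = z n] (mod int p ^ m)"
    using step(1) by (meson cong_dvd_modulus le_imp_power_dvd)
  thus ?case using step(3) cong_trans by blast
qed auto

text \<open>An approximate solution agrees modulo p^N with an exact solution for a nearby value of c, up to
  the factor exp V, where V is the double integral of the difference of the right-hand sides.\<close>

theorem sigma_unit_cong:
  assumes p: "prime p" "5 \<le> p" and N: "4 \<le> N" and e: "e \<in> Zp p"
    and sg: "is_padic_sigma p E e \<sigma>" and k: "k < N - 1"
    and c: "c = of_int ((a1 E)^2 + 4 * a2 E - e (N - 3)) / 12"
  shows "rat_cong p (N - 1 - k) (of_int (\<sigma> (k + 1) (N - 1 - k))) (sigma_unit E c $ k)"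
proof -
  have p0: "p \<noteq> 0" and p1: "1 < int p ^ N"
    using p N by (auto intro!: one_less_power)
  \<comment> \<open>The single level \<open>p^N\<close> suffices. Its representative
    \<open>G\<close> is an integer series with constant coefficient 1, so it can be inverted and
    differentiated over the rationals.\<close>
  define s G where "s = series_mod \<sigma> N" and "G = fps_shift 1 s"
  define D \<Omega> where "D = omega_inv E" and "\<Omega> = inverse D"
  define C' where "C' = fps_X * fps_deriv G * inverse G"
  \<comment> \<open>\<open>\<beta> / t\<close> is the logarithmic derivative of
    \<open>s = t G\<close> with respect to the invariant differential. Thus \<open>\<beta>\<close>
    is the counterpart of \<open>zeta_series\<close>, satisfying its equation only modulo
    \<open>p^N\<close>.\<close>
  define \<beta> where "\<beta> = D * (1 + C')"
  define c' :: rat where "c' = of_int ((a1 E)^2 + 4 * a2 E - e N) / 12"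
  have \<sigma>: "\<sigma> 0 N = 0" "\<sigma> 1 N = 1" "\<And>j. \<sigma> j \<in> Zp p"
    using sg p1 by (auto simp: is_padic_sigma_def Zp_of_int_def)
  have s: "s = fps_X * G"
    by (rule fps_ext) (auto simp: G_def s_def series_mod_def \<sigma>)
  have Gn: "G $ j = of_int (\<sigma> (Suc j) N)" for j by (simp add: G_def s_def series_mod_def)
  have G0: "G $ 0 = 1" using \<sigma> by (simp add: Gn)
  have smG: "fps_small p j 0 G" for j using p by (simp add: fps_small_def Gn)
  have GG: "G * inverse G = 1" using G0 by (simp add: inverse_mult_eq_1')
  have D\<Omega>: "D * \<Omega> = 1" by (simp add: D_def \<Omega>_def inverse_omega_inv)
  have smD: "fps_small p j 0 D" for j unfolding D_def by (rule fps_small_omega_inv[OF p(1)])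
  have sm\<Omega>: "fps_small p j 0 \<Omega>" for j
    unfolding \<Omega>_def using p smD by (intro fps_small_inverse) (auto simp: D_def)
  have G_ne: "G \<noteq> 0" "D \<noteq> 0" using G0 omega_inv_nth_0[of E] unfolding D_def by (metis fps_zero_nth zero_neq_one)+
  have C'G: "C' * G = fps_X * fps_deriv G"
    using GG by (simp add: C'_def mult.assoc mult.commute[of _ G])

  \<comment> \<open>The defining equation of sigma times \<open>t^2 \<omega>\<close>, so that all
    poles are cleared. In degree \<open>i\<close> it determines \<open>(i - 1)\<close> times the
    coefficient of \<open>\<beta>\<close>, which leaves the coefficient of \<open>t\<close>
    free.\<close>
  have ode: "fps_small p j N (xc_series E c' + fps_X * fps_deriv \<beta> - \<beta>)" for j
  proof -
    note [simp del] = fls_divide_X fls_divide_X_power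
    define F where "F = (fps_to_fls :: rat fps \<Rightarrow> rat fls)"
    have Fm: "F (f * g) = F f * F g" "F (f + g) = F f + F g" "F (f - g) = F f - F g"
       "F (- f) = - F f" "F (fps_X ^ 2) = fls_X ^ 2" "F fps_X = fls_X" for f g
      by (auto simp: F_def fls_times_fps_to_fls fps_to_fls_power fps_X_to_fls)
    have F_ne: "F G \<noteq> 0" "F D \<noteq> 0" using G_ne by (auto simp: F_def)
    have "\<beta> * G = D * (G + fps_X * fps_deriv G)"
      unfolding \<beta>_def using C'G by (simp add: algebra_simps)
    hence \<beta>G: "F \<beta> * F G = F D * F (G + fps_X * fps_deriv G)"
      by (simp flip: Fm)
    have "fls_deriv (F s) = F (G + fps_X * fps_deriv G)"
      by (simp add: F_def fls_deriv_fps_to_fls s)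
    hence y: "1 / (omega_series E * F s) * fls_deriv (F s) = F \<beta> / fls_X"
      using \<beta>G F_ne unfolding omega_series_eq D_def[symmetric] F_def[symmetric]
      by (simp add: s Fm field_simps)
    define y where "y = F \<beta> / fls_X"
    have "y * fls_X = F \<beta>" by (simp add: y_def)
    from arg_cong[OF this, of fls_deriv] have "y + fls_deriv y * fls_X = F (fps_deriv \<beta>)"
      by (simp add: F_def fls_deriv_fps_to_fls)
    hence dy: "fls_deriv y = F (fps_X * fps_deriv \<beta> - \<beta>) / fls_X ^ 2"
      by (simp add: y_def Fm field_simps power2_eq_square)
    have "- (1 / omega_series E) * fls_deriv y = F (- (D * (fps_X * fps_deriv \<beta> - \<beta>))) / fls_X ^ 2"
      unfolding dy omega_series_eq D_def[symmetric] F_def[symmetric] by (simp add: Fm)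
    moreover have "x_series E + fls_const c' =
        F (inverse (w_unit E) + fps_const c' * fps_X ^ 2) / fls_X ^ 2"
      unfolding x_series_eq F_def[symmetric]
      by (simp add: Fm add_divide_distrib) (simp add: F_def)
    moreover have "fls_cong p N (x_series E + fls_const c') (- (1 / omega_series E) * fls_deriv y)"
      using sg unfolding is_padic_sigma_def Let_def y_def y[symmetric]
      by (simp add: s_def F_def c'_def)
    ultimately have cong: "fls_cong p N (F (inverse (w_unit E) + fps_const c' * fps_X ^ 2) / fls_X ^ 2)
        (F (- (D * (fps_X * fps_deriv \<beta> - \<beta>))) / fls_X ^ 2)" by simp
    have "fps_small p j N (inverse (w_unit E) + fps_const c' * fps_X ^ 2
        + D * (fps_X * fps_deriv \<beta> - \<beta>))"
      unfolding fps_small_def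
    proof (intro allI impI)
      fix i
      show "p_integral p ((inverse (w_unit E) + fps_const c' * fps_X ^ 2
        + D * (fps_X * fps_deriv \<beta> - \<beta>)) $ i / of_nat p ^ N)"
        using cong[unfolded fls_cong_def rat_cong_def, rule_format, of "int i - 2"]
        by (simp add: F_def fls_divide_X_power add_diff_eq flip: diff_minus_eq_add)
    qed
    from fps_small_mult_left[OF p(1) sm\<Omega> this]
    have "fps_small p j N (\<Omega> * (inverse (w_unit E) + fps_const c' * fps_X ^ 2)
        + (D * \<Omega>) * (fps_X * fps_deriv \<beta> - \<beta>))" by (simp add: algebra_simps)
    thus ?thesis unfolding D\<Omega>
      by (simp add: xc_series_def flip: D_def \<Omega>_def) (simp add: algebra_simps)
  qed

  \<comment> \<open>The free coefficient comes from oddness. With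
    \<open>i(t) = - t - a1 t^2 + ...\<close>, comparing coefficients of \<open>t^2\<close> gives
    \<open>G_1 - a1 = - G_1\<close> modulo \<open>p^N\<close>.\<close>
  have \<beta>1: "p_integral p ((of_int (a1 E) - 2 * G $ 1) / of_nat p ^ N)"
  proof -
    define q where "q = 1 - of_int (a1 E) * fps_X - of_int (a3 E) * w_series E"
    have w0: "w_series E $ 0 = 0" "w_series E $ Suc 0 = 0"
      by (auto simp: w_series_eq fps_X_power_mult_nth)
    have q0: "q $ 0 = 1" "q $ 1 = - of_int (a1 E)"
      by (simp_all add: q_def w0 fps_mult_nth_1)
    have "(q * inverse q) $ 1 = 0" using q0 by (simp add: inverse_mult_eq_1')
    hence q1: "inverse q $ 0 = 1" "inverse q $ 1 = of_int (a1 E)"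
      using q0 by (simp_all add: fps_mult_nth_1)
    define i where "i = formal_inverse E"
    have i: "i = - (fps_X * inverse q)" unfolding i_def q_def by (rule formal_inverse_eq)
    have i012: "i $ 0 = 0" "i $ 1 = -1" "i $ 2 = - of_int (a1 E)"
      using q1 by (auto simp: i numeral_2_eq_2)
    have "(s oo i) $ 2 = G $ 1 - of_int (a1 E)"
      using i012 G0
      by (simp add: fps_compose_nth s numeral_2_eq_2 power2_eq_square fps_mult_nth_1 fps_mult_nth)
    moreover have "rat_cong p N ((s oo i) $ 2) ((- s) $ 2)"
      using sg unfolding is_padic_sigma_def fps_cong_def i_def s_def by blast
    moreover have "s $ 2 = G $ 1" by (simp add: s numeral_2_eq_2)
    ultimately have "rat_cong p N (G $ 1 - of_int (a1 E)) (- (G $ 1))" by simp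
    from p_integral_minus[OF p(1) this[unfolded rat_cong_def]] show ?thesis
      by (simp add: field_simps minus_divide_left)
  qed

  note two = p_integral_half[OF p] p_integral_twelfth[OF p]
  define \<Delta> where "\<Delta> = zeta_series E c - \<beta>"
  have \<Delta>0: "\<Delta> $ 0 = 0"
    by (simp add: \<Delta>_def zeta_series_def \<beta>_def D_def C'_def)
  have \<Delta>1: "p_integral p (\<Delta> $ 1 / of_nat p ^ N)"
  proof -
    have "D $ 1 = - of_int (a1 E)"
      by (simp add: D_def omega_inv_def fps_mult_nth_1 power2_eq_square numeral_eq_Suc)
    hence "\<Delta> $ 1 = (of_int (a1 E) - 2 * G $ 1) * (1 / 2)"
      using G0 by (simp add: \<Delta>_def zeta_series_def \<beta>_def fps_mult_nth_1 C'_def D_def field_simps)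
    hence "\<Delta> $ 1 / of_nat p ^ N = (of_int (a1 E) - 2 * G $ 1) / of_nat p ^ N * (1 / 2)"
      by (simp only: times_divide_eq_left)
    also have "p_integral p \<dots>" by (rule p_integral_mult[OF p(1) \<beta>1 two(1)])
    finally show ?thesis .
  qed
  \<comment> \<open>The factor \<open>i - 1\<close> stays on the left, so that its division can
    later be combined with the one by \<open>k\<close>. Changing \<open>c'\<close> to
    \<open>c\<close> is what lowers the precision from \<open>N\<close> to
    \<open>N - 3\<close>.\<close>
  have \<Delta>2: "p_integral p (of_nat (i - 1) * \<Delta> $ i / of_nat p ^ (N - 3))" if i: "2 \<le> i" for i
  proof -
    define r where "r = xc_series E c' + fps_X * fps_deriv \<beta> - \<beta>"
    have r: "fps_small p (Suc i) (N - 3) r"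
      unfolding r_def by (rule fps_small_mono[OF p(1) ode]) auto
    define \<delta> where "\<delta> = xc_series E c' - xc_series E c"
    have "int p ^ (N - 3) dvd e (N - 3) - e N"
      using Zp_cong[OF e, of "N - 3" N] by (metis cong_iff_dvd_diff cong_sym diff_le_self)
    hence "p_integral p (of_int (e (N - 3) - e N) / of_nat p ^ (N - 3) * (1 / 12))"
      using p two by (intro p_integral_mult) (simp_all only: p_integral_of_int_div_iff)
    moreover have "c' - c = of_int (e (N - 3) - e N) * (1 / 12)"
      by (simp add: c c'_def diff_divide_distrib)
    ultimately have "p_integral p ((c' - c) / of_nat p ^ (N - 3))"
      by (simp only: times_divide_eq_left)
    hence "fps_small p (Suc i) (N - 3) (fps_const (c' - c))"
      using p by (intro fps_small_const)
    moreover have "\<delta> = fps_const (c' - c) * (fps_X ^ 2 * \<Omega>)"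
      by (simp add: \<delta>_def xc_series_def D_def \<Omega>_def algebra_simps flip: fps_const_sub)
    ultimately have \<delta>: "fps_small p (Suc i) (N - 3) \<delta>"
      using p sm\<Omega> by (simp only:) (intro fps_small_mult_right fps_small_power; simp)
    have "of_nat (i - 1) * zeta_series E c $ i = - xc_series E c $ i"
      using i by (simp add: zeta_series_def of_nat_diff field_simps)
    moreover have "of_nat (i - 1) * \<beta> $ i = (fps_X * fps_deriv \<beta> - \<beta>) $ i"
      using i by (cases i) (simp_all add: algebra_simps)
    ultimately have "of_nat (i - 1) * \<Delta> $ i = (\<delta> - r) $ i"
      by (simp add: \<Delta>_def \<delta>_def r_def algebra_simps)
    thus ?thesis using fps_smallD[OF fps_small_diff[OF p(1) \<delta> r], of i] by simp
  qed

  define V where "V = fps_integral0 (fps_shift 1 (\<Delta> * \<Omega>))"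
  have V0: "V $ 0 = 0" by (simp add: V_def)
  have "(\<Delta> * \<Omega>) $ 0 = 0" by (simp add: \<Delta>0)
  hence dV: "fps_X * fps_deriv V = \<Delta> * \<Omega>"
    unfolding V_def fps_deriv_fps_integral by (intro fps_ext) auto
  have smV: "fps_small p j (N - 1) (fps_dilate p V)" for j
    unfolding fps_small_def
  proof (intro allI impI)
    fix k
    show "p_integral p (fps_dilate p V $ k / of_nat p ^ (N - 1))"
    proof (cases "k = 0")
      case True
      thus ?thesis using p by (simp add: V0)
    next
      case False
      have "of_nat k * V $ k = (fps_X * fps_deriv V) $ k" using False by (cases k) simp_all
      also have "\<dots> = (\<Sum>i=0..k. \<Delta> $ i * \<Omega> $ (k - i))"
        by (simp add: dV fps_mult_nth)
      also have "\<dots> = (\<Sum>i\<in>{1..k}. \<Delta> $ i * \<Omega> $ (k - i))"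
        by (intro sum.mono_neutral_right) (auto simp: \<Delta>0 not_less_eq_eq Suc_le_eq)
      finally have "V $ k = (\<Sum>i\<in>{1..k}. \<Delta> $ i * \<Omega> $ (k - i)) / of_nat k"
        using False by (simp add: field_simps)
      hence "fps_dilate p V $ k / of_nat p ^ (N - 1) =
          (\<Sum>i\<in>{1..k}. (of_nat p ^ k * \<Delta> $ i / (of_nat k * of_nat p ^ (N - 1))) * \<Omega> $ (k - i))"
        by (simp add: sum_distrib_left sum_divide_distrib mult.assoc)
      also have "p_integral p \<dots>"
      proof (intro p_integral_sum p_integral_mult p)
        fix i assume i: "i \<in> {1..k}"
        show "p_integral p (\<Omega> $ (k - i))"
          using fps_smallD[OF sm\<Omega>, of "k - i" "Suc k"] by simp
        \<comment> \<open>For \<open>i = 1\<close> nothing has been divided and \<open>N\<close>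
          digits are known, so the crude bound for division by \<open>k\<close> is enough. Otherwise
          \<open>p^k\<close> is split as \<open>p^(k-2) p^2\<close>: the first factor absorbs
          \<open>(i - 1) k\<close>, the second lifts \<open>N - 3\<close> to
          \<open>N - 1\<close>.\<close>
        show "p_integral p (of_nat p ^ k * \<Delta> $ i / (of_nat k * of_nat p ^ (N - 1)))"
        proof (cases "i = 1")
          case True
          have NN: "(of_nat p ^ N :: rat) = of_nat p * of_nat p ^ (N - 1)"
            using N by (simp flip: power_Suc)
          have "p_integral p (of_nat p * (of_nat p ^ k / of_nat k) * (\<Delta> $ 1 / of_nat p ^ N))"
            using p False \<Delta>1 by (intro p_integral_mult p_integral_pow_div) auto
          moreover have "of_nat p * (of_nat p ^ k / of_nat k) * (\<Delta> $ 1 / of_nat p ^ N) =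
              of_nat p ^ k * \<Delta> $ i / (of_nat k * of_nat p ^ (N - 1))"
            unfolding True NN using p0 by simp
          ultimately show ?thesis by simp
        next
          case i1: False
          have k2: "k = (k - 2) + 2" using i i1 by auto
          have N3: "N - 1 = (N - 3) + 2" using N by auto
          have "p_integral p ((of_nat p ^ (k - 2) / (of_nat (i - 1) * of_nat k)) *
              (of_nat (i - 1) * \<Delta> $ i / of_nat p ^ (N - 3)))"
            using i i1 p by (intro p_integral_mult p_integral_pow_div_div \<Delta>2) auto
          moreover have "(of_nat p ^ (k - 2) / (of_nat (i - 1) * of_nat k)) *
              (of_nat (i - 1) * \<Delta> $ i / of_nat p ^ (N - 3)) =
              of_nat p ^ (k - 2) * of_nat p ^ 2 * \<Delta> $ i / (of_nat k * (of_nat p ^ (N - 3) * of_nat p ^ 2))"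
            using i i1 p0 by (simp add: field_simps del: of_nat_diff)
          moreover have "\<dots> = of_nat p ^ k * \<Delta> $ i / (of_nat k * of_nat p ^ (N - 1))"
            unfolding power_add[symmetric] using k2 N3 by metis
          ultimately show ?thesis by simp
        qed
      qed
      finally show ?thesis .
    qed
  qed

  define R where "R = fps_exp 1 oo V"
  \<comment> \<open>Both sides have constant coefficient 1 and the same logarithmic derivative, as
    \<open>dlog_series E c = C' + t V'\<close>.\<close>
  have su: "sigma_unit E c = G * R"
  proof (rule fps_X_deriv_unique[OF sigma_unit_deriv])
    have dR: "fps_deriv R = fps_deriv V * R"
      unfolding R_def using V0 by (simp add: fps_compose_deriv mult.commute)
    have "\<beta> * \<Omega> = 1 + C'"
      using D\<Omega> by (simp add: \<beta>_def mult.assoc mult.commute[of _ \<Omega>])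
    moreover have "dlog_series E c = (\<Delta> + \<beta>) * \<Omega> - 1"
      by (simp add: dlog_series_def \<Delta>_def \<Omega>_def D_def)
    ultimately have dl: "dlog_series E c = C' + \<Delta> * \<Omega>" by (simp add: algebra_simps)
    have "fps_X * fps_deriv (G * R) = (fps_X * fps_deriv G) * R + (fps_X * fps_deriv V) * (G * R)"
      by (simp add: dR algebra_simps)
    also have "\<dots> = dlog_series E c * (G * R)"
      unfolding dV dl C'G[symmetric] by (simp add: algebra_simps)
    finally show "fps_X * fps_deriv (G * R) = dlog_series E c * (G * R)" .
  qed (simp_all add: G0 R_def)
  have "fps_dilate p R = fps_exp 1 oo fps_dilate p V"
    by (simp add: R_def fps_dilate_def fps_compose_assoc V0)
  moreover have "fps_small p (Suc k) (N - 1) ((fps_exp 1 oo fps_dilate p V) - 1)"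
    using p N smV by (intro fps_small_exp) (auto simp: V0)
  ultimately have "fps_small p (Suc k) (N - 1) (fps_dilate p R - 1)" by simp
  moreover have "fps_small p (Suc k) 0 (fps_dilate p G)"
    using p smG by (auto simp: fps_small_def Gn intro!: p_integral_mult p_integral_power)
  ultimately have "fps_small p (Suc k) (N - 1) (fps_dilate p G * (fps_dilate p R - 1))"
    using p by (intro fps_small_mult_left)
  moreover have "(fps_dilate p G * (fps_dilate p R - 1)) $ k = of_nat p ^ k * (sigma_unit E c $ k - G $ k)"
    unfolding su by (simp add: algebra_simps fps_dilate_mult[symmetric])
  moreover have "(of_nat p ^ (N - 1) :: rat) = of_nat p ^ k * of_nat p ^ (N - 1 - k)"
    using k by (simp flip: power_add)
  ultimately have "rat_cong p (N - 1 - k) (sigma_unit E c $ k) (G $ k)"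
    using p0 fps_smallD[of p "Suc k" "N - 1" "fps_dilate p G * (fps_dilate p R - 1)" k]
    by (simp add: rat_cong_def)
  moreover have "rat_cong p (N - 1 - k) (G $ k) (of_int (\<sigma> (k + 1) (N - 1 - k)))"
    using Zp_cong[OF \<sigma>(3), of "N - 1 - k" N "k + 1"] by (simp add: Gn rat_cong_of_int_iff[OF p(1)])
  ultimately show ?thesis using rat_cong_trans rat_cong_sym p(1) by metis
qed

section \<open>Series as reversed coefficient lists\<close>

text \<open>A truncated series is stored with its constant coefficient last.  Then division with remainder
  is division of series: the quotient of A B by D consists of the leading coefficients of the series
  A B / D, and D has a unit leading coefficient as soon as its constant coefficient is a unit.\<close>

definition list_series :: "int list \<Rightarrow> rat fps" where
  "list_series X = Abs_fps (\<lambda>k. if k < length X then of_int (X ! (length X - 1 - k)) else 0)"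

lemma list_series_nth:
  "list_series X $ k = (if k < length X then of_int (X ! (length X - 1 - k)) else 0)"
  by (simp add: list_series_def)

lemma fps_small_list_series: "prime p \<Longrightarrow> fps_small p j 0 (list_series X)"
  by (simp add: fps_small_def list_series_nth)

text \<open>In reversed storage the low coefficients of a product of series are the top coefficients
  of the product of polynomials; for \<open>k < L\<close> the truncation of the factors is
  invisible.\<close>

lemma coeff_Poly_mult_top:
  assumes "length X = L" "length Y = L" "k < L"
  shows "coeff (Poly X * Poly Y) (2 * L - 2 - k) =
    (\<Sum>i=0..k. X ! (L - 1 - i) * Y ! (L - 1 - (k - i)))"
proof -
  let ?n = "2 * L - 2 - k"
  have "coeff (Poly X * Poly Y) ?n = (\<Sum>i\<le>?n. coeff (Poly X) i * coeff (Poly Y) (?n - i))"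
    by (rule coeff_mult)
  also have "\<dots> = (\<Sum>i\<in>{L - 1 - k..L - 1}. coeff (Poly X) i * coeff (Poly Y) (?n - i))"
    by (rule sum.mono_neutral_right) (use assms in \<open>auto simp: nth_default_def\<close>)
  also have "\<dots> = (\<Sum>i=0..k. X ! (L - 1 - i) * Y ! (L - 1 - (k - i)))"
  proof (rule sum.reindex_bij_witness[of _ "\<lambda>i. L - 1 - i" "\<lambda>i. L - 1 - i"])
    fix i assume i: "i \<in> {L - 1 - k..L - 1}"
    hence "?n - i = L - 1 - (k - (L - 1 - i))" "i < L" "L - 1 - (L - 1 - i) = i"
      "L - 1 - (k - (L - 1 - i)) < L"
      using assms by auto
    thus "X ! (L - 1 - (L - 1 - i)) * Y ! (L - 1 - (k - (L - 1 - i))) =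
        coeff (Poly X) i * coeff (Poly Y) (?n - i)"
      using assms by (simp add: nth_default_def)
  qed (use assms in auto)
  finally show ?thesis .
qed

text \<open>The remainder occupies indices up to \<open>L - 2\<close>, while the first
  \<open>L\<close> coefficients of the series sit at indices \<open>L - 1\<close> to
  \<open>2 L - 2\<close>, so the remainder does not touch them. The product has
  \<open>2 L - 1\<close> entries, hence the quotient has exactly \<open>L\<close>.\<close>

lemma poly_div_list_series:
  assumes p: "prime p" and len: "length A = L" "length B = L" "length D = L" "1 \<le> L"
    and div: "is_poly_div p r (poly_times p r A B) D C R"
  shows "length C = L" "set C \<subseteq> {0..<int p ^ r}"
    "fps_small p L r (list_series C * list_series D - list_series A * list_series B)"
proof -
  note d = div[unfolded is_poly_div_def]
  show lenC: "length C = L" using d len by (simp add: poly_times_def)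
  show "set C \<subseteq> {0..<int p ^ r}" using d by (simp add: residues_list_def)
  have ser: "(list_series X * list_series Y) $ k = of_int (coeff (Poly X * Poly Y) (2 * L - 2 - k))"
    if "length X = L" "length Y = L" "k < L" for X Y k
    unfolding coeff_Poly_mult_top[OF that]
    using that by (auto simp: fps_mult_nth list_series_nth intro!: sum.cong)
  show "fps_small p L r (list_series C * list_series D - list_series A * list_series B)"
    unfolding fps_small_def
  proof (intro allI impI)
    fix k assume k: "k < L"
    let ?n = "2 * L - 2 - k"
    have "coeff (Poly (poly_times p r A B)) ?n = coeff (Poly A * Poly B) ?n mod int p ^ r"
      using k len by (simp add: poly_times_def nth_default_def del: upt_Suc)
    moreover have "coeff (Poly R) ?n = 0"
      using d k len by (simp add: nth_default_def)
    moreover have "[coeff (Poly (poly_times p r A B)) ?n = coeff (Poly C * Poly D + Poly R) ?n] (mod int p ^ r)"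
      using d by blast
    ultimately have "[coeff (Poly A * Poly B) ?n = coeff (Poly C * Poly D) ?n] (mod int p ^ r)"
      by (simp add: cong_def)
    hence "int p ^ r dvd coeff (Poly C * Poly D) ?n - coeff (Poly A * Poly B) ?n"
      using cong_iff_dvd_diff cong_sym by blast
    thus "p_integral p ((list_series C * list_series D - list_series A * list_series B) $ k / of_nat p ^ r)"
      using p ser[OF lenC len(3) k] ser[OF len(1,2) k]
      by (simp add: p_integral_of_int_div_iff flip: of_int_diff)
  qed
qed

text \<open>Pseudo-division over the integers yields an identity for a power of the leading
  coefficient times \<open>A\<close>; that power is invertible modulo \<open>p^r\<close>, and
  multiplying by its inverse gives the division.\<close>

lemma is_poly_div_exists:
  assumes p: "prime p" and B: "B \<noteq> []" "coprime (last B) (int p)"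
  shows "\<exists>Q R. is_poly_div p r A B Q R"
proof -
  let ?m = "int p ^ r"
  have "0 < ?m" using p by (auto dest: prime_gt_0_nat)
  define f g where "f = Poly A" and "g = Poly B"
  have "last B \<noteq> 0" using B p by (auto dest: prime_gt_1_nat)
  hence "coeff g (length B - 1) \<noteq> 0" using B by (simp add: g_def nth_default_def last_conv_nth)
  moreover have "coeff g i = 0" if "i > length B - 1" for i
    using that B by (simp add: g_def nth_default_def)
  ultimately have deg_g: "degree g = length B - 1" and g0: "g \<noteq> 0"
    by (metis le_degree le_antisym not_le leading_coeff_0_iff degree_0 coeff_0, force)
  obtain q s where qs: "pseudo_divmod f g = (q, s)" by (cases "pseudo_divmod f g") auto
  define k where "k = Suc (degree f) - degree g"
  have eq: "smult (lead_coeff g ^ k) f = g * q + s" and s: "s = 0 \<or> degree s < degree g"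
    using pseudo_divmod[OF g0 qs] by (auto simp: k_def)
  have "lead_coeff g = last B" using B deg_g by (simp add: g_def nth_default_def last_conv_nth)
  hence "coprime (lead_coeff g ^ k) ?m" using B by simp
  then obtain b where b: "[lead_coeff g ^ k * b = 1] (mod ?m)"
    using cong_solve_coprime_int by blast
  \<comment> \<open>The length of the stored quotient is prescribed; the degree count shows that
    cutting it off there loses nothing.\<close>
  have q0: "coeff q i = 0" if i: "length A + 1 - length B \<le> i" for i
  proof (rule ccontr)
    assume "coeff q i \<noteq> 0"
    hence "q \<noteq> 0" "i \<le> degree q" by (auto intro: le_degree)
    hence dgq: "degree (g * q) = degree g + degree q" using g0 by (simp add: degree_mult_eq)
    have "g * q = smult (lead_coeff g ^ k) f - s" using eq by simp
    hence "degree (g * q) \<le> max (degree f) (degree s)"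
      by (simp only:) (rule degree_diff_le, (rule le_max_iff_disj[THEN iffD2]; simp)+)
    hence "degree g + degree q \<le> degree f"
      using s dgq by (auto simp: max_def split: if_splits)
    moreover have "f \<noteq> 0"
      using \<open>g * q = _\<close> s dgq g0 \<open>q \<noteq> 0\<close> by auto
    hence "degree f < length A" unfolding f_def
      by (metis coeff_Poly_eq leading_coeff_0_iff not_le_imp_less nth_default_beyond)
    ultimately show False using i \<open>i \<le> degree q\<close> deg_g B by (cases B) auto
  qed
  define Q R where "Q = map (\<lambda>i. (b * coeff q i) mod ?m) [0..<length A + 1 - length B]"
    and "R = map (\<lambda>i. (b * coeff s i) mod ?m) [0..<length B - 1]"
  have cQ: "[coeff (Poly Q) i = b * coeff q i] (mod ?m)" for i
    using q0[of i] by (auto simp: Q_def nth_default_def cong_def simp del: upt_Suc)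
  have cR: "[coeff (Poly R) i = b * coeff s i] (mod ?m)" for i
    using s deg_g by (auto simp: R_def nth_default_def cong_def coeff_eq_0)
  have main: "[coeff (Poly A) i = coeff (Poly Q * Poly B + Poly R) i] (mod ?m)" for i
  proof -
    have "[coeff (Poly Q * g + Poly R) i =
        (\<Sum>j\<le>i. b * coeff q j * coeff g (i - j)) + b * coeff s i] (mod ?m)"
      unfolding coeff_add coeff_mult by (intro cong_add cong_sum cong_mult cQ cR cong_refl)
    also have "(\<Sum>j\<le>i. b * coeff q j * coeff g (i - j)) + b * coeff s i = b * coeff (g * q + s) i"
      unfolding mult.commute[of g q] by (simp add: coeff_mult sum_distrib_left distrib_left mult.assoc)
    also have "\<dots> = lead_coeff g ^ k * b * coeff f i"
      by (simp only: eq[symmetric] coeff_smult mult_ac)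
    also have "[\<dots> = 1 * coeff f i] (mod ?m)" by (intro cong_mult b cong_refl)
    finally show ?thesis by (simp add: f_def g_def cong_sym_eq)
  qed
  have "is_poly_div p r A B Q R"
    unfolding is_poly_div_def
    using B main \<open>0 < ?m\<close> by (auto simp: Q_def R_def residues_list_def simp del: upt_Suc)
  thus ?thesis by blast
qed

section \<open>Bounded execution\<close>

abbreviation seq_com :: "com \<Rightarrow> com \<Rightarrow> com"  (infixr ";;" 60) where
  "c ;; d \<equiv> Seq c d"

locale machine =
  fixes tI :: "nat \<Rightarrow> nat" and tM tD :: "nat \<Rightarrow> nat \<Rightarrow> nat \<Rightarrow> nat"
begin

text \<open>A total-correctness triple with a time budget. Only upper bounds are recorded, so
  budgets add along sequences and may be relaxed.\<close>

definition run :: "com \<Rightarrow> state \<Rightarrow> nat \<Rightarrow> (state \<Rightarrow> bool) \<Rightarrow> bool" where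
  "run c st B R \<longleftrightarrow> (\<exists>t st'. exec tI tM tD c st t st' \<and> t \<le> B \<and> R st')"

text \<open>Covers the linear charge and the charge \<open>tI\<close> at once, which gives the
  arithmetic instructions a uniform side condition.\<close>

definition affordable :: "nat \<Rightarrow> int \<Rightarrow> int \<Rightarrow> bool" where
  "affordable U x y \<longleftrightarrow> ilen x + ilen y \<le> U \<and> tI (ilen x + ilen y) \<le> U"

lemma affordableD: "affordable U x y \<Longrightarrow> ilen x \<le> U"
  by (simp add: affordable_def)

lemma run_mono: "run c st a R \<Longrightarrow> a \<le> b \<Longrightarrow> run c st b R"
  unfolding run_def by (meson order_trans)

lemma run_weaken: "run c st a P \<Longrightarrow> (\<And>st'. P st' \<Longrightarrow> R st') \<Longrightarrow> run c st a R"
  unfolding run_def by blast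

lemma run_Seq: "run c st a (\<lambda>st'. run d st' b R) \<Longrightarrow> run (c ;; d) st (a + b) R"
  unfolding run_def by (meson add_mono exec_Seq)

lemma run_Seq2:
  "run c st a P \<Longrightarrow> (\<And>st'. P st' \<Longrightarrow> run d st' b R) \<Longrightarrow> run (c ;; d) st (a + b) R"
  by (intro run_Seq) (rule run_weaken)

lemma run_Skip: "R st \<Longrightarrow> run Skip st 1 R"
  unfolding run_def by (meson exec_Skip order_refl)

lemma run_Load: "affordable U c 0 \<Longrightarrow> R (s(x := c), l) \<Longrightarrow> run (Load x c) (s, l) U R"
  unfolding run_def by (meson exec_Load affordableD)

lemma run_Plus:
  "affordable U (s y) (s z) \<Longrightarrow> R (s(x := s y + s z), l) \<Longrightarrow> run (Plus x y z) (s, l) U R"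
  unfolding run_def affordable_def by (meson exec_Plus)

lemma run_Minus:
  "affordable U (s y) (s z) \<Longrightarrow> R (s(x := s y - s z), l) \<Longrightarrow> run (Minus x y z) (s, l) U R"
  unfolding run_def affordable_def by (meson exec_Minus)

lemma run_Times:
  "affordable U (s y) (s z) \<Longrightarrow> R (s(x := s y * s z), l) \<Longrightarrow> run (Times x y z) (s, l) U R"
  unfolding run_def affordable_def by (meson exec_Times)

lemma run_Quot:
  "affordable U (s y) (s z) \<Longrightarrow> R (s(x := s y div s z), l) \<Longrightarrow> run (Quot x y z) (s, l) U R"
  unfolding run_def affordable_def by (meson exec_Quot)

lemma run_Rem:
  "affordable U (s y) (s z) \<Longrightarrow> R (s(x := s y mod s z), l) \<Longrightarrow> run (Rem x y z) (s, l) U R"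
  unfolding run_def affordable_def by (meson exec_Rem)

lemma run_Get:
  "0 \<le> s y \<Longrightarrow> nat (s y) < length (l A) \<Longrightarrow> affordable U (s y) (l A ! nat (s y)) \<Longrightarrow>
    R (s(x := l A ! nat (s y)), l) \<Longrightarrow> run (Get x A y) (s, l) U R"
  unfolding run_def affordable_def by (meson exec_Get)

lemma run_Put:
  "0 \<le> s y \<Longrightarrow> nat (s y) < length (l A) \<Longrightarrow> affordable U (s y) (s x) \<Longrightarrow>
    R (s, l(A := (l A)[nat (s y) := s x])) \<Longrightarrow> run (Put A y x) (s, l) U R"
  unfolding run_def affordable_def by (meson exec_Put)

lemma run_Push:
  "affordable U (int (length (l A))) (s x) \<Longrightarrow> R (s, l(A := l A @ [s x])) \<Longrightarrow>
    run (Push A x) (s, l) U R"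
  unfolding run_def affordable_def by (meson exec_Push)

lemma run_Clear: "R (s, l(A := [])) \<Longrightarrow> run (Clear A) (s, l) 1 R"
  unfolding run_def by (meson exec_Clear order_refl)

lemma run_IfPos:
  "(fst st x > 0 \<Longrightarrow> run c st a R) \<Longrightarrow> (fst st x \<le> 0 \<Longrightarrow> run d st b R) \<Longrightarrow>
    run (IfPos x c d) st (1 + max a b) R"
proof (cases "fst st x > 0")
  case True
  assume "fst st x > 0 \<Longrightarrow> run c st a R"
  with True obtain t st' where "exec tI tM tD c st t st'" "t \<le> a" "R st'"
    unfolding run_def by blast
  thus ?thesis using exec_IfPos_true[OF True] unfolding run_def
    by (intro exI[of _ "1 + t"] exI[of _ st']) auto
next
  case False
  assume "fst st x \<le> 0 \<Longrightarrow> run d st b R"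
  with False obtain t st' where "exec tI tM tD d st t st'" "t \<le> b" "R st'"
    unfolding run_def by fastforce
  thus ?thesis using exec_IfPos_false[of st x] False unfolding run_def
    by (intro exI[of _ "1 + t"] exI[of _ st']) auto
qed

text \<open>The invariant is indexed by the number of completed rounds. At index \<open>n\<close>
  the test must fail, which yields termination and the cost bound together.\<close>

lemma run_WhilePos:
  assumes "I i st" "i \<le> n"
    and "\<And>i st. I i st \<Longrightarrow> i \<le> n \<Longrightarrow> fst st x > 0 \<Longrightarrow> i < n \<and> run c st B (I (Suc i))"
    and "\<And>i st. I i st \<Longrightarrow> i \<le> n \<Longrightarrow> fst st x \<le> 0 \<Longrightarrow> R st"
  shows "run (WhilePos x c) st ((n - i) * (B + 1) + 1) R"
  using assms(1,2)
proof (induction "n - i" arbitrary: i st)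
  case 0
  hence "fst st x \<le> 0" using assms(3)[of i st] by fastforce
  thus ?case using assms(4)[OF 0(2,3)] unfolding run_def
    by (metis exec_WhilePos_false le_add2)
next
  case (Suc d)
  show ?case
  proof (cases "fst st x > 0")
    case True
    obtain t st' where t: "exec tI tM tD c st t st'" "t \<le> B" "I (Suc i) st'"
      using assms(3)[OF Suc.prems True] unfolding run_def by blast
    have d: "d = n - Suc i" "Suc i \<le> n" "n - i = Suc (n - Suc i)"
      using Suc.hyps(2) by auto
    obtain u st'' where u: "exec tI tM tD (WhilePos x c) st' u st''"
        "u \<le> (n - Suc i) * (B + 1) + 1" "R st''"
      using Suc.hyps(1)[OF d(1) t(3) d(2)] unfolding run_def by blast
    have "1 + t + u \<le> (n - i) * (B + 1) + 1"
      using t(2) u(2) by (simp only: \<open>n - i = Suc (n - Suc i)\<close> mult_Suc)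
    thus ?thesis using exec_WhilePos_true[OF True t(1) u(1)] u(3) unfolding run_def by blast
  next
    case False
    thus ?thesis using assms(4)[OF Suc.prems] unfolding run_def
      by (metis exec_WhilePos_false le_add2 not_less)
  qed
qed

lemmas run_intros = run_Load run_Plus run_Minus run_Times run_Quot run_Rem run_Get run_Put
  run_Push run_Clear run_Skip run_Seq

end

section \<open>Program fragments\<close>

text \<open>Registers 0 to 7 hold the input, registers 8 to 17 constants; registers from 40 on and the arrays
  98 and 99 are scratch space of the fragments.\<close>

definition pow_com :: "nat \<Rightarrow> nat \<Rightarrow> com" where
  "pow_com x n = Load x 1 ;; Plus 40 n 9 ;; WhilePos 40 (Times x x 0 ;; Minus 40 40 8)"

text \<open>Division of register 43 by the small number in register 44 modulo \<open>p^M\<close> (register 10): the search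
  for a multiple of \<open>p^M\<close> that makes the division exact works with residues modulo the divisor only.\<close>

definition div_com :: com where
  "div_com = Rem 45 43 44 ;; Rem 46 10 44 ;; Load 47 0 ;;
     WhilePos 45 (Plus 45 45 46 ;; Rem 45 45 44 ;; Plus 47 47 8) ;;
     Times 48 47 10 ;; Plus 48 48 43 ;; Quot 42 48 44"

text \<open>The fragment body computes entry number i (register 40), the coefficient of \<open>t^k\<close> with k in
  register 41, into register 42.\<close>

definition build_com :: "nat \<Rightarrow> nat \<Rightarrow> com \<Rightarrow> com" where
  "build_com C n body = Clear C ;; Load 40 0 ;; Plus 41 n 9 ;;
     WhilePos 41 (Minus 41 41 8 ;; body ;; Push C 42 ;; Plus 40 40 8)"

definition monom_com :: "nat \<Rightarrow> nat \<Rightarrow> com" where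
  "monom_com C k = build_com C 12 (Minus 43 41 k ;; Load 42 0 ;;
     IfPos 43 Skip (Minus 43 k 41 ;; IfPos 43 Skip (Load 42 1)))"

definition lin_com :: "nat \<Rightarrow> nat \<Rightarrow> nat \<Rightarrow> nat \<Rightarrow> nat \<Rightarrow> com" where
  "lin_com C x A y B = build_com C 12 (Get 43 A 40 ;; Times 43 43 x ;; Get 44 B 40 ;;
     Times 44 44 y ;; Plus 43 43 44 ;; Rem 42 43 10)"

definition deriv_com :: "nat \<Rightarrow> nat \<Rightarrow> com" where
  "deriv_com C A = build_com C 12 (Get 43 A 40 ;; Times 43 43 41 ;; Rem 42 43 10)"

text \<open>Divides the coefficient of \<open>t^k\<close> by k - z if 0 < k - z and k < b, and drops the other
  coefficients.\<close>

definition integrate_com :: "nat \<Rightarrow> nat \<Rightarrow> nat \<Rightarrow> nat \<Rightarrow> com" where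
  "integrate_com C A z b = build_com C 12 (Load 42 0 ;; Minus 44 41 z ;;
     IfPos 44 (Minus 43 b 41 ;; IfPos 43 (Get 43 A 40 ;; div_com) Skip) Skip)"

text \<open>The division also truncates the product to \<open>L\<close> coefficients, so a plain
  product is obtained by dividing by the series 1.\<close>

definition muldiv_com :: "nat \<Rightarrow> nat \<Rightarrow> nat \<Rightarrow> nat \<Rightarrow> com" where
  "muldiv_com C A B D = PolyTimes 99 A B 0 11 ;; PolyDiv C 98 99 D 0 11"

text \<open>Three price levels: \<open>U1\<close> for counters and residues modulo exponents,
  \<open>U2\<close> for numbers of full precision, \<open>U3\<close> for polynomial operations. The
  square in the bound on \<open>H\<close> leaves room for products of two operands, and
  \<open>2 * (N - 1) - 1\<close> is the number of coefficients of a product of two arrays.\<close>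

locale sigma_machine = machine +
  fixes p N :: nat and E :: weierstrass and e S H :: int and U1 U2 U3 :: nat
  assumes p: "prime p" "5 \<le> p" and N: "4 \<le> N"
    and e: "0 \<le> e" "e < int p ^ (16 * N)"
    and S: "64 * int N \<le> S"
    and H: "4 * (int p ^ (16 * N) + S + \<bar>a1 E\<bar> + \<bar>a2 E\<bar> + \<bar>a3 E\<bar> + \<bar>a4 E\<bar> + \<bar>a6 E\<bar>)^2 \<le> H"
    and small: "\<And>x y. \<bar>x\<bar> \<le> S \<Longrightarrow> \<bar>y\<bar> \<le> S \<Longrightarrow> affordable U1 x y"
    and big: "\<And>x y. \<bar>x\<bar> \<le> H \<Longrightarrow> \<bar>y\<bar> \<le> H \<Longrightarrow> affordable U2 x y"
    and poly: "tM (N - 1) p (16 * N) \<le> U3" "tD (2 * (N - 1) - 1) p (16 * N) \<le> U3"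
begin

definition L :: nat where "L = N - 1"
definition M :: nat where "M = 16 * N"
definition Q :: int where "Q = int p ^ M"
definition W :: int where
  "W = Q + S + \<bar>a1 E\<bar> + \<bar>a2 E\<bar> + \<bar>a3 E\<bar> + \<bar>a4 E\<bar> + \<bar>a6 E\<bar>"

lemma L: "3 \<le> L" "L < N" "L \<le> M" using N by (auto simp: L_def M_def)

lemma Q_pos: "0 < Q" using p by (simp add: Q_def)

lemma S_ge: "256 \<le> S" "64 * int L \<le> S" "16 * int N \<le> S" "int M \<le> S"
  using S N by (auto simp: L_def M_def)

lemma W_ge: "Q \<le> W" "S \<le> W" "256 \<le> W" "\<bar>a1 E\<bar> \<le> W" "\<bar>a2 E\<bar> \<le> W" "\<bar>a3 E\<bar> \<le> W" "\<bar>a4 E\<bar> \<le> W"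
   "\<bar>a6 E\<bar> \<le> W" "0 < W"
  using Q_pos S_ge by (auto simp: W_def)

lemma W_H: "4 * (W * W) \<le> H"
  using H by (simp add: W_def Q_def M_def power2_eq_square)

lemma H_ge_mult: "\<bar>x\<bar> \<le> W \<Longrightarrow> \<bar>y\<bar> \<le> W \<Longrightarrow> \<bar>x * y\<bar> \<le> W * W"
  unfolding abs_mult using W_ge by (intro mult_mono) auto

lemma W_le_H: "4 * W \<le> H"
proof -
  have "W * 1 \<le> W * W" using W_ge by (intro mult_left_mono) auto
  thus ?thesis using W_H by linarith
qed

lemma S_le_H: "S \<le> H" using W_le_H W_ge by linarith

lemma U_ge: "2 \<le> U1" "2 \<le> U2"
  using small[of 0 0] big[of 0 0] S_ge S_le_H by (auto simp: affordable_def ilen_def)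

definition good :: "int list \<Rightarrow> bool" where
  "good X \<longleftrightarrow> length X = L \<and> set X \<subseteq> {0..<Q}"

lemma good_nth: "good X \<Longrightarrow> i < L \<Longrightarrow> 0 \<le> X ! i \<and> X ! i < Q"
  unfolding good_def by (metis atLeastLessThan_iff nth_mem subsetD)

lemma goodI: "length X = L \<Longrightarrow> (\<And>i. i < L \<Longrightarrow> 0 \<le> X ! i \<and> X ! i < Q) \<Longrightarrow> good X"
  by (auto simp: good_def in_set_conv_nth)

definition env :: "(nat \<Rightarrow> int) \<Rightarrow> bool" where
  "env s \<longleftrightarrow> s 0 = int p \<and> s 1 = int N \<and> s 2 = a1 E \<and> s 3 = a2 E \<and> s 4 = a3 E \<and> s 5 = a4 E \<and>
     s 6 = a6 E \<and> s 7 = e \<and> s 8 = 1 \<and> s 9 = 0 \<and> s 10 = Q \<and> s 11 = int M \<and> s 12 = int L \<and>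
     s 13 = int L - 1 \<and> s 14 = -1 \<and> s 15 = 2 \<and> s 16 = 3 \<and> s 17 = int L - 2"

lemma env_agree: "env s \<Longrightarrow> (\<forall>x<40. s' x = s x) \<Longrightarrow> env s'"
  by (simp add: env_def)

text \<open>One multiplication per unit of the exponent; with the exponent at most
  \<open>16 N\<close>, this costs about as much as a pass over an array.\<close>

lemma run_pow:
  assumes "s 0 = int p" "s 8 = 1" "s 9 = 0" "s n = int m" "m \<le> M" "n \<noteq> x" "x \<noteq> 0" "x \<noteq> 8" "x \<noteq> 9" "x \<noteq> 40"
  shows "run (pow_com x n) (s, l) ((m + 1) * (5 * U2))
    (\<lambda>(s', l'). l' = l \<and> (\<forall>y. y \<notin> {x, 40} \<longrightarrow> s' y = s y) \<and> s' x = int p ^ m)"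
  (is "run _ _ _ ?R")
proof -
  define I where "I = (\<lambda>i (s', l'). l' = l \<and> (\<forall>y. y \<notin> {x, 40} \<longrightarrow> s' y = s y) \<and>
    s' x = int p ^ i \<and> s' 40 = int (m - i))"
  have bigp: "\<bar>int p ^ i\<bar> \<le> H" if "i \<le> m" for i
  proof -
    have "int p ^ i \<le> Q" unfolding Q_def using p that assms by (intro power_increasing) auto
    thus ?thesis using W_ge W_le_H by simp
  qed
  have bigm: "int i \<le> H" if "i \<le> m" for i using that assms S_ge S_le_H by linarith
  have loop: "run (WhilePos 40 (Times x x 0 ;; Minus 40 40 8)) (s(x := 1, 40 := int m), l)
      ((m - 0) * ((U2 + U2) + 1) + 1)
      ?R"
  proof (rule run_WhilePos[where I = I])
    show "I 0 (s(x := 1, 40 := int m), l)" using assms by (simp add: I_def)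
  next
    fix i st assume I: "I i st" and i: "i \<le> m" and pos: "fst st 40 > 0"
    obtain s' l' where st: "st = (s', l')" by (cases st)
    have *: "l' = l" "\<And>y. y \<notin> {x, 40} \<Longrightarrow> s' y = s y" "s' x = int p ^ i" "s' 40 = int (m - i)"
      using I by (auto simp: I_def st)
    have "i < m" using pos * by (auto simp: st)
    have B: "\<bar>int p ^ i\<bar> \<le> H" "\<bar>int p\<bar> \<le> H" "int (m - i) \<le> H" "1 \<le> H"
      using bigp[of i] bigp[of 1] bigm[of "m - i"] \<open>i < m\<close> W_le_H W_ge by auto
    have "run (Times x x 0 ;; Minus 40 40 8) (s', l') (U2 + U2) (I (Suc i))"
      by (intro run_intros big)
         (use * assms B \<open>i < m\<close> in \<open>auto simp: I_def of_nat_diff\<close>)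
    thus "i < m \<and> run (Times x x 0 ;; Minus 40 40 8) st (U2 + U2) (I (Suc i))"
      using \<open>i < m\<close> by (simp add: st)
  next
    fix i st assume "I i st" "i \<le> m" "fst st 40 \<le> 0"
    thus "?R st"
      by (auto simp: I_def)
  qed simp
  have c: "U2 + (U2 + (m * (U2 + U2 + 1) + 1)) \<le> (m + 1) * (5 * U2)"
  proof -
    have "m * (U2 + U2 + 1) \<le> m * (5 * U2)" using U_ge by (intro mult_le_mono2) simp
    moreover have "(m + 1) * (5 * U2) = m * (5 * U2) + 5 * U2" by simp
    ultimately show ?thesis using U_ge by linarith
  qed
  have "run (pow_com x n) (s, l) (U2 + (U2 + ((m - 0) * ((U2 + U2) + 1) + 1)))
    ?R"
    unfolding pow_com_def
    apply (intro run_Seq run_Load run_Plus big)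
    using loop assms bigm[of m] W_le_H W_ge by auto
  thus ?thesis by (rule run_mono) (use c in simp)
qed

text \<open>Adding \<open>i * Q\<close> changes nothing modulo \<open>Q\<close>, and some
  \<open>i < d\<close> makes the dividend divisible by \<open>d\<close>. The loop follows only the
  residue modulo \<open>d\<close>, at price \<open>U1\<close>; full-size operations occur a constant
  number of times. The bound \<open>i < d\<close> also keeps the quotient below
  \<open>Q\<close>.\<close>

lemma run_div:
  assumes s: "s 10 = Q" "s 8 = 1" "0 \<le> s 43" "s 43 < Q" "s 44 = int d" "0 < d" "3 * int d \<le> S"
    and x0: "x0 < d" "int d dvd s 43 + int x0 * Q"
  shows "run div_com (s, l) (8 * U2 + d * (3 * U1 + 1))
    (\<lambda>(s', l'). l' = l \<and> (\<forall>y. y \<notin> {42, 45, 46, 47, 48} \<longrightarrow> s' y = s y) \<and>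
       0 \<le> s' 42 \<and> s' 42 < Q \<and> [int d * s' 42 = s 43] (mod Q))"
  (is "run _ _ _ ?R")
proof -
  define a where "a = s 43"
  define s0 where "s0 = s(45 := a mod int d, 46 := Q mod int d, 47 := 0)"
  define I where "I = (\<lambda>i (s', l'). l' = l \<and> (\<forall>y. y \<notin> {45, 47} \<longrightarrow> s' y = s0 y) \<and>
    s' 45 = (a + int i * Q) mod int d \<and> s' 47 = int i)"
  have dH: "int d \<le> H" "3 * int d \<le> S" using s S_le_H by linarith+
  let ?b = "Plus 45 45 46 ;; Rem 45 45 44 ;; Plus 47 47 8"
  have loop: "run (WhilePos 45 ?b) (s0, l) ((x0 - 0) * ((U1 + (U1 + U1)) + 1) + 1)
    (\<lambda>(s', l'). l' = l \<and> (\<forall>y. y \<notin> {45, 47} \<longrightarrow> s' y = s0 y) \<and>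
       (\<exists>i\<le>x0. s' 47 = int i \<and> int d dvd a + int i * Q))"
  proof (rule run_WhilePos[where I = I])
    show "I 0 (s0, l)" by (simp add: I_def s0_def)
  next
    fix i st assume I: "I i st" and i: "i \<le> x0" and pos: "fst st 45 > 0"
    obtain s' l' where st: "st = (s', l')" by (cases st)
    have *: "l' = l" "\<And>y. y \<notin> {45, 47} \<Longrightarrow> s' y = s0 y" "s' 45 = (a + int i * Q) mod int d" "s' 47 = int i"
      using I by (auto simp: I_def st)
    have "i \<noteq> x0" using pos * x0(2) by (auto simp: st a_def)
    hence "i < x0" using i by simp
    have b: "0 \<le> (a + int i * Q) mod int d" "(a + int i * Q) mod int d < int d"
      "0 \<le> Q mod int d" "Q mod int d < int d" using s by auto
    hence b': "(a + int i * Q) mod int d \<le> S" "Q mod int d \<le> S"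
      "(a + int i * Q) mod int d + Q mod int d \<le> S" using dH by linarith+
    have s': "s' 46 = Q mod int d" "s' 44 = int d" "s' 8 = 1" using *(2) s by (auto simp: s0_def)
    have upd: "((a + int i * Q) mod int d + Q mod int d) mod int d = (a + int (Suc i) * Q) mod int d"
      by (simp add: mod_add_eq algebra_simps)
    have "run ?b (s', l') (U1 + (U1 + U1)) (I (Suc i))"
      by (intro run_intros small)
         (use *(1,3,4) *(2) s' b b' dH \<open>i < x0\<close> x0 upd in \<open>auto simp: I_def\<close>)
    thus "i < x0 \<and> run ?b st (U1 + (U1 + U1)) (I (Suc i))"
      using \<open>i < x0\<close> by (simp add: st)
  next
    fix i st assume "I i st" and i: "i \<le> x0" and "fst st 45 \<le> 0"
    moreover have "0 \<le> (a + int i * Q) mod int d" using s by simp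
    ultimately show "case st of (s', l') \<Rightarrow> l' = l \<and> (\<forall>y. y \<notin> {45, 47} \<longrightarrow> s' y = s0 y) \<and>
       (\<exists>i\<le>x0. s' 47 = int i \<and> int d dvd a + int i * Q)"
      by (cases st) (auto simp: I_def intro!: exI[of _ i])
  qed simp
  have rest: "run (Times 48 47 10 ;; Plus 48 48 43 ;; Quot 42 48 44) st (U2 + (U2 + U2))
     ?R"
    if post: "case st of (s', l') \<Rightarrow> l' = l \<and> (\<forall>y. y \<notin> {45, 47} \<longrightarrow> s' y = s0 y) \<and>
       (\<exists>i\<le>x0. s' 47 = int i \<and> int d dvd a + int i * Q)" for st
  proof -
    obtain s' i where st: "st = (s', l)" and s': "\<And>y. y \<notin> {45, 47} \<Longrightarrow> s' y = s0 y"
      and i: "i \<le> x0" "s' 47 = int i" "int d dvd a + int i * Q"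
      using post by (cases st) auto
    have s'': "s' 10 = Q" "s' 43 = a" "s' 44 = int d"
      using s'[of 10] s'[of 43] s'[of 44] s by (auto simp: s0_def a_def)
    have le: "int i * Q \<le> (int d - 1) * Q" using i x0 Q_pos by (intro mult_right_mono) auto
    have lt: "a + int i * Q < int d * Q"
      using le s(4) by (simp add: a_def algebra_simps)
    have a0: "0 \<le> a" "a < Q" using s by (auto simp: a_def)
    have "int d * Q \<le> W * W" using dH W_ge Q_pos s by (intro mult_mono) auto
    hence B: "a + int i * Q \<le> H" "int i * Q \<le> H" "a \<le> H" "Q \<le> H" "0 \<le> int i * Q" "int i \<le> H"
      using lt a0 W_H W_le_H W_ge Q_pos i x0 dH by auto
    obtain q where q: "a + int i * Q = int d * q" using i(3) by blast
    hence div: "(int i * Q + a) div int d = q" using s by (simp add: add.commute)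
    have "0 \<le> int d * q" using q B(5) a0(1) by linarith
    hence "0 \<le> q" using s by (simp add: zero_le_mult_iff)
    moreover have "q < Q" using lt q s by simp
    moreover have "[int d * q = a] (mod Q)" unfolding q[symmetric] by (simp add: cong_def)
    ultimately show ?thesis
      unfolding st
      by (intro run_intros big) (use B a0 i s' s'' dH div in \<open>auto simp: s0_def a_def add.commute\<close>)
  qed
  have "run div_com (s, l) (U2 + (U2 + (U2 + (((x0 - 0) * ((U1 + (U1 + U1)) + 1) + 1) + (U2 + (U2 + U2))))))
    ?R"
    unfolding div_com_def
  proof (intro run_Seq run_Load run_Rem big, goal_cases)
    case 7
    have "s(45 := s 43 mod s 44, 46 := (s(45 := s 43 mod s 44)) 10 mod (s(45 := s 43 mod s 44)) 44,
        47 := 0) = s0" by (simp add: s0_def a_def s)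
    thus ?case using run_weaken[OF loop rest] by simp
  qed (use s dH W_ge W_le_H Q_pos in auto)
  thus ?thesis
  proof (rule run_mono)
    have "x0 * (3 * U1 + 1) \<le> d * (3 * U1 + 1)" using x0 by (intro mult_right_mono) auto
    thus "U2 + (U2 + (U2 + (((x0 - 0) * ((U1 + (U1 + U1)) + 1) + 1) + (U2 + (U2 + U2))))) \<le>
        8 * U2 + d * (3 * U1 + 1)" using U_ge by (simp add: algebra_simps)
  qed
qed


text \<open>\<open>Inv\<close> speaks of register 60 because the output pass carries a running power
  of \<open>p\<close> there; the other passes take it to be trivially true.\<close>

lemma run_build:
  assumes s: "s 8 = 1" "s 9 = 0" "s n = int m" "n < 40" "int m \<le> H"
    and Inv0: "Inv 0 (s 60)"
    and body: "\<And>i s' X. i < m \<Longrightarrow> (\<forall>y<40. s' y = s y) \<Longrightarrow> s' 40 = int i \<Longrightarrow>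
      s' 41 = int (m - 1 - i) \<Longrightarrow> Inv i (s' 60) \<Longrightarrow>
      run body (s', l(C := X)) b (\<lambda>(s'', l''). (\<forall>y<42. s'' y = s' y) \<and> Inv (Suc i) (s'' 60) \<and>
        \<bar>s'' 42\<bar> \<le> H \<and> P i (s'' 42) \<and> l'' = l(C := X))"
  shows "run (build_com C n body) (s, l) ((m + 1) * (b + 6 * U2))
    (\<lambda>(s', l'). (\<forall>y<40. s' y = s y) \<and>
       (\<exists>X. length X = m \<and> (\<forall>i<m. P i (X ! i)) \<and> l' = l(C := X)))"
  (is "run _ _ _ ?R")
proof -
  define I where "I = (\<lambda>i (s', l'). (\<forall>y<40. s' y = s y) \<and> s' 40 = int i \<and> s' 41 = int (m - i) \<and>
    Inv i (s' 60) \<and> (\<exists>X. length X = i \<and> (\<forall>k<i. P k (X ! k)) \<and> l' = l(C := X)))"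
  have H1: "1 \<le> H" using W_le_H W_ge by simp
  let ?b = "Minus 41 41 8 ;; body ;; Push C 42 ;; Plus 40 40 8"
  have loop: "run (WhilePos 41 ?b) (s(40 := 0, 41 := int m), l(C := []))
      ((m - 0) * ((U2 + (b + (U2 + U2))) + 1) + 1)
      ?R"
  proof (rule run_WhilePos[where I = I])
    show "I 0 (s(40 := 0, 41 := int m), l(C := []))" using s Inv0 by (simp add: I_def)
  next
    fix i st assume I: "I i st" and i: "i \<le> m" and pos: "fst st 41 > 0"
    obtain s' l' where st: "st = (s', l')" by (cases st)
    obtain X where *: "\<forall>y<40. s' y = s y" "s' 40 = int i" "s' 41 = int (m - i)" "Inv i (s' 60)"
      "length X = i" "\<forall>k<i. P k (X ! k)" "l' = l(C := X)"
      using I by (auto simp: I_def st)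
    have "i < m" using pos * by (auto simp: st)
    have s8: "s' 8 = 1" using * s by simp
    let ?s = "s'(41 := int (m - 1 - i))"
    have body': "run body (?s, l(C := X)) b (\<lambda>(s'', l''). (\<forall>y<42. s'' y = ?s y) \<and> Inv (Suc i) (s'' 60) \<and>
        \<bar>s'' 42\<bar> \<le> H \<and> P i (s'' 42) \<and> l'' = l(C := X))"
      by (rule body) (use * \<open>i < m\<close> in auto)
    have fin: "run (Push C 42 ;; Plus 40 40 8) st (U2 + U2) (I (Suc i))"
      if post: "case st of (s'', l'') \<Rightarrow> (\<forall>y<42. s'' y = ?s y) \<and> Inv (Suc i) (s'' 60) \<and>
        \<bar>s'' 42\<bar> \<le> H \<and> P i (s'' 42) \<and> l'' = l(C := X)" for st
    proof -
      obtain s'' where st': "st = (s'', l(C := X))" and **: "\<forall>y<42. s'' y = ?s y" "Inv (Suc i) (s'' 60)"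
        "\<bar>s'' 42\<bar> \<le> H" "P i (s'' 42)" using post by (cases st) auto
      have "s'' 8 = 1" "s'' 40 = int i" "s'' 41 = int (m - Suc i)" "\<forall>y<40. s'' y = s y"
        using **(1) s8 * by auto
      thus ?thesis
        unfolding st'
        by (intro run_intros big)
           (use ** * s \<open>i < m\<close> H1 in \<open>auto simp: I_def nth_append less_Suc_eq intro!: exI[of _ "X @ [s'' 42]"]\<close>)
    qed
    have m: "s' 41 - s' 8 = int (m - 1 - i)" using \<open>i < m\<close> * s8 by (simp add: of_nat_diff)
    have "run ?b (s', l') (U2 + (b + (U2 + U2))) (I (Suc i))"
    proof (intro run_Seq run_Minus big, goal_cases)
      case 3
      show ?case unfolding m using run_weaken[OF body' fin] *(7) by simp
    qed (use * s8 s H1 \<open>i < m\<close> in auto)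
    thus "i < m \<and> run ?b st (U2 + (b + (U2 + U2))) (I (Suc i))"
      using \<open>i < m\<close> by (simp add: st)
  next
    fix i st assume "I i st" "i \<le> m" "fst st 41 \<le> 0"
    moreover from this have "i = m" by (cases st) (auto simp: I_def)
    ultimately show "?R st"
      by (cases st) (auto simp: I_def)
  qed simp
  have "run (build_com C n body) (s, l)
    (1 + (U2 + (U2 + ((m - 0) * ((U2 + (b + (U2 + U2))) + 1) + 1))))
    ?R"
    unfolding build_com_def
    by (intro run_Seq run_Clear run_Load run_Plus big) (use loop s H1 in auto)
  thus ?thesis
  proof (rule run_mono)
    have "m * (U2 + (b + (U2 + U2)) + 1) \<le> m * (b + 6 * U2)"
      using U_ge by (intro mult_le_mono2) simp
    moreover have "(m + 1) * (b + 6 * U2) = m * (b + 6 * U2) + (b + 6 * U2)" by simp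
    ultimately show "1 + (U2 + (U2 + ((m - 0) * ((U2 + (b + (U2 + U2))) + 1) + 1))) \<le> (m + 1) * (b + 6 * U2)"
      using U_ge by simp
  qed
qed

lemma abs_le_H: "\<bar>z\<bar> \<le> W \<Longrightarrow> \<bar>z\<bar> \<le> H" "\<bar>z\<bar> \<le> W * W \<Longrightarrow> \<bar>z\<bar> \<le> H"
  using W_H W_le_H W_ge(9) by (linarith, linarith)

text \<open>One unit of time pays for every fragment that handles a whole array.\<close>

definition U :: nat where "U = 20 * (U3 + (L + 1) * (U2 + L * U1))"

text \<open>The 20 in \<open>U\<close> is \<open>14 + 6\<close>: full-size operations granted to the
  body of a pass and to the loop around it.\<close>

lemma U_ge_build: "b \<le> 14 * U2 + L * (4 * U1) \<Longrightarrow> (L + 1) * (b + 6 * U2) \<le> U"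
proof -
  assume b: "b \<le> 14 * U2 + L * (4 * U1)"
  have "(L + 1) * (b + 6 * U2) \<le> (L + 1) * (20 * (U2 + L * U1))"
    using b by (intro mult_le_mono2) simp
  also have "\<dots> = 20 * ((L + 1) * (U2 + L * U1))" by (rule mult.left_commute)
  also have "\<dots> \<le> U" unfolding U_def by (intro mult_le_mono2) simp
  finally show ?thesis .
qed

lemma run_build_L:
  assumes s: "env s"
    and body: "\<And>i s' X. i < L \<Longrightarrow> (\<forall>y<40. s' y = s y) \<Longrightarrow> env s' \<Longrightarrow> s' 40 = int i \<Longrightarrow>
      s' 41 = int (L - 1 - i) \<Longrightarrow>
      run body (s', l(C := X)) (14 * U2 + L * (4 * U1)) (\<lambda>(s'', l''). (\<forall>y<42. s'' y = s' y) \<and>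
        \<bar>s'' 42\<bar> \<le> H \<and> P i (s'' 42) \<and> l'' = l(C := X))"
  shows "run (build_com C 12 body) (s, l) U
    (\<lambda>(s', l'). (\<forall>y<40. s' y = s y) \<and>
       (\<exists>X. length X = L \<and> (\<forall>i<L. P i (X ! i)) \<and> l' = l(C := X)))"
proof (rule run_mono[OF run_build[where Inv = "\<lambda>_ _. True" and b = "14 * U2 + L * (4 * U1)" and m = L]])
  show "int L \<le> H" using S_ge S_le_H by linarith
  show "(L + 1) * (14 * U2 + L * (4 * U1) + 6 * U2) \<le> U" by (rule U_ge_build) simp
qed (use s body env_agree[OF s] in \<open>auto simp: env_def\<close>)

lemma run_monom:
  assumes s: "env s" "k < 40" "s k = int j" "j \<le> 8"
  shows "run (monom_com C k) (s, l) U
    (\<lambda>(s', l'). (\<forall>y<40. s' y = s y) \<and>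
       (\<exists>X. length X = L \<and> (\<forall>i<L. X ! i = (if L - 1 - i = j then 1 else 0)) \<and> l' = l(C := X)))"
  unfolding monom_com_def
proof (rule run_build_L[where P = "\<lambda>i r. r = (if L - 1 - i = j then 1 else 0)", OF s(1)])
  fix i s' X assume i: "i < L" and s': "\<forall>y<40. s' y = s y" "env s'" "s' 40 = int i"
    "s' 41 = int (L - 1 - i)"
  have sk: "s' k = int j" using s s' by simp
  have LH: "int L \<le> H" "8 \<le> H" using S_ge S_le_H by linarith+
  hence B: "int (L - 1 - i) \<le> H" by linarith
  show "run (Minus 43 41 k ;; Load 42 0 ;; IfPos 43 Skip (Minus 43 k 41 ;; IfPos 43 Skip (Load 42 1)))
     (s', l(C := X)) (14 * U2 + L * (4 * U1))
     (\<lambda>(s'', l''). (\<forall>y<42. s'' y = s' y) \<and> \<bar>s'' 42\<bar> \<le> H \<and>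
        s'' 42 = (if L - 1 - i = j then 1 else 0) \<and> l'' = l(C := X))"
  proof (rule run_mono)
    show "run (Minus 43 41 k ;; Load 42 0 ;; IfPos 43 Skip (Minus 43 k 41 ;; IfPos 43 Skip (Load 42 1)))
       (s', l(C := X)) (U2 + (U2 + (1 + max 1 (U2 + (1 + max 1 U2)))))
       (\<lambda>(s'', l''). (\<forall>y<42. s'' y = s' y) \<and> \<bar>s'' 42\<bar> \<le> H \<and>
          s'' 42 = (if L - 1 - i = j then 1 else 0) \<and> l'' = l(C := X))"
      by (intro run_intros run_IfPos big) (use s sk s' B LH in auto)
    show "U2 + (U2 + (1 + max 1 (U2 + (1 + max 1 U2)))) \<le> 14 * U2 + L * (4 * U1)"
      using U_ge by simp
  qed
qed

lemma run_lin:
  assumes s: "env s" "x < 40" "y < 40" "\<bar>s x\<bar> \<le> W" "\<bar>s y\<bar> \<le> W" and AB: "good (l A)" "good (l B)"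
    and C: "A \<noteq> C" "B \<noteq> C"
  shows "run (lin_com C x A y B) (s, l) U
    (\<lambda>(s', l'). (\<forall>y<40. s' y = s y) \<and>
       (\<exists>X. length X = L \<and> (\<forall>i<L. X ! i = (l A ! i * s x + l B ! i * s y) mod Q) \<and> l' = l(C := X)))"
  unfolding lin_com_def
proof (rule run_build_L[OF s(1)])
  fix i s' X assume i: "i < L" and s': "\<forall>y<40. s' y = s y" "env s'" "s' 40 = int i"
    "s' 41 = int (L - 1 - i)"
  have sxy: "s' x = s x" "s' y = s y" "s' 10 = Q" using s s' by (auto simp: env_def)
  have LH: "int L \<le> H" using S_ge S_le_H by linarith
  have A: "0 \<le> l A ! i" "l A ! i < Q" "0 \<le> l B ! i" "l B ! i < Q" "length (l A) = L" "length (l B) = L"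
    using good_nth AB i by (auto simp: good_def)
  have A': "\<bar>l A ! i\<bar> \<le> W" "\<bar>l B ! i\<bar> \<le> W" using A W_ge by auto
  have W1: "\<bar>l A ! i * s x\<bar> \<le> W * W" "\<bar>l B ! i * s y\<bar> \<le> W * W"
    using A' s by (auto intro!: H_ge_mult)
  have HH: "W \<le> H" "W * W \<le> H" "2 * (W * W) \<le> H" using W_H W_le_H W_ge by auto
  have m: "0 \<le> z mod Q \<and> z mod Q < Q" for z using Q_pos by simp
  have sum: "\<bar>l A ! i * s x + l B ! i * s y\<bar> \<le> H" using W1 HH by linarith
  have mH: "\<bar>z mod Q\<bar> \<le> H" for z using m[of z] W_ge HH by linarith
  have xy: "x \<noteq> 43" "y \<noteq> 43" "y \<noteq> 44" using s by auto
  have B: "\<bar>s x\<bar> \<le> H" "\<bar>s y\<bar> \<le> H" "\<bar>l A ! i\<bar> \<le> H" "\<bar>l B ! i\<bar> \<le> H" "\<bar>l A ! i * s x\<bar> \<le> H"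
    "\<bar>l B ! i * s y\<bar> \<le> H" "\<bar>Q\<bar> \<le> H" "int i \<le> H" "l A ! i \<le> H" "l B ! i \<le> H"
    using abs_le_H(1)[OF s(4)] abs_le_H(1)[OF s(5)] abs_le_H(1)[OF A'(1)] abs_le_H(1)[OF A'(2)]
      abs_le_H(2)[OF W1(1)] abs_le_H(2)[OF W1(2)] abs_le_H(1)[of Q] W_ge(1) Q_pos i LH by auto
  show "run (Get 43 A 40 ;; Times 43 43 x ;; Get 44 B 40 ;; Times 44 44 y ;; Plus 43 43 44 ;; Rem 42 43 10)
     (s', l(C := X)) (14 * U2 + L * (4 * U1))
     (\<lambda>(s'', l''). (\<forall>y<42. s'' y = s' y) \<and> \<bar>s'' 42\<bar> \<le> H \<and>
        s'' 42 = (l A ! i * s x + l B ! i * s y) mod Q \<and> l'' = l(C := X))"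
  proof (rule run_mono)
    show "run (Get 43 A 40 ;; Times 43 43 x ;; Get 44 B 40 ;; Times 44 44 y ;; Plus 43 43 44 ;; Rem 42 43 10)
       (s', l(C := X)) (U2 + (U2 + (U2 + (U2 + (U2 + U2)))))
       (\<lambda>(s'', l''). (\<forall>y<42. s'' y = s' y) \<and> \<bar>s'' 42\<bar> \<le> H \<and>
          s'' 42 = (l A ! i * s x + l B ! i * s y) mod Q \<and> l'' = l(C := X))"
      by (intro run_intros big) (simp_all add: sxy s' A i C xy B sum mH)
    show "U2 + (U2 + (U2 + (U2 + (U2 + U2)))) \<le> 14 * U2 + L * (4 * U1)" by simp
  qed
qed

lemma run_deriv:
  assumes s: "env s" and A: "good (l A)" and C: "A \<noteq> C"
  shows "run (deriv_com C A) (s, l) U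
    (\<lambda>(s', l'). (\<forall>y<40. s' y = s y) \<and>
       (\<exists>X. length X = L \<and> (\<forall>i<L. X ! i = (l A ! i * int (L - 1 - i)) mod Q) \<and> l' = l(C := X)))"
  unfolding deriv_com_def
proof (rule run_build_L[OF s])
  fix i s' X assume i: "i < L" and s': "\<forall>y<40. s' y = s y" "env s'" "s' 40 = int i"
    "s' 41 = int (L - 1 - i)"
  have sxy: "s' 10 = Q" using s s' by (auto simp: env_def)
  have LH: "int L \<le> H" "int (L - 1 - i) \<le> W" using S_ge S_le_H W_ge by linarith+
  have A: "0 \<le> l A ! i" "l A ! i < Q" "length (l A) = L"
    using good_nth A i by (auto simp: good_def)
  have A': "\<bar>l A ! i\<bar> \<le> W" using A W_ge by auto
  have W1: "\<bar>l A ! i * int (L - 1 - i)\<bar> \<le> W * W"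
    using A' LH by (intro H_ge_mult) auto
  have HH: "W \<le> H" "W * W \<le> H" "2 * (W * W) \<le> H" using W_H W_le_H W_ge by auto
  have m: "0 \<le> z mod Q \<and> z mod Q < Q" for z using Q_pos by simp
  have mH: "\<bar>z mod Q\<bar> \<le> H" for z using m[of z] W_ge HH by linarith
  have B: "\<bar>l A ! i * int (L - 1 - i)\<bar> \<le> H" "\<bar>l A ! i\<bar> \<le> H" "\<bar>Q\<bar> \<le> H" "int i \<le> H"
    "l A ! i \<le> H" "int (L - Suc i) \<le> H" "l A ! i * int (L - Suc i) \<le> H"
    using abs_le_H(2)[OF W1] abs_le_H(1)[OF A'] abs_le_H(1)[of Q] W_ge(1) Q_pos i LH HH by auto
  show "run (Get 43 A 40 ;; Times 43 43 41 ;; Rem 42 43 10)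
     (s', l(C := X)) (14 * U2 + L * (4 * U1))
     (\<lambda>(s'', l''). (\<forall>y<42. s'' y = s' y) \<and> \<bar>s'' 42\<bar> \<le> H \<and>
        s'' 42 = (l A ! i * int (L - 1 - i)) mod Q \<and> l'' = l(C := X))"
  proof (rule run_mono)
    show "run (Get 43 A 40 ;; Times 43 43 41 ;; Rem 42 43 10)
       (s', l(C := X)) (U2 + (U2 + U2))
       (\<lambda>(s'', l''). (\<forall>y<42. s'' y = s' y) \<and> \<bar>s'' 42\<bar> \<le> H \<and>
          s'' 42 = (l A ! i * int (L - 1 - i)) mod Q \<and> l'' = l(C := X))"
      by (intro run_intros big) (simp_all add: sxy s' A i C B mH del: of_nat_diff)
    show "U2 + (U2 + U2) \<le> 14 * U2 + L * (4 * U1)" by simp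
  qed
qed

text \<open>Divisibility up to multiples of \<open>Q\<close> is not automatic when \<open>p\<close>
  divides the exponent. \<open>ex\<close> asks for it exactly where a division takes place; it is
  discharged once the dividend is known to approximate a true multiple.\<close>

lemma run_integrate:
  assumes s: "env s" "z < 40" "b < 40" "s z = int o'" "s b = int c" "int o' \<le> S" "int c \<le> S"
    and A: "good (l A)" and C: "A \<noteq> C"
    and ex: "\<And>k. k < L \<Longrightarrow> o' < k \<Longrightarrow> k < c \<Longrightarrow> \<exists>x<k - o'. int (k - o') dvd l A ! (L - 1 - k) + int x * Q"
  shows "run (integrate_com C A z b) (s, l) U
    (\<lambda>(s', l'). (\<forall>y<40. s' y = s y) \<and>
       (\<exists>X. good X \<and> (\<forall>k<L. if o' < k \<and> k < c
            then [int (k - o') * X ! (L - 1 - k) = l A ! (L - 1 - k)] (mod Q)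
            else X ! (L - 1 - k) = 0) \<and> l' = l(C := X)))"
  (is "run _ _ _ ?R")
proof -
  define P where "P = (\<lambda>i r. let k = L - 1 - i in 0 \<le> r \<and> r < Q \<and> (if o' < k \<and> k < c
            then [int (k - o') * r = l A ! i] (mod Q) else r = 0))"
  let ?body = "Load 42 0 ;; Minus 44 41 z ;;
     IfPos 44 (Minus 43 b 41 ;; IfPos 43 (Get 43 A 40 ;; div_com) Skip) Skip"
  have "run (integrate_com C A z b) (s, l) U
    (\<lambda>(s', l'). (\<forall>y<40. s' y = s y) \<and>
       (\<exists>X. length X = L \<and> (\<forall>i<L. P i (X ! i)) \<and> l' = l(C := X)))"
    unfolding integrate_com_def
  proof (rule run_build_L[OF s(1)])
    fix i s' X assume i: "i < L" and s': "\<forall>y<40. s' y = s y" "env s'" "s' 40 = int i"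
      "s' 41 = int (L - 1 - i)"
    define k where "k = L - 1 - i"
    have k: "k < L" "L - 1 - k = i" using i by (auto simp: k_def)
    have szb: "s' z = int o'" "s' b = int c" "s' 10 = Q" "s' 8 = 1"
      using s s' by (auto simp: env_def)
    have LH: "int L \<le> H" "int k \<le> H" "int o' \<le> H" "int c \<le> H" "0 \<le> H"
      using S_ge S_le_H s k by linarith+
    have A: "0 \<le> l A ! i" "l A ! i < Q" "length (l A) = L"
      using good_nth A i by (auto simp: good_def)
    have A': "\<bar>l A ! i\<bar> \<le> H" using A W_ge W_le_H by auto
    have LH': "\<bar>int k - int o'\<bar> \<le> H" "int (L - Suc i) = int k" using LH by (auto simp: k_def)
    have z: "z \<noteq> 42" "z \<noteq> 43" "z \<noteq> 44" "b \<noteq> 42" "b \<noteq> 43" "b \<noteq> 44" using s by auto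
    define B c0 where "B = U2 + (8 * U2 + (k - o') * (3 * U1 + 1))" and "c0 = Get 43 A 40 ;; div_com"
    have div: "run c0 (s'(42 := 0, 44 := int k - int o', 43 := int c - int k), l(C := X)) B
        (\<lambda>(s'', l''). (\<forall>y<42. s'' y = s' y) \<and> \<bar>s'' 42\<bar> \<le> H \<and> P i (s'' 42) \<and> l'' = l(C := X))"
      if kk: "o' < k" "k < c"
    proof -
      obtain x where x: "x < k - o'" "int (k - o') dvd l A ! i + int x * Q"
        using ex[of k] kk k by auto
      let ?s = "s'(42 := 0, 44 := int k - int o', 43 := l A ! i)"
      have "run div_com (?s, l(C := X)) (8 * U2 + (k - o') * (3 * U1 + 1))
        (\<lambda>(s'', l''). l'' = l(C := X) \<and> (\<forall>y. y \<notin> {42, 45, 46, 47, 48} \<longrightarrow> s'' y = ?s y) \<and>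
          0 \<le> s'' 42 \<and> s'' 42 < Q \<and> [int (k - o') * s'' 42 = ?s 43] (mod Q))"
        by (rule run_div[where d = "k - o'"]) (use x kk k szb A S_ge in auto)
      hence d: "run div_com (?s, l(C := X)) (8 * U2 + (k - o') * (3 * U1 + 1))
        (\<lambda>(s'', l''). (\<forall>y<42. s'' y = s' y) \<and> \<bar>s'' 42\<bar> \<le> H \<and> P i (s'' 42) \<and> l'' = l(C := X))"
        by (rule run_weaken) (use kk W_ge W_le_H in \<open>auto simp: P_def k_def Let_def\<close>)
      show ?thesis
        unfolding B_def c0_def
        by (intro run_Seq run_Get big) (use d s' i A A' C LH in \<open>auto simp: fun_upd_twist\<close>)
    qed
    have P0: "P i 0" if "\<not> (o' < k \<and> k < c)"
      using that Q_pos by (auto simp: P_def k_def Let_def)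
    show "run ?body (s', l(C := X)) (14 * U2 + L * (4 * U1))
     (\<lambda>(s'', l''). (\<forall>y<42. s'' y = s' y) \<and> \<bar>s'' 42\<bar> \<le> H \<and> P i (s'' 42) \<and> l'' = l(C := X))"
    proof (rule run_mono)
      show "run ?body (s', l(C := X)) (U2 + (U2 + (1 + max (U2 + (1 + max B 1)) 1)))
       (\<lambda>(s'', l''). (\<forall>y<42. s'' y = s' y) \<and> \<bar>s'' 42\<bar> \<le> H \<and> P i (s'' 42) \<and> l'' = l(C := X))"
        unfolding c0_def[symmetric]
        by (intro run_intros run_IfPos big) (use div P0 LH LH' in \<open>auto simp: szb s' z\<close>)
      have "(k - o') * (3 * U1 + 1) \<le> L * (4 * U1)"
        using k U_ge by (intro mult_le_mono) auto
      thus "U2 + (U2 + (1 + max (U2 + (1 + max B 1)) 1)) \<le> 14 * U2 + L * (4 * U1)"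
        using U_ge by (simp add: B_def)
    qed
  qed
  thus ?thesis
  proof (rule run_weaken)
    fix st assume "case st of (s', l') \<Rightarrow> (\<forall>y<40. s' y = s y) \<and>
       (\<exists>X. length X = L \<and> (\<forall>i<L. P i (X ! i)) \<and> l' = l(C := X))"
    then obtain s' X where st: "st = (s', l(C := X))" "\<forall>y<40. s' y = s y" "length X = L"
      "\<forall>i<L. P i (X ! i)" by (cases st) auto
    have "good X" using st(3,4) by (auto simp: P_def Let_def intro!: goodI)
    moreover have "if o' < k \<and> k < c
            then [int (k - o') * X ! (L - 1 - k) = l A ! (L - 1 - k)] (mod Q)
            else X ! (L - 1 - k) = 0" if "k < L" for k
      using st(4)[rule_format, of "L - 1 - k"] that by (auto simp: P_def Let_def of_nat_diff)
    ultimately show "?R st"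
      using st(1,2) unfolding st(1) prod.case by blast
  qed
qed

lemma run_muldiv:
  assumes s: "env s" and A: "good (l A)" "good (l B)" "good (l D)" "coprime (last (l D)) (int p)"
    and D: "D \<noteq> 99" "C < 98"
  shows "run (muldiv_com C A B D) (s, l) U
    (\<lambda>(s', l'). s' = s \<and> (\<exists>X P R. good X \<and>
       fps_small p L M (list_series X * list_series (l D) - list_series (l A) * list_series (l B)) \<and>
       l' = l(99 := P, C := X, 98 := R)))"
proof -
  define P where "P = poly_times p M (l A) (l B)"
  have len: "length (l A) = L" "length (l B) = L" "length (l D) = L" "1 \<le> L"
    using A L by (auto simp: good_def)
  have res: "residues_list p M (l A)" "residues_list p M (l B)" "residues_list p M (l D)"
    using A by (auto simp: good_def residues_list_def Q_def)
  have resP: "residues_list p M P" using Q_pos by (auto simp: residues_list_def P_def poly_times_def Q_def)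
  have "l D \<noteq> []" using len by auto
  then obtain X R where div: "is_poly_div p M P (l D) X R"
    using is_poly_div_exists[OF p(1)] A by blast
  note X = poly_div_list_series[OF p(1) len div[unfolded P_def]]
  have s': "s 0 = int p" "s 11 = int M" using s by (auto simp: env_def)
  have M1: "1 \<le> M" using L by simp
  have lenP: "length P = 2 * L - 1" using len by (simp add: P_def poly_times_def mult_2 del: upt_Suc)
  have 1: "exec tI tM tD (PolyTimes 99 A B 0 11) (s, l) (tM L p M) (s, l(99 := P))"
    using exec_PolyTimes[of p s 0 M 11 l A B tI tM tD 99] s' p M1 res len by (simp add: P_def)
  have "exec tI tM tD (PolyDiv C 98 99 D 0 11) (s, l(99 := P)) (tD (2 * L - 1) p M)
      (s, l(99 := P, C := X, 98 := R))"
    using exec_PolyDiv[of p s 0 M 11 "l(99 := P)" 99 D X R tI tM tD C 98] s' p M1 res resP len lenP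
      D div L by (simp add: max_def split: if_splits)
  from exec_Seq[OF 1 this] have "exec tI tM tD (muldiv_com C A B D) (s, l) (tM L p M + tD (2 * L - 1) p M)
      (s, l(99 := P, C := X, 98 := R))" by (simp add: muldiv_com_def)
  moreover have "tM L p M + tD (2 * L - 1) p M \<le> U"
    using poly by (simp add: U_def L_def M_def)
  moreover have "good X" using X by (simp add: good_def Q_def)
  ultimately show ?thesis using X(3) unfolding run_def by blast
qed

end

section \<open>Approximation of series by arrays\<close>

text \<open>Since \<open>d \<le> m\<close>, the digits of \<open>a\<close> that are known show that
  the \<open>p\<close>-part of \<open>d\<close> divides \<open>a\<close>; the part prime to
  \<open>p\<close> is dealt with by adding a multiple of \<open>p^M\<close>. Any quotient then
  agrees with \<open>\<eta>\<close> up to a loss of the valuation of \<open>d\<close>, which is less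
  than \<open>d\<close>.\<close>

lemma divide_congruence:
  assumes p: "prime p" and d: "0 < d" "d \<le> m" "m \<le> M"
    and a: "rat_cong p m (of_int a) (of_nat d * \<eta>)" and \<eta>: "p_integral p \<eta>"
  shows "\<exists>x<d. int d dvd a + int x * int p ^ M"
    and "[int d * q = a] (mod int p ^ M) \<Longrightarrow> rat_cong p (m - d) (of_int q) \<eta>"
proof -
  have p0: "p \<noteq> 0" using p by (auto dest: prime_gt_0_nat)
  obtain v u where vu: "d = p ^ v * u" "\<not> p dvd u" "v < d" using p_part_exists[OF p d(1)] by metis
  have u0: "u \<noteq> 0" using vu d by auto
  have dvu: "(of_nat d :: rat) = of_nat p ^ v * of_nat u" by (subst vu(1)) simp
  define \<zeta> where "\<zeta> = (of_int a - of_nat d * \<eta>) / of_nat p ^ m"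
  have \<zeta>: "p_integral p \<zeta>" using a by (simp add: \<zeta>_def rat_cong_def)
  have pm: "(of_nat p ^ m :: rat) = of_nat p ^ v * of_nat p ^ (m - v)"
    using vu(3) d(2) by (simp flip: power_add)
  have "of_int a = of_nat d * \<eta> + of_nat p ^ m * \<zeta>" using p0 by (simp add: \<zeta>_def)
  hence "of_int a / of_nat p ^ v = of_nat u * \<eta> + of_nat p ^ (m - v) * \<zeta>"
    using p0 by (simp add: dvu pm field_simps)
  also have "p_integral p \<dots>"
    using p \<zeta> \<eta> by (intro p_integral_add p_integral_mult p_integral_power) auto
  finally have "int p ^ v dvd a" by (simp add: p_integral_of_int_div_iff[OF p])
  then obtain a' where a': "a = int p ^ v * a'" by blast
  show "\<exists>x<d. int d dvd a + int x * int p ^ M"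
  proof -
    have "coprime (int p ^ (M - v)) (int u)"
      using p vu(2) by (simp add: prime_imp_coprime)
    then obtain x where "[int p ^ (M - v) * x = 1] (mod int u)"
      using cong_solve_coprime_int by blast
    hence "[int p ^ (M - v) * x * (- a') = 1 * (- a')] (mod int u)" by (intro cong_mult cong_refl)
    hence "[int p ^ (M - v) * (x * (- a') mod int u) = - a'] (mod int u)"
      by (simp add: cong_def mod_mult_right_eq mult.assoc)
    hence dvd: "int u dvd a' + (x * (- a') mod int u) * int p ^ (M - v)"
      by (simp add: cong_iff_dvd_diff algebra_simps)
    define y where "y = nat (x * (- a') mod int u)"
    have y: "int y = x * (- a') mod int u" using u0 by (simp add: y_def)
    have "int y < int u" unfolding y using u0 by simp
    hence "y < u" by simp
    also have "u \<le> d" using p0 by (simp add: vu(1))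
    finally have "y < d" .
    moreover have "a + int y * int p ^ M = int p ^ v * (a' + int y * int p ^ (M - v))"
    proof -
      have "int p ^ M = int p ^ v * int p ^ (M - v)" using vu(3) d by (simp flip: power_add)
      thus ?thesis by (simp add: a' algebra_simps)
    qed
    hence "int d dvd a + int y * int p ^ M"
      using dvd by (simp add: vu(1) y mult_dvd_mono)
    ultimately show ?thesis by blast
  qed
  show "rat_cong p (m - d) (of_int q) \<eta>" if q: "[int d * q = a] (mod int p ^ M)"
  proof -
    have "rat_cong p m (of_int (int d * q)) (of_int a)"
      using q rat_cong_of_int_iff[OF p] rat_cong_weaken[OF p _ d(3)] by blast
    from rat_cong_trans[OF p this a] have "p_integral p (of_nat d * (of_int q - \<eta>) / of_nat p ^ m)"
      by (simp add: rat_cong_def algebra_simps)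
    hence "p_integral p (of_nat d * (of_int q - \<eta>) / of_nat p ^ m * (1 / of_int (int u)))"
      using p vu(2) by (intro p_integral_mult p_integral_inverse_int) auto
    moreover have "of_nat d * (of_int q - \<eta>) / of_nat p ^ m * (1 / of_int (int u)) =
        (of_int q - \<eta>) / of_nat p ^ (m - v)"
      using p0 u0 by (simp add: dvu pm)
    ultimately show ?thesis
      using rat_cong_weaken[OF p, of "m - v" "of_int q" \<eta> "m - d"] vu(3) by (simp add: rat_cong_def)
  qed
qed

section \<open>The fragments as operations on approximated series\<close>

context sigma_machine
begin

text \<open>Coefficients from \<open>j\<close> on may be wrong, but they are still residues, so the
  instructions remain applicable to the whole array.\<close>

definition approx :: "nat \<Rightarrow> nat \<Rightarrow> int list \<Rightarrow> rat fps \<Rightarrow> bool" where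
  "approx j m X F \<longleftrightarrow> good X \<and> j \<le> L \<and> m \<le> M \<and> fps_small p j m (list_series X - F)"

lemma approx_good: "approx j m X F \<Longrightarrow> good X" by (simp add: approx_def)

lemma approx_weaken: "approx j m X F \<Longrightarrow> j' \<le> j \<Longrightarrow> m' \<le> m \<Longrightarrow> approx j' m' X F"
  using fps_small_mono[OF p(1)] by (auto simp: approx_def)

lemma approx_self: "good X \<Longrightarrow> approx L M X (list_series X)"
  using p by (auto simp: approx_def intro: fps_small_0I)

lemma list_series_good: "good X \<Longrightarrow> list_series X $ k = (if k < L then of_int (X ! (L - 1 - k)) else 0)"
  by (simp add: list_series_nth good_def)

lemma approx_nth:
  "approx j m X F \<Longrightarrow> k < j \<Longrightarrow> rat_cong p m (of_int (X ! (L - 1 - k))) (F $ k)"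
  by (auto simp: approx_def list_series_good rat_cong_def dest!: fps_smallD)

lemma approxI:
  assumes "good X" "j \<le> L" "m \<le> M" "\<And>k. k < j \<Longrightarrow> rat_cong p m (of_int (X ! (L - 1 - k))) (F $ k)"
  shows "approx j m X F"
  using assms by (auto simp: approx_def fps_small_def list_series_good rat_cong_def)

text \<open>An integer array at integral distance from \<open>F\<close> makes \<open>F\<close>
  integral, so integrality need not be carried along separately.\<close>

lemma approx_integral: "approx j m X F \<Longrightarrow> fps_small p j 0 F"
  using fps_small_diff[OF p(1) fps_small_list_series[OF p(1), of j X], of "list_series X - F"]
    fps_small_mono[OF p(1), of j m "list_series X - F" j 0]
  by (simp add: approx_def)

lemma approx_lin:
  assumes A: "approx j m A F" and B: "approx j m B G"
    and X: "length X = L" "\<forall>i<L. X ! i = (A ! i * x + B ! i * y) mod Q"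
  shows "approx j m X (of_int x * F + of_int y * G)"
proof -
  have gX: "good X" using X Q_pos by (intro goodI) auto
  have "fps_small p j m (list_series X - (of_int x * list_series A + of_int y * list_series B))"
    unfolding fps_small_def
  proof (intro allI impI)
    fix k assume k: "k < j"
    hence kL: "k < L" using A by (simp add: approx_def)
    let ?i = "L - 1 - k"
    have i: "?i < L" using kL by simp
    have "(list_series X - (of_int x * list_series A + of_int y * list_series B)) $ k =
        of_int (X ! ?i - (A ! ?i * x + B ! ?i * y))"
      using kL gX A B by (simp add: list_series_good approx_good fps_of_int[symmetric] mult.commute)
    moreover have "int p ^ M dvd X ! ?i - (A ! ?i * x + B ! ?i * y)"
      using X i by (simp add: Q_def flip: mod_eq_dvd_iff)
    hence "int p ^ m dvd X ! ?i - (A ! ?i * x + B ! ?i * y)"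
      using A by (meson approx_def dvd_trans le_imp_power_dvd)
    ultimately show "p_integral p ((list_series X - (of_int x * list_series A + of_int y * list_series B)) $ k /
        of_nat p ^ m)"
      by (simp only: p_integral_of_int_div_iff[OF p(1)])
  qed
  moreover have "fps_small p j m (of_int x * (list_series A - F) + of_int y * (list_series B - G))"
    using A B p by (intro fps_small_add fps_small_mult_left) (auto simp: approx_def)
  ultimately have "fps_small p j m (list_series X - (of_int x * list_series A + of_int y * list_series B) +
      (of_int x * (list_series A - F) + of_int y * (list_series B - G)))"
    by (rule fps_small_add[OF p(1)])
  moreover have "list_series X - (of_int x * list_series A + of_int y * list_series B) +
      (of_int x * (list_series A - F) + of_int y * (list_series B - G)) =
      list_series X - (of_int x * F + of_int y * G)" by (simp add: algebra_simps)
  ultimately show ?thesis using gX A by (simp add: approx_def)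
qed

lemma run_lin_approx:
  assumes s: "env s" "x < 40" "y < 40" "\<bar>s x\<bar> \<le> W" "\<bar>s y\<bar> \<le> W"
    and AB: "approx j m (l A) F" "approx j m (l B) G" "A \<noteq> C" "B \<noteq> C"
    and R: "\<And>s' X. \<forall>z<40. s' z = s z \<Longrightarrow> env s' \<Longrightarrow> approx j m X (of_int (s x) * F + of_int (s y) * G) \<Longrightarrow>
      R (s', l(C := X))"
  shows "run (lin_com C x A y B) (s, l) U R"
  by (rule run_weaken[OF run_lin[OF s approx_good[OF AB(1)] approx_good[OF AB(2)] AB(3,4)]])
     (use R approx_lin[OF AB(1,2)] env_agree[OF s(1)] in blast)

lemma run_monom_approx:
  assumes s: "env s" "k < 40" "s k = int j" "j \<le> 8"
    and R: "\<And>s' X. \<forall>z<40. s' z = s z \<Longrightarrow> env s' \<Longrightarrow> approx L M X (fps_X ^ j) \<Longrightarrow> R (s', l(C := X))"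
  shows "run (monom_com C k) (s, l) U R"
proof (rule run_weaken[OF run_monom[OF s]])
  fix st assume "case st of (s', l') \<Rightarrow> (\<forall>y<40. s' y = s y) \<and>
       (\<exists>X. length X = L \<and> (\<forall>i<L. X ! i = (if L - 1 - i = j then 1 else 0)) \<and> l' = l(C := X))"
  then obtain s' X where st: "st = (s', l(C := X))" "\<forall>y<40. s' y = s y" "length X = L"
    "\<forall>i<L. X ! i = (if L - 1 - i = j then 1 else 0)" by (cases st) auto
  have "1 < Q" using p L by (auto simp: Q_def M_def intro!: one_less_power)
  hence "good X" using st by (intro goodI) auto
  moreover have "rat_cong p M (of_int (X ! (L - 1 - k))) (fps_X ^ j $ k)" if "k < L" for k
    using st(4) that p by (auto simp: rat_cong_def)
  ultimately have "approx L M X (fps_X ^ j)" by (intro approxI) auto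
  thus "R st" using R st env_agree[OF s(1)] by blast
qed

lemma run_deriv_approx:
  assumes s: "env s" and A: "approx j m (l A) F" "A \<noteq> C"
    and R: "\<And>s' X. \<forall>z<40. s' z = s z \<Longrightarrow> env s' \<Longrightarrow> approx j m X (fps_X * fps_deriv F) \<Longrightarrow> R (s', l(C := X))"
  shows "run (deriv_com C A) (s, l) U R"
proof (rule run_weaken[OF run_deriv[where l = l and A = A and C = C, OF s approx_good[OF A(1)] A(2)]])
  fix st assume "case st of (s', l') \<Rightarrow> (\<forall>y<40. s' y = s y) \<and>
       (\<exists>X. length X = L \<and> (\<forall>i<L. X ! i = (l A ! i * int (L - 1 - i)) mod Q) \<and> l' = l(C := X))"
  then obtain s' X where st: "st = (s', l(C := X))" "\<forall>y<40. s' y = s y" "length X = L"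
    "\<forall>i<L. X ! i = (l A ! i * int (L - 1 - i)) mod Q" by (cases st) auto
  have "good X" using st Q_pos by (intro goodI) auto
  moreover have "rat_cong p m (of_int (X ! (L - 1 - k))) ((fps_X * fps_deriv F) $ k)" if k: "k < j" for k
  proof -
    have kL: "k < L" "m \<le> M" using A k by (auto simp: approx_def)
    hence "X ! (L - 1 - k) = (int k * l A ! (L - 1 - k)) mod Q"
      using st(4)[rule_format, of "L - 1 - k"] by (simp add: mult.commute)
    hence "[X ! (L - 1 - k) = int k * l A ! (L - 1 - k)] (mod int p ^ M)"
      by (simp add: cong_def Q_def)
    hence "rat_cong p M (of_int (X ! (L - 1 - k))) (of_int (int k * l A ! (L - 1 - k)))"
      by (simp only: rat_cong_of_int_iff[OF p(1)])
    hence "rat_cong p m (of_int (X ! (L - 1 - k))) (of_nat k * of_int (l A ! (L - 1 - k)))"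
      using rat_cong_weaken[OF p(1) _ kL(2)] by simp
    moreover have "p_integral p (of_nat k * ((of_int (l A ! (L - 1 - k)) - F $ k) / of_nat p ^ m))"
      using approx_nth[OF A(1) k] p by (intro p_integral_mult) (auto simp: rat_cong_def)
    hence "rat_cong p m (of_nat k * of_int (l A ! (L - 1 - k))) (of_nat k * F $ k)"
      by (simp add: rat_cong_def algebra_simps)
    moreover have "(fps_X * fps_deriv F) $ k = of_nat k * F $ k" by (cases k) auto
    ultimately show ?thesis using rat_cong_trans[OF p(1)] by metis
  qed
  ultimately have "approx j m X (fps_X * fps_deriv F)"
    using A by (intro approxI) (auto simp: approx_def)
  thus "R st" using R st env_agree[OF s(1)] by blast
qed

lemma last_good: "good X \<Longrightarrow> last X = X ! (L - 1)"
  using L by (cases "X = []") (auto simp: good_def last_conv_nth)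

text \<open>Besides the approximation, the continuation receives the congruence between the stored
  arrays at full precision \<open>M\<close>. It is needed where the constant coefficient 1 has to
  survive exactly.\<close>

lemma run_muldiv_approx:
  assumes s: "env s" and A: "approx j m (l A) F" "approx j m (l B) G" "approx j m (l D) K" "K $ 0 = 1"
    and jm: "1 \<le> j" "1 \<le> m" and D: "D \<noteq> 99" "C < 98" and eq: "Z * K = F * G"
    and R: "\<And>X P P'. approx j m X Z \<Longrightarrow>
       fps_small p L M (list_series X * list_series (l D) - list_series (l A) * list_series (l B)) \<Longrightarrow>
       R (s, l(99 := P, C := X, 98 := P'))"
  shows "run (muldiv_com C A B D) (s, l) U R"
proof -
  have p0: "p \<noteq> 0" using p by auto
  have cop: "coprime (last (l D)) (int p)"
  proof -
    have "rat_cong p m (of_int (last (l D))) (of_int 1)"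
      using approx_nth[OF A(3), of 0] jm A(4) last_good[OF approx_good[OF A(3)]] by simp
    hence "[last (l D) = 1] (mod int p ^ m)" by (simp only: rat_cong_of_int_iff[OF p(1)])
    moreover have "int p dvd int p ^ m" using jm by (simp add: dvd_power)
    ultimately have "[last (l D) = 1] (mod int p)" by (rule cong_dvd_modulus)
    thus ?thesis by (metis cong_imp_coprime cong_sym coprime_1_left)
  qed
  show ?thesis
  proof (rule run_weaken[OF run_muldiv[OF s approx_good[OF A(1)] approx_good[OF A(2)]
        approx_good[OF A(3)] cop D]])
    fix st assume "case st of (s', l') \<Rightarrow> s' = s \<and> (\<exists>X P R. good X \<and>
       fps_small p L M (list_series X * list_series (l D) - list_series (l A) * list_series (l B)) \<and>
       l' = l(99 := P, C := X, 98 := R))"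
    then obtain X P P' where st: "st = (s, l(99 := P, C := X, 98 := P'))" "good X"
      "fps_small p L M (list_series X * list_series (l D) - list_series (l A) * list_series (l B))"
      by (cases st) auto
    have jmLM: "j \<le> L" "m \<le> M" using A by (auto simp: approx_def)
    define a b d x where "a = list_series (l A)" and "b = list_series (l B)" and "d = list_series (l D)"
      and "x = list_series X"
    have int: "fps_small p j 0 a" "fps_small p j 0 b" "fps_small p j 0 d" "fps_small p j 0 x"
      "fps_small p j 0 F" "fps_small p j 0 G" "fps_small p j 0 K"
      using A p by (auto simp: a_def b_def d_def x_def fps_small_list_series approx_integral)
    have sm: "fps_small p j m (a - F)" "fps_small p j m (b - G)" "fps_small p j m (K - d)"
      using A fps_small_minus[OF p(1), of j m "d - K"] by (auto simp: approx_def a_def b_def d_def)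
    have "fps_small p j m (x * d - a * b)"
      using fps_small_mono[OF p(1) st(3) jmLM] by (simp add: a_def b_def d_def x_def)
    moreover have "fps_small p j m (x * (K - d))" by (rule fps_small_mult_left[OF p(1) int(4) sm(3)])
    moreover have "fps_small p j m ((a - F) * b)" by (rule fps_small_mult_right[OF p(1) sm(1) int(2)])
    moreover have "fps_small p j m (F * (b - G))" by (rule fps_small_mult_left[OF p(1) int(5) sm(2)])
    \<comment> \<open>The errors of the divisor, of the truncated division and of the two factors
      telescope to \<open>(x - Z) * K\<close>.\<close>
    ultimately have "fps_small p j m (x * (K - d) + (x * d - a * b) + ((a - F) * b + F * (b - G)))"
      using p by (intro fps_small_add)
    also have "x * (K - d) + (x * d - a * b) + ((a - F) * b + F * (b - G)) = (x - Z) * K"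
      using eq by (simp add: algebra_simps)
    finally have "fps_small p j m (x - Z)" by (rule fps_small_cancel[OF p(1) int(7) A(4)])
    hence "approx j m X Z" using st(2) jmLM by (simp add: approx_def x_def)
    thus "R st" using R st by blast
  qed
qed

text \<open>Each divisor \<open>k - o'\<close> is below \<open>c\<close>, so a uniform charge of
  \<open>c\<close> digits covers all coefficients.\<close>

lemma run_integrate_approx:
  assumes s: "env s" "z < 40" "b < 40" "s z = int o'" "s b = int c" "o' \<le> c" "c \<le> m" "m \<le> M"
    and A: "good (l A)" "A \<noteq> C"
    and F: "\<And>k. k < L \<Longrightarrow> o' < k \<Longrightarrow> k < c \<Longrightarrow> p_integral p (F $ k) \<and>
       rat_cong p m (of_int (l A ! (L - 1 - k))) (of_nat (k - o') * F $ k)"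
    and R: "\<And>s' X. \<forall>z<40. s' z = s z \<Longrightarrow> env s' \<Longrightarrow> good X \<Longrightarrow>
       (\<forall>k<L. o' < k \<and> k < c \<longrightarrow> rat_cong p (m - c) (of_int (X ! (L - 1 - k))) (F $ k)) \<Longrightarrow>
       R (s', l(C := X))"
  shows "run (integrate_com C A z b) (s, l) U R"
proof -
  have cS: "int c \<le> S" "int o' \<le> S" using S_ge s by linarith+
  show ?thesis
  proof (rule run_weaken[OF run_integrate[where l = l and A = A and C = C, OF s(1-5) cS(2,1) A]])
    fix k assume k: "k < L" "o' < k" "k < c"
    have "k - o' \<le> m" "0 < k - o'" using k s by auto
    from divide_congruence(1)[OF p(1) this(2,1) s(8)] F[OF k]
    show "\<exists>x<k - o'. int (k - o') dvd l A ! (L - 1 - k) + int x * Q"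
      unfolding Q_def by blast
  next
    fix st assume "case st of (s', l') \<Rightarrow> (\<forall>y<40. s' y = s y) \<and>
       (\<exists>X. good X \<and> (\<forall>k<L. if o' < k \<and> k < c
            then [int (k - o') * X ! (L - 1 - k) = l A ! (L - 1 - k)] (mod Q)
            else X ! (L - 1 - k) = 0) \<and> l' = l(C := X))"
    then obtain s' X where st: "st = (s', l(C := X))" "\<forall>y<40. s' y = s y" "good X"
      "\<forall>k<L. if o' < k \<and> k < c then [int (k - o') * X ! (L - 1 - k) = l A ! (L - 1 - k)] (mod Q)
            else X ! (L - 1 - k) = 0" by (cases st) auto
    have "rat_cong p (m - c) (of_int (X ! (L - 1 - k))) (F $ k)" if k: "k < L" "o' < k" "k < c" for k
    proof -
      have d: "k - o' \<le> m" "0 < k - o'" using k s by auto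
      have "[int (k - o') * X ! (L - 1 - k) = l A ! (L - 1 - k)] (mod int p ^ M)"
        using st(4)[rule_format, OF k(1)] k by (simp only: Q_def if_True simp_thms)
      hence "rat_cong p (m - (k - o')) (of_int (X ! (L - 1 - k))) (F $ k)"
        by (rule divide_congruence(2)[OF p(1) d(2,1) s(8) conjunct2[OF F[OF k]] conjunct1[OF F[OF k]]])
      thus ?thesis by (rule rat_cong_weaken[OF p(1)]) (use k in simp)
    qed
    thus "R st" using R st env_agree[OF s(1)] by blast
  qed
qed

end

section \<open>The program\<close>

definition w_lin :: "weierstrass \<Rightarrow> rat fps" where
  "w_lin E = 1 - of_int (a1 E) * fps_X - of_int (a2 E) * fps_X^2"

definition w_quad :: "weierstrass \<Rightarrow> rat fps" where
  "w_quad E = of_int (a3 E) * fps_X^3 + of_int (a4 E) * fps_X^4"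

definition w_cub :: "weierstrass \<Rightarrow> rat fps" where
  "w_cub E = of_int (a6 E) * fps_X^6"

text \<open>The derivative with respect to \<open>h\<close> of the cubic equation for
  \<open>w_unit\<close>, at \<open>F\<close>: the denominator of the Newton step. At the solution it
  is \<open>omega_inv\<close>, so evaluating it once more after the iteration yields the invariant
  differential.\<close>

definition w_den :: "weierstrass \<Rightarrow> rat fps \<Rightarrow> rat fps" where
  "w_den E F = w_lin E - (2 * w_quad E + 3 * (w_cub E * F)) * F"

lemma w_den_w_unit: "w_den E (w_unit E) = omega_inv E"
  by (simp add: w_den_def omega_inv_def w_lin_def w_quad_def w_cub_def algebra_simps power2_eq_square)

lemma w_unit_eq': "w_lin E * w_unit E = 1 + w_quad E * (w_unit E)^2 + w_cub E * (w_unit E)^3"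
  using w_unit_eq[of E] unfolding w_lin_def w_quad_def w_cub_def by algebra

lemma w_den_nth_0 [simp]: "w_den E F $ 0 = 1"
  by (simp add: w_den_def w_lin_def w_quad_def w_cub_def)

lemma fps_small_w_coeffs:
  assumes "prime p"
  shows "fps_small p j 0 (w_lin E)" "fps_small p j 0 (w_quad E)" "fps_small p j 0 (w_cub E)"
  unfolding w_lin_def w_quad_def w_cub_def using assms
  by (intro fps_small_diff fps_small_add fps_small_mult_left fps_small_power; simp)+

text \<open>The hypothesis on \<open>G\<close> is Newton's step with its denominator cleared. For a
  cubic the Taylor remainder is exactly \<open>(F - w_unit)^2\<close> times a polynomial with
  integral coefficients, so terms double without loss of digits.\<close>

lemma w_newton:
  assumes p: "prime p" and F: "fps_small p n 0 F" "fps_small p j m (F - w_unit E)"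
    and G: "G * w_den E F = 1 - (w_quad E + 2 * (w_cub E * F)) * F * F"
  shows "fps_small p (min (2 * j) n) m (G - w_unit E)"
proof -
  let ?h = "w_unit E"
  have h: "fps_small p n 0 ?h" by (rule fps_small_w_unit[OF p])
  have "fps_small p n 0 (F - ?h)" by (intro fps_small_diff p F h)
  hence "fps_small p (min (2 * j) n) m ((F - ?h) * (F - ?h))"
    by (intro fps_small_square p F)
  moreover have c: "fps_small p (min (2 * j) n) 0 F" "fps_small p (min (2 * j) n) 0 ?h"
    using fps_small_mono[OF p F(1)] fps_small_w_unit[OF p] by auto
  moreover have "fps_small p (min (2 * j) n) 0 (- w_quad E - w_cub E * (?h + 2 * F))"
    using p fps_small_w_coeffs[OF p] c
    by (intro fps_small_mult_left fps_small_diff fps_small_minus fps_small_add) auto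
  ultimately have "fps_small p (min (2 * j) n) m ((- w_quad E - w_cub E * (?h + 2 * F)) * ((F - ?h) * (F - ?h)))"
    using fps_small_mult_left[OF p] by blast
  also have "(- w_quad E - w_cub E * (?h + 2 * F)) * ((F - ?h) * (F - ?h)) = (G - ?h) * w_den E F"
    using G w_unit_eq'[of E] unfolding w_den_def by algebra
  finally have *: "fps_small p (min (2 * j) n) m ((G - ?h) * w_den E F)" .
  have "fps_small p (min (2 * j) n) 0 (w_den E F)"
    unfolding w_den_def using p fps_small_w_coeffs[OF p] c
    by (intro fps_small_diff fps_small_add fps_small_mult_left) auto
  from fps_small_cancel[OF p this w_den_nth_0 *] show ?thesis .
qed

text \<open>One Newton step for \<open>t g' = C g\<close>: if \<open>g = G (1 + \<eta>)\<close>, then \<open>C - t G' / G\<close> is the logarithmic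
  derivative of \<open>1 + \<eta>\<close>, which agrees with \<open>t \<eta>'\<close> up to the square of the error.\<close>

lemma dlog_newton:
  assumes p: "prime p" and G: "fps_small p n 0 G" "G $ 0 = 1" and g: "fps_small p n 0 g" "g $ 0 = 1"
    and j: "fps_small p j m (G - g)" "j \<le> n" and ode: "fps_X * fps_deriv g = C * g"
    and d: "d = C - fps_X * fps_deriv G * inverse G"
  defines "\<eta> \<equiv> g * inverse G - 1"
  shows "fps_small p n 0 \<eta>" "\<eta> $ 0 = 0" "fps_small p (min (2 * j) n) m (d - fps_X * fps_deriv \<eta>)"
    "g = G * (1 + \<eta>)"
proof -
  have GG: "G * inverse G = 1" using G by (simp add: inverse_mult_eq_1')
  have iG: "fps_small p n 0 (inverse G)" by (rule fps_small_inverse[OF p G])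
  show \<eta>: "fps_small p n 0 \<eta>"
    unfolding \<eta>_def using p iG g by (intro fps_small_diff fps_small_mult_left) auto
  show "\<eta> $ 0 = 0" using G g by (simp add: \<eta>_def)
  show gG: "g = G * (1 + \<eta>)" using GG by (simp add: \<eta>_def algebra_simps)
  have iGj: "fps_small p j 0 (inverse G)" using fps_small_mono[OF p iG] j by auto
  have "fps_small p j m (- ((G - g) * inverse G))"
    using p iGj j by (intro fps_small_minus fps_small_mult_right)
  also have "- ((G - g) * inverse G) = \<eta>" using GG by (simp add: \<eta>_def algebra_simps)
  finally have \<eta>j: "fps_small p j m \<eta>" .
  have 1: "d * (1 + \<eta>) = fps_X * fps_deriv \<eta>"
  proof -
    have dG: "d * G = C * G - fps_X * fps_deriv G" using GG by (simp add: d algebra_simps)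
    have dg: "fps_deriv g = fps_deriv G * (1 + \<eta>) + G * fps_deriv \<eta>" by (subst gG) simp
    have "fps_X * (fps_deriv G * (1 + \<eta>) + G * fps_deriv \<eta>) = C * (G * (1 + \<eta>))"
      using ode unfolding dg gG[symmetric] .
    hence "(d * (1 + \<eta>)) * G = (fps_X * fps_deriv \<eta>) * G" using dG by algebra
    moreover have "G \<noteq> 0" using G by (metis fps_zero_nth zero_neq_one)
    ultimately show ?thesis by simp
  qed
  have unit: "(1 + \<eta>) $ 0 = 1" using G g by (simp add: \<eta>_def)
  have "fps_small p n 0 (1 + \<eta>)" using p \<eta> by (intro fps_small_add) auto
  hence dn: "fps_small p n 0 d"
    using fps_small_cancel[OF p _ unit, of n 0 d] fps_small_deriv[OF p \<eta>] by (simp add: 1)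
  have "fps_small p j 0 (1 + \<eta>)" using p fps_small_mono[OF p \<eta>] j by (intro fps_small_add) auto
  hence dj: "fps_small p j m d"
    using fps_small_cancel[OF p _ unit, of j m d] fps_small_deriv[OF p \<eta>j] by (simp add: 1)
  \<comment> \<open>Both \<open>d\<close> and \<open>\<eta>\<close> are small in their first
    \<open>j\<close> terms, so their product is small in \<open>2 j\<close> terms.\<close>
  have "fps_small p (min (2 * j) n) m (- (d * \<eta>))"
    by (intro fps_small_minus fps_small_square p dn dj \<eta> \<eta>j)
  also have "- (d * \<eta>) = d - fps_X * fps_deriv \<eta>" using 1 by (simp add: algebra_simps)
  finally show "fps_small p (min (2 * j) n) m (d - fps_X * fps_deriv \<eta>)" .
qed

text \<open>Integrality is read backwards from sigma: \<open>dlog_series\<close> is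
  \<open>t g' / g\<close> with \<open>g\<close> a unit, and zeta is
  \<open>omega_inv * (1 + dlog_series)\<close>. The defining formula of zeta, with its division by
  \<open>k - 1\<close>, would not show it.\<close>

lemma fps_small_zeta_series:
  assumes p: "prime p" and g: "fps_small p j 0 (sigma_unit E c)"
  shows "fps_small p j 0 (dlog_series E c)" "fps_small p j 0 (zeta_series E c)"
proof -
  show C: "fps_small p j 0 (dlog_series E c)"
    using fps_small_cancel[OF p g sigma_unit_nth_0, of 0 "dlog_series E c"] fps_small_deriv[OF p g]
    by (simp add: sigma_unit_deriv)
  have "zeta_series E c = omega_inv E * (1 + dlog_series E c)"
    using inverse_omega_inv[of E] by (simp add: dlog_series_def algebra_simps)
  thus "fps_small p j 0 (zeta_series E c)"
    using p C fps_small_omega_inv[OF p] by (auto intro!: fps_small_mult_left fps_small_add)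
qed

text \<open>Array 1 holds the series 1 (so that products are divisions by array 1), array 10 holds w_unit and
  array 11 holds omega_inv.\<close>

definition setup_com :: com where
  "setup_com = Load 8 1 ;; Load 20 16 ;; Times 11 20 1 ;; Minus 12 1 8 ;; Minus 13 12 8 ;;
     Minus 17 13 8 ;; Load 14 (-1) ;; Load 15 2 ;; Load 16 3 ;; pow_com 10 11"

definition tables_com :: com where
  "tables_com = monom_com 1 9 ;; monom_com 2 8 ;; monom_com 3 15 ;; monom_com 4 16 ;; Load 20 4 ;;
     monom_com 5 20 ;; Load 20 6 ;; monom_com 6 20 ;; lin_com 20 2 2 3 3 ;; lin_com 7 8 1 14 20 ;;
     lin_com 8 4 4 5 5 ;; lin_com 9 6 6 9 1"

definition den_com :: com where
  "den_com = muldiv_com 12 9 10 1 ;; lin_com 20 15 8 16 12 ;; muldiv_com 21 20 10 1 ;;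
     lin_com 11 8 7 14 21"

definition w_step_com :: com where
  "w_step_com = den_com ;; lin_com 20 8 8 15 12 ;; muldiv_com 21 20 10 1 ;; muldiv_com 20 21 10 1 ;;
     lin_com 21 8 1 14 20 ;; muldiv_com 10 21 1 11"

definition w_com :: com where
  "w_com = lin_com 10 8 1 9 1 ;; Load 21 1 ;; Minus 22 12 21 ;;
     WhilePos 22 (w_step_com ;; Plus 21 21 21 ;; Minus 22 12 21) ;; den_com"

definition c_com :: com where
  "c_com = Times 43 2 2 ;; Load 44 4 ;; Times 44 44 3 ;; Plus 43 43 44 ;; Minus 43 43 7 ;; Rem 43 43 10 ;;
     Load 44 12 ;; div_com ;; Minus 23 9 42"

definition half_com :: com where
  "half_com = Minus 43 9 2 ;; Rem 43 43 10 ;; Plus 44 15 9 ;; div_com ;; Plus 24 42 9"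

text \<open>Integration leaves the coefficients of 1 and \<open>t\<close> at 0; they sit at
  positions \<open>L - 1\<close> and \<open>L - 2\<close> and are set to 1 and to
  \<open>- a1 / 2\<close>. The last instruction subtracts the 1 in \<open>dlog_series\<close> by
  clearing the constant coefficient.\<close>

definition zeta_com :: com where
  "zeta_com = muldiv_com 20 1 1 10 ;; lin_com 21 14 20 23 3 ;; muldiv_com 20 21 1 11 ;;
     integrate_com 22 20 8 12 ;; Put 22 13 8 ;; Put 22 17 24 ;; muldiv_com 13 22 1 11 ;; Put 13 13 9"

text \<open>Register 21 is doubled at the start, so the integration stops at the new number of
  terms. Beyond it the dividends are not yet known to be multiples of their exponents, and those
  coefficients are dropped.\<close>

definition sigma_step_com :: com where
  "sigma_step_com = Plus 21 21 21 ;; deriv_com 20 14 ;; muldiv_com 23 20 1 14 ;; lin_com 20 8 13 14 23 ;;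
     integrate_com 23 20 9 21 ;; Put 23 13 8 ;; muldiv_com 14 14 23 1 ;; Minus 22 12 21"

text \<open>Reading from the end undoes the reversed storage. Register 60 starts at
  \<open>p^(N-1)\<close> and is divided by \<open>p\<close> in each round, so entry
  \<open>i\<close>, the coefficient of \<open>t^(i+1)\<close> in sigma, is reduced modulo
  \<open>p^(N-1-i)\<close>.\<close>

definition output_com :: com where
  "output_com = pow_com 60 12 ;; build_com 0 12 (Minus 43 13 40 ;; Get 43 14 43 ;; Rem 42 43 60 ;; Quot 60 60 0)"

definition sigma_com :: com where
  "sigma_com = setup_com ;; tables_com ;; w_com ;; c_com ;; half_com ;; zeta_com ;;
     lin_com 14 8 1 9 1 ;; Load 21 1 ;; Minus 22 12 21 ;; WhilePos 22 sigma_step_com ;; output_com"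

section \<open>Correctness and cost of the program\<close>

context sigma_machine
begin

lemma U_ge_U2: "20 * U2 \<le> U" "1 \<le> U"
proof -
  have "U2 * 1 \<le> (L + 1) * (U2 + L * U1)"
    by (subst mult.commute) (intro mult_le_mono; simp)
  thus "20 * U2 \<le> U" by (simp add: U_def)
  thus "1 \<le> U" using U_ge by simp
qed

definition tables :: "(nat \<Rightarrow> int list) \<Rightarrow> bool" where
  "tables l \<longleftrightarrow> approx L M (l 1) 1 \<and> approx L M (l 3) (fps_X ^ 2) \<and> approx L M (l 7) (w_lin E) \<and>
     approx L M (l 8) (w_quad E) \<and> approx L M (l 9) (w_cub E)"

lemma tables_cong: "tables l \<Longrightarrow> (\<And>A. A < 10 \<Longrightarrow> l' A = l A) \<Longrightarrow> tables l'"
  by (simp add: tables_def)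

lemma approx_cong: "approx j m X F \<Longrightarrow> fps_small p j m (F - G) \<Longrightarrow> approx j m X G"
  using fps_small_add[OF p(1), of j m "list_series X - F" "F - G"] by (simp add: approx_def)

lemma run_den:
  assumes s: "env s" and l: "tables l" and F: "approx j m (l 10) F" and jm: "1 \<le> j" "1 \<le> m"
  shows "run den_com (s, l) (4 * U) (\<lambda>(s', l'). (\<forall>z<40. s' z = s z) \<and>
    (\<forall>A. A \<notin> {11, 12, 20, 21, 98, 99} \<longrightarrow> l' A = l A) \<and>
    approx j m (l' 11) (w_den E F) \<and> approx j m (l' 12) (w_cub E * F))"
    (is "run _ _ _ ?R")
proof -
  have jL: "j \<le> L" "m \<le> M" using F by (auto simp: approx_def)
  have T: "approx j m (l 1) 1" "approx j m (l 7) (w_lin E)" "approx j m (l 8) (w_quad E)"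
    "approx j m (l 9) (w_cub E)"
    using l approx_weaken[OF _ jL] by (auto simp: tables_def)
  have es: "s 8 = 1" "s 14 = -1" "s 15 = 2" "s 16 = 3" using s by (auto simp: env_def)
  have "run den_com (s, l) (U + (U + (U + U))) ?R"
    unfolding den_com_def
  proof (rule run_Seq, rule run_muldiv_approx[where j = j and m = m and F = "w_cub E" and G = F
        and K = 1 and Z = "w_cub E * F"])
    fix X1 P1 P1' assume X1: "approx j m X1 (w_cub E * F)"
    let ?l = "l(99 := P1, 12 := X1, 98 := P1')"
    show "run (lin_com 20 15 8 16 12 ;; muldiv_com 21 20 10 1 ;; lin_com 11 8 7 14 21) (s, ?l) (U + (U + U)) ?R"
    proof (rule run_Seq, rule run_lin_approx[where j = j and m = m and F = "w_quad E" and G = "w_cub E * F"])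
      fix s' X2 assume s': "\<forall>z<40. s' z = s z" "env s'"
        and "approx j m X2 (of_int (s 15) * w_quad E + of_int (s 16) * (w_cub E * F))"
      hence X2: "approx j m X2 (2 * w_quad E + 3 * (w_cub E * F))" by (simp add: es)
      let ?l = "l(99 := P1, 12 := X1, 98 := P1', 20 := X2)"
      show "run (muldiv_com 21 20 10 1 ;; lin_com 11 8 7 14 21) (s', ?l) (U + U) ?R"
      proof (rule run_Seq, rule run_muldiv_approx[where j = j and m = m
          and F = "2 * w_quad E + 3 * (w_cub E * F)" and G = F
          and K = 1 and Z = "(2 * w_quad E + 3 * (w_cub E * F)) * F"])
        fix X3 P2 P2' assume X3: "approx j m X3 ((2 * w_quad E + 3 * (w_cub E * F)) * F)"
        let ?l = "l(99 := P1, 12 := X1, 98 := P1', 20 := X2, 99 := P2, 21 := X3, 98 := P2')"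
        show "run (lin_com 11 8 7 14 21) (s', ?l) U ?R"
        proof (rule run_lin_approx[where j = j and m = m and F = "w_lin E"
            and G = "(2 * w_quad E + 3 * (w_cub E * F)) * F"])
          fix s'' X4 assume s'': "\<forall>z<40. s'' z = s' z" "env s''"
            and "approx j m X4 (of_int (s' 8) * w_lin E +
              of_int (s' 14) * ((2 * w_quad E + 3 * (w_cub E * F)) * F))"
          hence "approx j m X4 (w_den E F)" using s' by (simp add: es w_den_def)
          thus "?R (s'', ?l(11 := X4))" using s' s'' X1 by simp
        qed (use s' X3 T W_ge es in auto)
      qed (use s' X2 T F jm in auto)
    qed (use s X1 T W_ge es in auto)
  qed (use s T F jm in auto)
  thus ?thesis by (rule run_mono) simp
qed

lemma run_w_step:
  assumes s: "env s" and l: "tables l" and h: "approx j M (l 10) (w_unit E)"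
  shows "run w_step_com (s, l) (9 * U) (\<lambda>(s', l'). (\<forall>z<40. s' z = s z) \<and> env s' \<and> tables l' \<and>
    approx (min (2 * j) L) M (l' 10) (w_unit E))"
    (is "run _ _ _ ?R")
proof -
  \<comment> \<open>The step is followed exactly, at full length and precision, for the stored
    series \<open>F\<close>; the distance to \<open>w_unit\<close> enters only at the end, through
    \<open>w_newton\<close>.\<close>
  define F where "F = list_series (l 10)"
  have g10: "good (l 10)" using h by (rule approx_good)
  have F: "approx L M (l 10) F" unfolding F_def by (rule approx_self[OF g10])
  have jm: "1 \<le> L" "1 \<le> M" using L by auto
  have Fsm: "fps_small p L 0 F" "fps_small p j M (F - w_unit E)"
    using h fps_small_list_series[OF p(1)] by (auto simp: F_def approx_def)
  let ?N = "(w_quad E + 2 * (w_cub E * F)) * F * F"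
  have "run w_step_com (s, l) (4 * U + (U + (U + (U + (U + U))))) ?R"
    unfolding w_step_com_def
  proof (rule run_Seq2[OF run_den[OF s l F jm]], clarify)
    fix s0 l0 assume s0: "\<forall>z<40. s0 z = s z"
      and fr: "\<forall>A. A \<notin> {11, 12, 20, 21, 98, 99} \<longrightarrow> l0 A = l A"
      and D: "approx L M (l0 11) (w_den E F)" "approx L M (l0 12) (w_cub E * F)"
    have e0: "env s0" by (rule env_agree[OF s s0])
    have es: "s0 8 = 1" "s0 14 = -1" "s0 15 = 2" using e0 by (auto simp: env_def)
    have l0: "tables l0" by (rule tables_cong[OF l]) (use fr in auto)
    have T: "approx L M (l0 1) 1" "approx L M (l0 8) (w_quad E)" "approx L M (l0 10) F"
      using l0 F fr by (auto simp: tables_def)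
    show "run (lin_com 20 8 8 15 12 ;; muldiv_com 21 20 10 1 ;; muldiv_com 20 21 10 1 ;;
        lin_com 21 8 1 14 20 ;; muldiv_com 10 21 1 11) (s0, l0) (U + (U + (U + (U + U)))) ?R"
    proof (rule run_Seq, rule run_lin_approx[where j = L and m = M and F = "w_quad E" and G = "w_cub E * F"])
      fix s1 X1 assume s1: "\<forall>z<40. s1 z = s0 z" "env s1"
        and "approx L M X1 (of_int (s0 8) * w_quad E + of_int (s0 15) * (w_cub E * F))"
      hence X1: "approx L M X1 (w_quad E + 2 * (w_cub E * F))" by (simp add: es)
      show "run (muldiv_com 21 20 10 1 ;; muldiv_com 20 21 10 1 ;; lin_com 21 8 1 14 20 ;;
          muldiv_com 10 21 1 11) (s1, l0(20 := X1)) (U + (U + (U + U))) ?R"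
      proof (rule run_Seq, rule run_muldiv_approx[where j = L and m = M and F = "w_quad E + 2 * (w_cub E * F)"
          and G = F and K = 1 and Z = "(w_quad E + 2 * (w_cub E * F)) * F"])
        fix X2 P2 P2' assume X2: "approx L M X2 ((w_quad E + 2 * (w_cub E * F)) * F)"
        let ?l = "l0(20 := X1, 99 := P2, 21 := X2, 98 := P2')"
        show "run (muldiv_com 20 21 10 1 ;; lin_com 21 8 1 14 20 ;; muldiv_com 10 21 1 11)
            (s1, ?l) (U + (U + U)) ?R"
        proof (rule run_Seq, rule run_muldiv_approx[where j = L and m = M
            and F = "(w_quad E + 2 * (w_cub E * F)) * F" and G = F and K = 1 and Z = ?N])
          fix X3 P3 P3' assume X3: "approx L M X3 ?N"
          let ?l = "l0(20 := X1, 99 := P2, 21 := X2, 98 := P2', 99 := P3, 20 := X3, 98 := P3')"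
          show "run (lin_com 21 8 1 14 20 ;; muldiv_com 10 21 1 11) (s1, ?l) (U + U) ?R"
          proof (rule run_Seq, rule run_lin_approx[where j = L and m = M and F = 1 and G = ?N])
            fix s2 X4 assume s2: "\<forall>z<40. s2 z = s1 z" "env s2"
              and "approx L M X4 (of_int (s1 8) * 1 + of_int (s1 14) * ?N)"
            hence X4: "approx L M X4 (1 - ?N)" using s1 by (simp add: es)
            let ?l = "l0(20 := X1, 99 := P2, 21 := X2, 98 := P2', 99 := P3, 20 := X3, 98 := P3', 21 := X4)"
            define Z where "Z = (1 - ?N) * inverse (w_den E F)"
            have Z: "Z * w_den E F = 1 - ?N"
              unfolding Z_def mult.assoc by (simp add: inverse_mult_eq_1)
            show "run (muldiv_com 10 21 1 11) (s2, ?l) U ?R"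
            proof (rule run_muldiv_approx[where j = L and m = M and F = "1 - ?N" and G = 1
                and K = "w_den E F" and Z = Z])
              fix X5 P5 P5' assume X5: "approx L M X5 Z"
              have "approx (min (2 * j) L) M X5 Z" using X5 by (rule approx_weaken) auto
              from approx_cong[OF this w_newton[OF p(1) Fsm Z]]
              have "approx (min (2 * j) L) M X5 (w_unit E)" .
              moreover have "tables (?l(99 := P5, 10 := X5, 98 := P5'))"
                by (rule tables_cong[OF l0]) auto
              ultimately show "?R (s2, ?l(99 := P5, 10 := X5, 98 := P5'))"
                using s0 s1 s2 by simp
            qed (use s2 X4 T D jm Z in auto)
          qed (use s1 X3 T W_ge es in auto)
        qed (use s1 X2 T jm in auto)
      qed (use s1 X1 T jm in auto)
    qed (use e0 D T W_ge es in auto)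
  qed
  thus ?thesis by (rule run_mono) simp
qed


lemma env_upd: "env s \<Longrightarrow> 18 \<le> x \<Longrightarrow> env (s(x := v))"
  by (simp add: env_def)

lemma run_setup:
  assumes s: "s 0 = int p" "s 1 = int N" "s 2 = a1 E" "s 3 = a2 E" "s 4 = a3 E" "s 5 = a4 E"
     "s 6 = a6 E" "s 7 = e" "s 9 = 0"
  shows "run setup_com (s, l) (6 * U) (\<lambda>(s', l'). env s' \<and> l' = l)" (is "run _ _ _ ?R")
proof -
  have B: "16 * int N \<le> H" "int N \<le> H" "16 \<le> H" using S_ge S_le_H by linarith+
  let ?s = "s(8 := 1, 20 := 16, 11 := 16 * int N, 12 := int N - 1, 13 := int N - 2, 17 := int N - 3,
    14 := -1, 15 := 2, 16 := 3)"
  have pw: "run (pow_com 10 11) (?s, l) ((M + 1) * (5 * U2)) ?R"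
    by (rule run_weaken[OF run_pow[where m = M]])
       (use s N in \<open>auto simp: env_def L_def M_def Q_def of_nat_diff\<close>)
  have "run setup_com (s, l)
    (U2 + (U2 + (U2 + (U2 + (U2 + (U2 + (U2 + (U2 + (U2 + (M + 1) * (5 * U2)))))))))) ?R"
    unfolding setup_com_def
    by (intro run_Seq[where a = U2] run_Load run_Times run_Minus big) (use s B N pw in auto)
  thus ?thesis
  proof (rule run_mono)
    have "M + 1 \<le> 17 * (L + 1)" using N by (simp add: M_def L_def)
    hence "(M + 1) * (5 * U2) \<le> 17 * (L + 1) * (5 * U2)" by (intro mult_le_mono1)
    also have "\<dots> \<le> 5 * (20 * ((L + 1) * U2))" by (simp add: algebra_simps)
    also have "\<dots> \<le> 5 * U"
      unfolding U_def by (intro mult_le_mono2, rule trans_le_add2) (simp add: algebra_simps)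
    finally show "U2 + (U2 + (U2 + (U2 + (U2 + (U2 + (U2 + (U2 + (U2 + (M + 1) * (5 * U2))))))))) \<le> 6 * U"
      using U_ge_U2 by simp
  qed
qed

lemma run_tables:
  assumes s: "env s"
  shows "run tables_com (s, l) (12 * U) (\<lambda>(s', l'). env s' \<and> tables l')" (is "run _ _ _ ?R")
proof -
  have B: "\<bar>4\<bar> \<le> H" "\<bar>6\<bar> \<le> H" "\<bar>0\<bar> \<le> H" using S_ge S_le_H by auto
  have es: "s 2 = a1 E" "s 3 = a2 E" "s 4 = a3 E" "s 5 = a4 E" "s 6 = a6 E" "s 8 = 1" "s 9 = 0"
    "s 14 = -1" "s 15 = 2" "s 16 = 3" if "env s" for s using that by (auto simp: env_def)
  have "run tables_com (s, l) (U + (U + (U + (U + (U2 + (U + (U2 + (U + (U + (U + (U + U))))))))))) ?R"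
    unfolding tables_com_def
  proof (rule run_Seq, rule run_monom_approx[where j = 0])
    fix s1 X1 assume s1: "env s1" and X1: "approx L M X1 (fps_X ^ 0)"
    show "run (monom_com 2 8 ;; monom_com 3 15 ;; monom_com 4 16 ;; Load 20 4 ;;
     monom_com 5 20 ;; Load 20 6 ;; monom_com 6 20 ;; lin_com 20 2 2 3 3 ;; lin_com 7 8 1 14 20 ;;
     lin_com 8 4 4 5 5 ;; lin_com 9 6 6 9 1) (s1, l(1 := X1))
     (U + (U + (U + (U2 + (U + (U2 + (U + (U + (U + (U + U)))))))))) ?R"
    proof (rule run_Seq, rule run_monom_approx[where j = 1])
      fix s2 X2 assume s2: "env s2" and X2: "approx L M X2 (fps_X ^ 1)"
      show "run (monom_com 3 15 ;; monom_com 4 16 ;; Load 20 4 ;;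
       monom_com 5 20 ;; Load 20 6 ;; monom_com 6 20 ;; lin_com 20 2 2 3 3 ;; lin_com 7 8 1 14 20 ;;
       lin_com 8 4 4 5 5 ;; lin_com 9 6 6 9 1) (s2, l(1 := X1, 2 := X2))
       (U + (U + (U2 + (U + (U2 + (U + (U + (U + (U + U))))))))) ?R"
      proof (rule run_Seq, rule run_monom_approx[where j = 2])
        fix s3 X3 assume s3: "env s3" and X3: "approx L M X3 (fps_X ^ 2)"
        show "run (monom_com 4 16 ;; Load 20 4 ;;
         monom_com 5 20 ;; Load 20 6 ;; monom_com 6 20 ;; lin_com 20 2 2 3 3 ;; lin_com 7 8 1 14 20 ;;
         lin_com 8 4 4 5 5 ;; lin_com 9 6 6 9 1) (s3, l(1 := X1, 2 := X2, 3 := X3))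
         (U + (U2 + (U + (U2 + (U + (U + (U + (U + U)))))))) ?R"
        proof (rule run_Seq, rule run_monom_approx[where j = 3])
          fix s4 X4 assume s4: "env s4" and X4: "approx L M X4 (fps_X ^ 3)"
          let ?l4 = "l(1 := X1, 2 := X2, 3 := X3, 4 := X4)"
          show "run (Load 20 4 ;;
           monom_com 5 20 ;; Load 20 6 ;; monom_com 6 20 ;; lin_com 20 2 2 3 3 ;; lin_com 7 8 1 14 20 ;;
           lin_com 8 4 4 5 5 ;; lin_com 9 6 6 9 1) (s4, ?l4)
           (U2 + (U + (U2 + (U + (U + (U + (U + U))))))) ?R"
          proof (rule run_Seq, rule run_Load[OF big[OF B(1,3)]], rule run_Seq, rule run_monom_approx[where j = 4])
            fix s5 X5 assume s5: "env s5" and X5: "approx L M X5 (fps_X ^ 4)"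
            show "run (Load 20 6 ;; monom_com 6 20 ;; lin_com 20 2 2 3 3 ;; lin_com 7 8 1 14 20 ;;
             lin_com 8 4 4 5 5 ;; lin_com 9 6 6 9 1) (s5, ?l4(5 := X5))
             (U2 + (U + (U + (U + (U + U))))) ?R"
            proof (rule run_Seq, rule run_Load[OF big[OF B(2,3)]], rule run_Seq, rule run_monom_approx[where j = 6])
              fix s6 X6 assume s6: "env s6" and X6: "approx L M X6 (fps_X ^ 6)"
              let ?l6 = "?l4(5 := X5, 6 := X6)"
              show "run (lin_com 20 2 2 3 3 ;; lin_com 7 8 1 14 20 ;;
               lin_com 8 4 4 5 5 ;; lin_com 9 6 6 9 1) (s6, ?l6) (U + (U + (U + U))) ?R"
              proof (rule run_Seq, rule run_lin_approx[where j = L and m = M and F = "fps_X ^ 1" and G = "fps_X ^ 2"])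
                fix s7 X7 assume s7: "env s7"
                  and "approx L M X7 (of_int (s6 2) * fps_X ^ 1 + of_int (s6 3) * fps_X ^ 2)"
                hence X7: "approx L M X7 (of_int (a1 E) * fps_X + of_int (a2 E) * fps_X ^ 2)"
                  by (simp add: es[OF s6])
                show "run (lin_com 7 8 1 14 20 ;; lin_com 8 4 4 5 5 ;; lin_com 9 6 6 9 1)
                  (s7, ?l6(20 := X7)) (U + (U + U)) ?R"
                proof (rule run_Seq, rule run_lin_approx[where j = L and m = M and F = "fps_X ^ 0"
                    and G = "of_int (a1 E) * fps_X + of_int (a2 E) * fps_X ^ 2"])
                  fix s8 X8 assume s8: "env s8" and "approx L M X8 (of_int (s7 8) * fps_X ^ 0 +
                      of_int (s7 14) * (of_int (a1 E) * fps_X + of_int (a2 E) * fps_X ^ 2))"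
                  hence X8: "approx L M X8 (w_lin E)"
                    by (simp add: es[OF s7] w_lin_def algebra_simps)
                  show "run (lin_com 8 4 4 5 5 ;; lin_com 9 6 6 9 1)
                    (s8, ?l6(20 := X7, 7 := X8)) (U + U) ?R"
                  proof (rule run_Seq, rule run_lin_approx[where j = L and m = M and F = "fps_X ^ 3"
                      and G = "fps_X ^ 4"])
                    fix s9 X9 assume s9: "env s9"
                      and "approx L M X9 (of_int (s8 4) * fps_X ^ 3 + of_int (s8 5) * fps_X ^ 4)"
                    hence X9: "approx L M X9 (w_quad E)" by (simp add: es[OF s8] w_quad_def)
                    show "run (lin_com 9 6 6 9 1) (s9, ?l6(20 := X7, 7 := X8, 8 := X9)) U ?R"
                    proof (rule run_lin_approx[where j = L and m = M and F = "fps_X ^ 6" and G = "fps_X ^ 0"])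
                      fix s10 X10 assume s10: "env s10"
                        and "approx L M X10 (of_int (s9 6) * fps_X ^ 6 + of_int (s9 9) * fps_X ^ 0)"
                      hence X10: "approx L M X10 (w_cub E)" by (simp add: es[OF s9] w_cub_def)
                      show "?R (s10, ?l6(20 := X7, 7 := X8, 8 := X9, 9 := X10))"
                        using s10 X1 X3 X8 X9 X10 by (simp add: tables_def)
                    qed (use s9 X6 X1 W_ge es[OF s9] in auto)
                  qed (use s8 X4 X5 W_ge es[OF s8] in auto)
                qed (use s7 X7 X1 W_ge es[OF s7] in auto)
              qed (use s6 X2 X3 W_ge es[OF s6] in auto)
            qed (use env_upd[OF s5] in auto)
          qed (use env_upd[OF s4] in auto)
        qed (use s3 es[OF s3] in auto)
      qed (use s2 es[OF s2] in auto)
    qed (use s1 es[OF s1] in auto)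
  qed (use s es[OF s] in auto)
  thus ?thesis by (rule run_mono) (use U_ge_U2 in simp)
qed

lemma run_w:
  assumes s: "env s" and l: "tables l" and K: "L \<le> 2 ^ K"
  shows "run w_com (s, l) ((K + 1) * (12 * U)) (\<lambda>(s', l'). env s' \<and> tables l' \<and>
    approx L M (l' 10) (w_unit E) \<and> approx L M (l' 11) (omega_inv E))" (is "run _ _ _ ?R")
proof -
  have LH: "int L \<le> S" "2 * int L \<le> H" "0 \<le> H" "1 \<le> H" using S_ge S_le_H by linarith+
  have es: "s 8 = 1" "s 9 = 0" "s 12 = int L" if "env s" for s using that by (auto simp: env_def)
  define I where "I = (\<lambda>i (s', l'). env s' \<and> s' 21 = 2 ^ i \<and> s' 22 = int L - 2 ^ i \<and> tables l' \<and>
    approx (min (2 ^ i) L) M (l' 10) (w_unit E))"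
  have loop: "run (WhilePos 22 (w_step_com ;; Plus 21 21 21 ;; Minus 22 12 21)) st
      ((K - 0) * ((9 * U + (U2 + U2)) + 1) + 1)
      (\<lambda>(s', l'). env s' \<and> tables l' \<and> approx L M (l' 10) (w_unit E))" if "I 0 st" for st
  proof (rule run_WhilePos[where I = I])
    fix i st assume I: "I i st" and i: "i \<le> K" and pos: "0 < fst st 22"
    obtain s' l' where st: "st = (s', l')" by (cases st)
    have *: "env s'" "s' 21 = 2 ^ i" "s' 22 = int L - 2 ^ i" "tables l'"
      "approx (min (2 ^ i) L) M (l' 10) (w_unit E)" using I by (auto simp: I_def st)
    have "int (2 ^ i) < int L" using pos * by (simp add: st)
    hence iL: "2 ^ i < L" by (simp only: of_nat_less_iff)
    hence "(2::nat) ^ i < 2 ^ K" using K by (rule less_le_trans)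
    hence "i < K" by (rule power_less_imp_less_exp[rotated]) simp
    have "(2::int) ^ i < int L" using iL by (metis of_nat_less_iff of_nat_numeral of_nat_power)
    hence B: "(2::int) ^ i \<le> H" "(2::int) ^ i + 2 ^ i \<le> H" "int L \<le> H"
      using LH by linarith+
    have "run (w_step_com ;; Plus 21 21 21 ;; Minus 22 12 21) (s', l') (9 * U + (U2 + U2)) (I (Suc i))"
    proof (rule run_Seq2[OF run_w_step[OF *(1,4,5)]], clarify)
      fix s1 l1 assume s1: "\<forall>z<40. s1 z = s' z" "env s1" "tables l1"
        "approx (min (2 * min (2 ^ i) L) L) M (l1 10) (w_unit E)"
      hence "approx (min (2 ^ Suc i) L) M (l1 10) (w_unit E)" using iL by (simp add: min_def split: if_splits)
      thus "run (Plus 21 21 21 ;; Minus 22 12 21) (s1, l1) (U2 + U2) (I (Suc i))"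
        by (intro run_intros big) (use s1 * B es[OF s1(2)] in \<open>auto simp: I_def env_upd\<close>)
    qed
    thus "i < K \<and> run (w_step_com ;; Plus 21 21 21 ;; Minus 22 12 21) st (9 * U + (U2 + U2)) (I (Suc i))"
      using \<open>i < K\<close> by (simp add: st)
  next
    fix i st assume I: "I i st" and "fst st 22 \<le> 0"
    hence "int L \<le> int (2 ^ i)" by (cases st) (simp add: I_def)
    hence "L \<le> 2 ^ i" by (simp only: of_nat_le_iff)
    thus "case st of (s', l') \<Rightarrow> env s' \<and> tables l' \<and> approx L M (l' 10) (w_unit E)"
      using I by (cases st) (auto simp: I_def min_def split: if_splits)
  qed (use that in auto)
  have "run w_com (s, l) (U + (U2 + (U2 + (((K - 0) * ((9 * U + (U2 + U2)) + 1) + 1) + 4 * U)))) ?R"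
    unfolding w_com_def
  proof (rule run_Seq, rule run_lin_approx[where j = L and m = M and F = 1 and G = 1])
    fix s1 X assume s1: "env s1" and "approx L M X (of_int (s 8) * 1 + of_int (s 9) * 1)"
    hence X: "approx L M X 1" using es[OF s] by simp
    have "approx 1 M X (w_unit E)"
      by (rule approx_cong[OF approx_weaken[OF X]]) (use L p in \<open>auto intro: fps_small_0I\<close>)
    hence "I 0 (s1(21 := 1, 22 := int L - 1), l(10 := X))"
      using s1 l X L by (auto simp: I_def env_upd tables_def min_def)
    note lp = loop[OF this]
    have den: "run den_com st (4 * U) ?R"
      if "case st of (s', l') \<Rightarrow> env s' \<and> tables l' \<and> approx L M (l' 10) (w_unit E)" for st
    proof (cases st)
      case (Pair s' l')
      have *: "env s'" "tables l'" "approx L M (l' 10) (w_unit E)" using that Pair by auto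
      show ?thesis unfolding Pair
      proof (rule run_weaken[OF run_den[OF *]], goal_cases)
        case (3 st)
        thus ?case using env_agree[OF *(1)] tables_cong[OF *(2)] *(3)
          by (cases st) (simp add: w_den_w_unit)
      qed (use L in auto)
    qed
    show "run (Load 21 1 ;; Minus 22 12 21 ;;
      WhilePos 22 (w_step_com ;; Plus 21 21 21 ;; Minus 22 12 21) ;; den_com) (s1, l(10 := X))
      (U2 + (U2 + (((K - 0) * ((9 * U + (U2 + U2)) + 1) + 1) + 4 * U))) ?R"
      by (rule run_Seq, rule run_Load, rule big, use LH in simp, use LH in simp,
          rule run_Seq, rule run_Minus, rule big, use LH es[OF s1] in simp, use LH in simp,
          rule run_Seq2[OF _ den]) (use lp es[OF s1] in auto)
  qed (use s l es[OF s] W_ge in \<open>auto simp: tables_def\<close>)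
  thus ?thesis
  proof (rule run_mono)
    have "K * (9 * U + (U2 + U2) + 1) \<le> K * (12 * U)"
      using U_ge_U2 by (intro mult_le_mono2) simp
    moreover have "(K + 1) * (12 * U) = K * (12 * U) + 12 * U" by simp
    ultimately show "U + (U2 + (U2 + (((K - 0) * ((9 * U + (U2 + U2)) + 1) + 1) + 4 * U))) \<le> (K + 1) * (12 * U)"
      using U_ge_U2 by simp
  qed
qed

text \<open>Formed from the residue handed to the program, hence an exact rational number that only
  approximates the constant of the p-adic sigma function.\<close>

definition c where "c = (of_int ((a1 E)^2 + 4 * a2 E - e) / 12 :: rat)"

lemma c_integral: "p_integral p c"
  using p_integral_mult[OF p(1) p_integral_of_int[OF p(1), of "(a1 E)^2 + 4 * a2 E - e"] p_integral_twelfth[OF p]]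
  by (simp add: c_def)

lemma M_ge: "12 \<le> M" using N by (simp add: M_def)

lemma div_cost: "d \<le> 12 \<Longrightarrow> 8 * U2 + d * (3 * U1 + 1) \<le> 8 * U"
proof -
  assume d: "d \<le> 12"
  have "d * (3 * U1 + 1) \<le> 12 * (4 * U1)" using d U_ge by (intro mult_le_mono) auto
  moreover have "1 * (3 * U1) \<le> (L + 1) * (U2 + L * U1)"
    using L by (intro mult_le_mono trans_le_add2) auto
  ultimately show ?thesis using U_ge_U2 by (simp add: U_def)
qed

lemma mod_Q_bound: "0 \<le> x mod Q" "x mod Q < Q" "\<bar>x mod Q\<bar> \<le> H"
  using Q_pos W_ge(1) W_le_H W_ge(9) pos_mod_bound[of Q x] pos_mod_sign[of Q x] by linarith+

lemma rat_cong_mod_Q: "rat_cong p M (of_int (x mod Q)) (of_int x)"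
  by (simp add: rat_cong_of_int_iff[OF p(1)] Q_def cong_def)

lemma run_div_const:
  assumes s: "env s" "s 43 = x mod Q" "s 44 = int d" and d: "0 < d" "d \<le> 12"
    and \<eta>: "p_integral p \<eta>" "of_nat d * \<eta> = of_int x"
  shows "run div_com (s, l) (8 * U) (\<lambda>(s', l'). env s' \<and> l' = l \<and> s' 23 = s 23 \<and>
    0 \<le> s' 42 \<and> s' 42 < Q \<and> rat_cong p (M - d) (of_int (s' 42)) \<eta>)"
proof -
  have dM: "d \<le> M" using d M_ge by simp
  have rc: "rat_cong p M (of_int (x mod Q)) (of_nat d * \<eta>)"
    unfolding \<eta>(2) by (rule rat_cong_mod_Q)
  obtain y where y: "y < d" "int d dvd x mod Q + int y * Q"
    using divide_congruence(1)[OF p(1) d(1) dM order_refl rc \<eta>(1)] unfolding Q_def by blast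
  have "run div_com (s, l) (8 * U2 + d * (3 * U1 + 1)) (\<lambda>(s', l'). l' = l \<and>
      (\<forall>y. y \<notin> {42, 45, 46, 47, 48} \<longrightarrow> s' y = s y) \<and>
      0 \<le> s' 42 \<and> s' 42 < Q \<and> [int d * s' 42 = s 43] (mod Q))"
    by (rule run_div[OF _ _ _ _ _ _ _ y(1)])
       (use y s d S_ge mod_Q_bound in \<open>auto simp: env_def\<close>)
  hence "run div_com (s, l) (8 * U2 + d * (3 * U1 + 1)) (\<lambda>(s', l'). env s' \<and> l' = l \<and> s' 23 = s 23 \<and>
    0 \<le> s' 42 \<and> s' 42 < Q \<and> rat_cong p (M - d) (of_int (s' 42)) \<eta>)"
  proof (rule run_weaken, clarify)
    fix s' assume s': "\<forall>y. y \<notin> {42, 45, 46, 47, 48} \<longrightarrow> s' y = s y" "0 \<le> s' 42" "s' 42 < Q"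
      "[int d * s' 42 = s 43] (mod Q)"
    have "rat_cong p (M - d) (of_int (s' 42)) \<eta>"
      using divide_congruence(2)[OF p(1) d(1) dM order_refl rc \<eta>(1)] s'(4) s(2) by (simp add: Q_def)
    moreover have "env s'" by (rule env_agree[OF s(1)]) (use s' in auto)
    ultimately show "env s' \<and> l = l \<and> s' 23 = s 23 \<and> 0 \<le> s' 42 \<and> s' 42 < Q \<and>
        rat_cong p (M - d) (of_int (s' 42)) \<eta>" using s' by simp
  qed
  thus ?thesis by (rule run_mono) (rule div_cost[OF d(2)])
qed

text \<open>For \<open>p \<ge> 5\<close> the number 12 is a unit at \<open>p\<close>; the 12 digits
  given up are the uniform charge of \<open>divide_congruence\<close>. The result is stored with a
  minus sign, ready for use as a factor.\<close>

lemma run_c: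
  assumes s: "env s"
  shows "run c_com (s, l) (9 * U) (\<lambda>(s', l'). env s' \<and> l' = l \<and>
    (\<exists>q. s' 23 = - q \<and> 0 \<le> q \<and> q < Q \<and> rat_cong p (M - 12) (of_int q) c))" (is "run _ _ _ ?R")
proof -
  define x where "x = a1 E * a1 E + 4 * a2 E - e"
  have es: "s 2 = a1 E" "s 3 = a2 E" "s 7 = e" "s 8 = 1" "s 9 = 0" "s 10 = Q" using s by (auto simp: env_def)
  have e': "0 \<le> e" "e < Q" using e by (auto simp: Q_def M_def)
  have W4: "4 * W \<le> W * W" using W_ge by (intro mult_right_mono) auto
  have sq: "0 \<le> a1 E * a1 E" "a1 E * a1 E \<le> W * W" using H_ge_mult[OF W_ge(4) W_ge(4)] by auto
  have B: "\<bar>a1 E\<bar> \<le> H" "\<bar>a2 E\<bar> \<le> H" "a1 E * a1 E \<le> H" "\<bar>4 * a2 E\<bar> \<le> H" "\<bar>e\<bar> \<le> H" "\<bar>Q\<bar> \<le> H"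
      "12 \<le> H" "4 \<le> H" "0 \<le> H"
    using sq W_H W_le_H W_ge(1,3,4,5) e' by auto
  have B': "\<bar>a1 E * a1 E + 4 * a2 E\<bar> \<le> H" "\<bar>x\<bar> \<le> H"
    using sq W4 W_H W_ge(1,5) e' unfolding x_def by linarith+
  let ?s = "s(43 := x mod Q, 44 := 12)"
  have "run div_com (?s, l) (8 * U) (\<lambda>(s', l'). env s' \<and> l' = l \<and> s' 23 = ?s 23 \<and>
    0 \<le> s' 42 \<and> s' 42 < Q \<and> rat_cong p (M - 12) (of_int (s' 42)) c)"
    by (rule run_div_const[where x = x])
       (use s c_integral in \<open>auto simp: env_upd c_def x_def power2_eq_square\<close>)
  hence div: "run (div_com ;; Minus 23 9 42) (?s, l) (8 * U + U2) ?R"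
  proof (rule run_Seq2, clarify)
    fix s' assume "env s'" "0 \<le> s' 42" "s' 42 < Q" "rat_cong p (M - 12) (of_int (s' 42)) c"
    thus "run (Minus 23 9 42) (s', l) U2 ?R"
      by (intro run_Minus big) (use B in \<open>auto simp: env_upd env_def\<close>)
  qed
  have "run c_com (s, l) (U2 + (U2 + (U2 + (U2 + (U2 + (U2 + (U2 + (8 * U + U2)))))))) ?R"
    unfolding c_com_def
    apply (intro run_Seq[where a = U2] run_Load run_Times run_Minus run_Plus run_Rem big)
    using div by (simp_all add: es B B' x_def[symmetric])
  thus ?thesis by (rule run_mono) (use U_ge_U2 in simp)
qed

lemma run_half:
  assumes s: "env s"
  shows "run half_com (s, l) (9 * U) (\<lambda>(s', l'). env s' \<and> l' = l \<and> s' 23 = s 23 \<and>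
    0 \<le> s' 24 \<and> s' 24 < Q \<and> rat_cong p (M - 2) (of_int (s' 24)) (- of_int (a1 E) / 2))"
  (is "run _ _ _ ?R")
proof -
  define x where "x = - a1 E"
  have es: "s 2 = a1 E" "s 8 = 1" "s 9 = 0" "s 10 = Q" "s 15 = 2" using s by (auto simp: env_def)
  have B: "\<bar>a1 E\<bar> \<le> H" "\<bar>x\<bar> \<le> H" "\<bar>Q\<bar> \<le> H" "2 \<le> H" "0 \<le> H"
    using W_le_H W_ge Q_pos unfolding x_def by linarith+
  have int: "p_integral p (- of_int (a1 E) / 2)"
    using p_integral_mult[OF p(1) p_integral_of_int[OF p(1), of x] p_integral_half[OF p]] by (simp add: x_def)
  let ?s = "s(43 := x mod Q, 44 := 2)"
  have "run div_com (?s, l) (8 * U) (\<lambda>(s', l'). env s' \<and> l' = l \<and> s' 23 = ?s 23 \<and>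
    0 \<le> s' 42 \<and> s' 42 < Q \<and> rat_cong p (M - 2) (of_int (s' 42)) (- of_int (a1 E) / 2))"
    by (rule run_div_const[where x = x, OF _ _ _ _ _ int]) (use s in \<open>auto simp: env_upd x_def\<close>)
  hence div: "run (div_com ;; Plus 24 42 9) (?s, l) (8 * U + U2) ?R"
  proof (rule run_Seq2, clarify)
    fix s' assume "env s'" "s' 23 = ?s 23" "0 \<le> s' 42" "s' 42 < Q"
      "rat_cong p (M - 2) (of_int (s' 42)) (- of_int (a1 E) / 2)"
    thus "run (Plus 24 42 9) (s', l) U2 ?R"
      by (intro run_Plus big) (use B in \<open>auto simp: env_upd env_def\<close>)
  qed
  have "run half_com (s, l) (U2 + (U2 + (U2 + (8 * U + U2)))) ?R"
    unfolding half_com_def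
    apply (intro run_Seq[where a = U2] run_Minus run_Plus run_Rem big)
    using div by (simp_all add: es B x_def[symmetric])
  thus ?thesis by (rule run_mono) (use U_ge_U2 in simp)
qed


text \<open>The hypothesis \<open>su\<close> licenses the divisions: it makes zeta integral, so that
  the coefficients of \<open>- xc_series E c\<close> are true multiples of
  \<open>k - 1\<close>.\<close>

lemma run_zeta:
  assumes s: "env s" and l: "tables l" "approx L M (l 10) (w_unit E)" "approx L M (l 11) (omega_inv E)"
    and q: "s 23 = - q" "0 \<le> q" "q < Q" "rat_cong p (M - 12) (of_int q) c"
    and h: "0 \<le> s 24" "s 24 < Q" "rat_cong p (M - 2) (of_int (s 24)) (- of_int (a1 E) / 2)"
    and su: "fps_small p L 0 (sigma_unit E c)"
  shows "run zeta_com (s, l) (6 * U) (\<lambda>(s', l'). env s' \<and> tables l' \<and>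
    approx L (M - 12 - L) (l' 13) (dlog_series E c))" (is "run _ _ _ ?R")
proof -
  have es: "s 3 = a2 E" "s 8 = 1" "s 9 = 0" "s 12 = int L" "s 13 = int L - 1" "s 14 = -1" "s 17 = int L - 2"
    if "env s" for s using that by (auto simp: env_def)
  have LM: "1 \<le> L" "1 \<le> M" "1 \<le> M - 12" "L \<le> M - 12" "1 \<le> M - 12 - L" "M - 12 - L \<le> M - 2"
    "M - 12 - L \<le> M"
    using N by (auto simp: L_def M_def)
  have B: "int L \<le> H" "3 \<le> H" "1 \<le> H" "\<bar>s 24\<bar> \<le> H" "\<bar>q\<bar> \<le> W"
    using S_ge S_le_H W_le_H W_ge h q by linarith+
  have ih: "inverse (w_unit E) * w_unit E = 1" "inverse (omega_inv E) * omega_inv E = 1"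
    by (auto simp: inverse_mult_eq_1)
  have zeta: "fps_small p L 0 (zeta_series E c)" by (rule fps_small_zeta_series[OF p(1) su])
  have "run zeta_com (s, l) (U + (U + (U + (U + (U2 + (U2 + (U + U2))))))) ?R"
    unfolding zeta_com_def
  proof (rule run_Seq, rule run_muldiv_approx[where j = L and m = M and F = 1 and G = 1
      and K = "w_unit E" and Z = "inverse (w_unit E)"])
    fix X1 P1 P1' assume X1: "approx L M X1 (inverse (w_unit E))"
    let ?l1 = "l(99 := P1, 20 := X1, 98 := P1')"
    show "run (lin_com 21 14 20 23 3 ;; muldiv_com 20 21 1 11 ;; integrate_com 22 20 8 12 ;;
        Put 22 13 8 ;; Put 22 17 24 ;; muldiv_com 13 22 1 11 ;; Put 13 13 9) (s, ?l1)
        (U + (U + (U + (U2 + (U2 + (U + U2)))))) ?R"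
    proof (rule run_Seq, rule run_lin_approx[where j = L and m = M and F = "inverse (w_unit E)" and G = "fps_X ^ 2"])
      fix s2 X2 assume s2: "\<forall>z<40. s2 z = s z" "env s2"
        and "approx L M X2 (of_int (s 14) * inverse (w_unit E) + of_int (s 23) * fps_X ^ 2)"
      hence "approx L M X2 (- inverse (w_unit E) - of_int q * fps_X ^ 2)" by (simp add: es[OF s] q)
      hence X2': "approx L (M - 12) X2 (- inverse (w_unit E) - of_int q * fps_X ^ 2)"
        by (rule approx_weaken) auto
      have "fps_small p L (M - 12) (fps_const (c - of_int q))"
        using rat_cong_sym[OF p(1) q(4)] p by (intro fps_small_const) (auto simp: rat_cong_def)
      hence "fps_small p L (M - 12) (fps_const (c - of_int q) * fps_X ^ 2)"
        using p by (intro fps_small_mult_right fps_small_power) auto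
      hence "fps_small p L (M - 12) ((- inverse (w_unit E) - of_int q * fps_X ^ 2) -
          (- inverse (w_unit E) - fps_const c * fps_X ^ 2))"
        by (simp add: algebra_simps flip: fps_const_sub) (simp add: fps_of_int[symmetric])
      from approx_cong[OF X2' this]
      have X2: "approx L (M - 12) X2 (- inverse (w_unit E) - fps_const c * fps_X ^ 2)" .
      let ?l2 = "l(99 := P1, 20 := X1, 98 := P1', 21 := X2)"
      show "run (muldiv_com 20 21 1 11 ;; integrate_com 22 20 8 12 ;;
        Put 22 13 8 ;; Put 22 17 24 ;; muldiv_com 13 22 1 11 ;; Put 13 13 9) (s2, ?l2)
        (U + (U + (U2 + (U2 + (U + U2))))) ?R"
      proof (rule run_Seq, rule run_muldiv_approx[where j = L and m = "M - 12"
          and F = "- inverse (w_unit E) - fps_const c * fps_X ^ 2" and G = 1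
          and K = "omega_inv E" and Z = "- xc_series E c"])
        fix X3 P3 P3' assume X3: "approx L (M - 12) X3 (- xc_series E c)"
        let ?l3 = "l(99 := P1, 20 := X1, 98 := P1', 21 := X2, 99 := P3, 20 := X3, 98 := P3')"
        show "run (integrate_com 22 20 8 12 ;;
          Put 22 13 8 ;; Put 22 17 24 ;; muldiv_com 13 22 1 11 ;; Put 13 13 9) (s2, ?l3)
          (U + (U2 + (U2 + (U + U2)))) ?R"
        proof (rule run_Seq, rule run_integrate_approx[where m = "M - 12" and F = "zeta_series E c"
            and c = L and o' = 1])
          fix s4 X4 assume s4: "\<forall>z<40. s4 z = s2 z" "env s4" and gX4: "good X4"
            and X4: "\<forall>k<L. 1 < k \<and> k < L \<longrightarrow>
              rat_cong p (M - 12 - L) (of_int (X4 ! (L - 1 - k))) (zeta_series E c $ k)"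
          define X5 where "X5 = X4[L - 1 := 1, L - 2 := s 24]"
          have lX4: "length X4 = L" using gX4 by (simp add: good_def)
          have gX5: "good X5"
          proof (rule goodI)
            show "length X5 = L" using lX4 by (simp add: X5_def)
            have "1 < Q" using p LM(2) by (auto simp: Q_def intro!: one_less_power)
            thus "0 \<le> X5 ! i \<and> X5 ! i < Q" if "i < L" for i
              using good_nth[OF gX4 that] h lX4 that by (auto simp: X5_def nth_list_update)
          qed
          have X5: "approx L (M - 12 - L) X5 (zeta_series E c)"
          proof (rule approxI[OF gX5])
            fix k assume k: "k < L"
            consider "k = 0" | "k = 1" | "1 < k" by linarith
            thus "rat_cong p (M - 12 - L) (of_int (X5 ! (L - 1 - k))) (zeta_series E c $ k)"
            proof cases
              case 1
              thus ?thesis using lX4 L p by (simp add: X5_def zeta_series_def rat_cong_def nth_list_update)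
            next
              case 2
              have "X5 ! (L - 1 - k) = s 24" using lX4 L 2
                by (simp add: X5_def numeral_2_eq_2)
              thus ?thesis using rat_cong_weaken[OF p(1) h(3) LM(6)] 2 by (simp add: zeta_series_def)
            next
              case 3
              have "X5 ! (L - 1 - k) = X4 ! (L - 1 - k)" using 3 k by (simp add: X5_def nth_list_update)
              thus ?thesis using X4 3 k by simp
            qed
          qed (use LM in auto)
          let ?l4 = "l(99 := P1, 20 := X1, 98 := P1', 21 := X2, 99 := P3, 20 := X3, 98 := P3', 22 := X4)"
          let ?l5 = "l(99 := P1, 20 := X1, 98 := P1', 21 := X2, 99 := P3, 20 := X3, 98 := P3', 22 := X5)"
          have md: "run (muldiv_com 13 22 1 11 ;; Put 13 13 9) (s4, ?l5) (U + U2) ?R"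
          proof (rule run_Seq, rule run_muldiv_approx[where j = L and m = "M - 12 - L"
            and F = "zeta_series E c" and G = 1 and K = "omega_inv E"
            and Z = "zeta_series E c * inverse (omega_inv E)"])
            fix X6 P6 P6' assume X6: "approx L (M - 12 - L) X6 (zeta_series E c * inverse (omega_inv E))"
            let ?X = "X6[L - 1 := 0]"
            have lX6: "length X6 = L" using X6 by (simp add: approx_def good_def)
            have "good ?X"
              using good_nth[OF approx_good[OF X6]] lX6 Q_pos
              by (intro goodI) (auto simp: nth_list_update)
            moreover have "rat_cong p (M - 12 - L) (of_int (?X ! (L - 1 - k))) (dlog_series E c $ k)"
              if k: "k < L" for k
            proof (cases "k = 0")
              case True
              thus ?thesis using lX6 L p by (simp add: rat_cong_def)
            next
              case False
              hence "L - 1 - k \<noteq> L - 1" using k by auto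
              thus ?thesis using approx_nth[OF X6 k] False by (simp add: dlog_series_def)
            qed
            ultimately have "approx L (M - 12 - L) ?X (dlog_series E c)" using LM by (intro approxI) auto
            thus "run (Put 13 13 9) (s4, ?l5(99 := P6, 13 := X6, 98 := P6')) U2 ?R"
              using s4 es[OF s4(2)] B lX6 L l
              by (intro run_Put big) (auto simp: nat_diff_distrib tables_def)
          next
            show "zeta_series E c * inverse (omega_inv E) * omega_inv E = zeta_series E c * 1"
              by (simp add: mult.assoc ih)
          qed (use s4 X5 l LM approx_weaken[of L M] in \<open>auto simp: tables_def\<close>)
          have n: "nat (int L - 1) = L - 1" "nat (int L - 2) = L - 2" by auto
          show "run (Put 22 13 8 ;; Put 22 17 24 ;; muldiv_com 13 22 1 11 ;; Put 13 13 9) (s4, ?l4)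
            (U2 + (U2 + (U + U2))) ?R"
            by (intro run_Seq[where a = U2] run_Put big)
               (use s4 s2 es[OF s4(2)] B lX4 L md in \<open>auto simp: n X5_def\<close>)
        next
          fix k assume k: "k < L" "1 < k" "k < L"
          have "p_integral p (zeta_series E c $ k)" using fps_smallD[OF zeta k(1)] by simp
          moreover have "of_nat (k - 1) * zeta_series E c $ k = (- xc_series E c) $ k"
            using k by (simp add: zeta_series_def of_nat_diff field_simps)
          ultimately show "p_integral p (zeta_series E c $ k) \<and> rat_cong p (M - 12)
              (of_int (?l3 20 ! (L - 1 - k))) (of_nat (k - 1) * zeta_series E c $ k)"
            using approx_nth[OF X3 k(1)] by simp
        qed (use s2 es[OF s2(2)] X3 LM in \<open>auto simp: approx_good\<close>)
      next
        show "- xc_series E c * omega_inv E = (- inverse (w_unit E) - fps_const c * fps_X\<^sup>2) * 1"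
          using ih(2) unfolding xc_series_def by algebra
      qed (use s2 X2 l LM approx_weaken[of L M] in \<open>auto simp: tables_def\<close>)
    qed (use s X1 l B q W_ge es[OF s] in \<open>auto simp: tables_def\<close>)
  qed (use s l LM ih in \<open>auto simp: tables_def\<close>)
  thus ?thesis by (rule run_mono) (use U_ge_U2 in simp)
qed

text \<open>The stored constant coefficient has to be equal to 1, not merely congruent to it,
  because the analysis inverts the stored series itself over the rationals.\<close>

lemma run_sigma_step:
  assumes s: "env s" "s 21 = int j" and l: "tables l" "approx L (M - 12 - L) (l 13) (dlog_series E c)"
    and g: "approx j (M - 12 - L - 2 * j) (l 14) (sigma_unit E c)" "l 14 ! (L - 1) = 1"
    and j: "1 \<le> j" "j < L" and su: "fps_small p L 0 (sigma_unit E c)"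
  shows "run sigma_step_com (s, l) (6 * U) (\<lambda>(s', l'). env s' \<and> s' 21 = int (2 * j) \<and>
    s' 22 = int L - int (2 * j) \<and> tables l' \<and> approx L (M - 12 - L) (l' 13) (dlog_series E c) \<and>
    approx (min (2 * j) L) (M - 12 - L - 2 * (2 * j)) (l' 14) (sigma_unit E c) \<and> l' 14 ! (L - 1) = 1)"
    (is "run _ _ _ ?R")
proof -
  define m0 m where "m0 = M - 12 - L" and "m = M - 12 - L - 2 * j"
  have mm: "1 \<le> m0" "m \<le> m0" "m0 \<le> M" "2 * j \<le> m" "m \<le> M" "m - 2 * j = M - 12 - L - 2 * (2 * j)"
    "1 \<le> m - 2 * j"
    using N j by (auto simp: L_def M_def m0_def m_def)
  have es: "s 8 = 1" "s 9 = 0" "s 12 = int L" "s 13 = int L - 1" "s 14 = -1"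
    if "env s" for s using that by (auto simp: env_def)
  have B: "int L \<le> H" "2 * int j \<le> H" "1 \<le> H" "\<bar>int L - 1\<bar> \<le> H"
    using S_ge S_le_H j L by linarith+
  define g C G where "g = sigma_unit E c" and "C = dlog_series E c" and "G = list_series (l 14)"
  have good: "good (l 14)" using assms approx_good by blast
  have G: "approx L M (l 14) G" unfolding G_def by (rule approx_self[OF good])
  have G0: "G $ 0 = 1" using list_series_good[OF good, of 0] assms(6) L by (simp add: G_def)
  have Gint: "fps_small p L 0 G" unfolding G_def by (rule fps_small_list_series[OF p(1)])
  have C: "approx L m0 (l 13) C" using l by (simp add: C_def m0_def)
  have GmG: "fps_small p j m (G - g)" using assms(5) by (simp add: approx_def G_def g_def m_def)
  define d where "d = C - fps_X * fps_deriv G * inverse G"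
  define \<eta> where "\<eta> = g * inverse G - 1"
  have jL: "j \<le> L" using j by simp
  have ode: "fps_X * fps_deriv g = C * g" unfolding g_def C_def by (rule sigma_unit_deriv)
  note newton = dlog_newton[OF p(1) Gint G0 su[folded g_def] _ GmG jL ode d_def, folded \<eta>_def]
  have g0: "g $ 0 = 1" by (simp add: g_def)
  note \<eta> = newton[OF g0]
  have GG: "G * inverse G = 1" using G0 by (simp add: inverse_mult_eq_1')
  have T: "approx L m0 (l 1) 1" "approx L M (l 1) 1" using l(1) approx_weaken[of L M] mm by (auto simp: tables_def)
  define j' where "j' = min (2 * j) L"
  have j': "j' \<le> L" "1 \<le> j'" using j by (auto simp: j'_def)
  have "run sigma_step_com (s, l) (U2 + (U + (U + (U + (U + (U2 + (U + U2))))))) ?R"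
    unfolding sigma_step_com_def
  proof (rule run_Seq, rule run_Plus)
    show "affordable U2 (s 21) (s 21)" using s B by (intro big) auto
    let ?s = "s(21 := s 21 + s 21)"
    have s0: "env ?s" by (rule env_upd[OF s(1)]) simp
    show "run (deriv_com 20 14 ;; muldiv_com 23 20 1 14 ;; lin_com 20 8 13 14 23 ;;
        integrate_com 23 20 9 21 ;; Put 23 13 8 ;; muldiv_com 14 14 23 1 ;; Minus 22 12 21)
        (?s, l) (U + (U + (U + (U + (U2 + (U + U2)))))) ?R"
    proof (rule run_Seq, rule run_deriv_approx[where j = L and m = M and F = G])
      fix s1 X1 assume s1: "\<forall>z<40. s1 z = ?s z" "env s1" and X1: "approx L M X1 (fps_X * fps_deriv G)"
      have s1j: "s1 21 = int (2 * j)" using s1(1) s by simp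
      show "run (muldiv_com 23 20 1 14 ;; lin_com 20 8 13 14 23 ;;
        integrate_com 23 20 9 21 ;; Put 23 13 8 ;; muldiv_com 14 14 23 1 ;; Minus 22 12 21)
        (s1, l(20 := X1)) (U + (U + (U + (U2 + (U + U2))))) ?R"
      proof (rule run_Seq, rule run_muldiv_approx[where j = L and m = M and F = "fps_X * fps_deriv G" and G = 1
          and K = G and Z = "fps_X * fps_deriv G * inverse G"])
        fix X2 P2 P2' assume X2: "approx L M X2 (fps_X * fps_deriv G * inverse G)"
        let ?l2 = "l(20 := X1, 99 := P2, 23 := X2, 98 := P2')"
        show "run (lin_com 20 8 13 14 23 ;;
          integrate_com 23 20 9 21 ;; Put 23 13 8 ;; muldiv_com 14 14 23 1 ;; Minus 22 12 21)
          (s1, ?l2) (U + (U + (U2 + (U + U2)))) ?R"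
        proof (rule run_Seq, rule run_lin_approx[where j = L and m = m0 and F = C
            and G = "fps_X * fps_deriv G * inverse G"])
          fix s3 X3 assume s3: "\<forall>z<40. s3 z = s1 z" "env s3"
            and "approx L m0 X3 (of_int (s1 8) * C + of_int (s1 14) * (fps_X * fps_deriv G * inverse G))"
          hence X3: "approx L m0 X3 d" by (simp add: es[OF s1(2)] d_def)
          have s3j: "s3 21 = int (2 * j)" using s3 s1j by simp
          let ?l3 = "l(20 := X1, 99 := P2, 23 := X2, 98 := P2', 20 := X3)"
          show "run (integrate_com 23 20 9 21 ;; Put 23 13 8 ;; muldiv_com 14 14 23 1 ;; Minus 22 12 21)
            (s3, ?l3) (U + (U2 + (U + U2))) ?R"
          proof (rule run_Seq, rule run_integrate_approx[where m = m and F = \<eta> and c = "2 * j" and o' = 0])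
            fix s4 X4 assume s4: "\<forall>z<40. s4 z = s3 z" "env s4" and gX4: "good X4"
              and X4: "\<forall>k<L. 0 < k \<and> k < 2 * j \<longrightarrow>
                rat_cong p (m - 2 * j) (of_int (X4 ! (L - 1 - k))) (\<eta> $ k)"
            have s4j: "s4 21 = int (2 * j)" using s4 s3j by simp
            define X5 where "X5 = X4[L - 1 := 1]"
            have lX4: "length X4 = L" using gX4 by (simp add: good_def)
            have Q1: "1 < Q" using p mm by (auto simp: Q_def intro!: one_less_power)
            have gX5: "good X5"
              using good_nth[OF gX4] lX4 Q1 by (intro goodI) (auto simp: X5_def nth_list_update)
            have X50: "X5 ! (L - 1) = 1" using lX4 L by (simp add: X5_def)
            have X5: "approx j' (m - 2 * j) X5 (1 + \<eta>)"
            proof (rule approxI[OF gX5 j'(1)])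
              fix k assume k: "k < j'"
              show "rat_cong p (m - 2 * j) (of_int (X5 ! (L - 1 - k))) ((1 + \<eta>) $ k)"
              proof (cases "k = 0")
                case True
                thus ?thesis using X50 \<eta>(2) p by (simp add: rat_cong_def)
              next
                case False
                hence "X5 ! (L - 1 - k) = X4 ! (L - 1 - k)"
                  using k j' by (simp add: X5_def nth_list_update)
                thus ?thesis using X4 False k by (simp add: j'_def)
              qed
            qed (use mm in simp)
            let ?l4 = "l(20 := X1, 99 := P2, 23 := X2, 98 := P2', 20 := X3, 23 := X4)"
            let ?l5 = "l(20 := X1, 99 := P2, 23 := X2, 98 := P2', 20 := X3, 23 := X5)"
            have Gj': "approx j' (m - 2 * j) (l 14) G" using G by (rule approx_weaken) (use mm j' in auto)
            have md: "run (muldiv_com 14 14 23 1 ;; Minus 22 12 21) (s4, ?l5) (U + U2) ?R"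
            proof (rule run_Seq, rule run_muldiv_approx[where j = j' and m = "m - 2 * j"
                and F = G and G = "1 + \<eta>" and K = 1 and Z = g])
              fix X6 P6 P6' assume X6: "approx j' (m - 2 * j) X6 g"
                and ser: "fps_small p L M (list_series X6 * list_series (?l5 1) -
                  list_series (?l5 14) * list_series (?l5 23))"
              have g6: "good X6" using X6 by (rule approx_good)
              have "approx L M (l 1) 1" by (rule T)
              from approx_nth[OF this, of 0] have one: "[l 1 ! (L - 1) = 1] (mod int p ^ M)"
                using L rat_cong_of_int_iff[OF p(1), of M "l 1 ! (L - 1)" 1] by simp
              have gl1: "good (l 1)" using T approx_good by blast
              \<comment> \<open>The approximation of \<open>g\<close> determines the constant
                coefficient only modulo a smaller power of \<open>p\<close>. The full-precision
                congruence makes it a residue congruent to 1 modulo \<open>Q\<close>, hence equal to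
                1.\<close>
              have "p_integral p (of_int (X6 ! (L - 1) * l 1 ! (L - 1) - 1) / of_nat p ^ M)"
                using fps_smallD[OF ser, of 0] L X50 assms(6)
                by (simp add: list_series_good[OF g6] list_series_good[OF gl1[unfolded One_nat_def]] list_series_good[OF good]
                   list_series_good[OF gX5])
              hence "[X6 ! (L - 1) * l 1 ! (L - 1) = 1] (mod int p ^ M)"
                by (simp only: p_integral_of_int_div_iff[OF p(1)] cong_iff_dvd_diff)
              moreover have "[X6 ! (L - 1) * l 1 ! (L - 1) = X6 ! (L - 1) * 1] (mod int p ^ M)"
                by (intro cong_mult one cong_refl)
              ultimately have "[X6 ! (L - 1) = 1] (mod Q)"
                unfolding Q_def by (metis cong_sym cong_trans mult.right_neutral)
              hence X60: "X6 ! (L - 1) = 1"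
                using good_nth[OF g6, of "L - 1"] Q1 L by (simp add: cong_def)
              show "run (Minus 22 12 21) (s4, ?l5(99 := P6, 14 := X6, 98 := P6')) U2 ?R"
                using X6 X60 s4 s4j es[OF s4(2)] B l C
                by (intro run_Minus big)
                   (auto simp: tables_def env_upd C_def m0_def g_def j'_def mm(6))
            next
              show "g * 1 = G * (1 + \<eta>)" using \<eta>(4) by simp
            qed (use s4 Gj' X5 T approx_weaken[OF T(2) j'(1)] mm j' in auto)
            have n: "nat (int L - 1) = L - 1" by auto
            show "run (Put 23 13 8 ;; muldiv_com 14 14 23 1 ;; Minus 22 12 21) (s4, ?l4) (U2 + (U + U2)) ?R"
              by (intro run_Seq[where a = U2] run_Put big)
                 (use s4 es[OF s4(2)] B lX4 L md in \<open>auto simp: n X5_def\<close>)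
          next
            fix k assume k: "k < L" "0 < k" "k < 2 * j"
            have "p_integral p (\<eta> $ k)" using fps_smallD[OF \<eta>(1) k(1)] by simp
            moreover have "rat_cong p m (of_int (X3 ! (L - 1 - k))) (d $ k)"
              using approx_nth[OF approx_weaken[OF X3 order_refl mm(2)] k(1)] .
            moreover have "rat_cong p m (d $ k) (of_nat k * \<eta> $ k)"
              using fps_smallD[OF \<eta>(3), of k] k by (cases k) (auto simp: rat_cong_def)
            ultimately show "p_integral p (\<eta> $ k) \<and> rat_cong p m (of_int (?l3 20 ! (L - 1 - k)))
                (of_nat (k - 0) * \<eta> $ k)"
              using rat_cong_trans[OF p(1)] by auto
          qed (use s3 s3j es[OF s3(2)] X3 mm in \<open>auto simp: approx_good\<close>)
        qed (use s1 es[OF s1(2)] W_ge C approx_weaken[OF X2 order_refl mm(3)] in auto)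
      next
        show "fps_X * fps_deriv G * inverse G * G = fps_X * fps_deriv G * 1"
          using GG by (simp add: mult.assoc mult.commute[of _ G])
      qed (use s1 X1 T G G0 L mm in auto)
    qed (use s0 G in auto)
  qed
  thus ?thesis by (rule run_mono) (use U_ge_U2 in simp)
qed


lemma run_output:
  assumes s: "env s" and l: "good (l 14)"
  shows "run output_com (s, l) (2 * U) (\<lambda>(s', l'). length (l' 0) = L \<and>
    (\<forall>i<L. l' 0 ! i = l 14 ! (L - 1 - i) mod int p ^ (L - i)))" (is "run _ _ _ ?R")
proof -
  have es: "s 0 = int p" "s 8 = 1" "s 9 = 0" "s 12 = int L" "s 13 = int L - 1" using s by (auto simp: env_def)
  have B: "int L \<le> H" "0 \<le> H" "\<bar>int L - 1\<bar> \<le> H" using S_ge S_le_H L by linarith+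
  have QH: "Q \<le> H" using W_ge W_le_H by linarith
  have pH: "int p ^ i \<le> H" if "i \<le> L" for i
  proof -
    have "int p ^ i \<le> Q" unfolding Q_def using p that L by (intro power_increasing) auto
    thus ?thesis using QH by simp
  qed
  have build: "run (build_com 0 12 (Minus 43 13 40 ;; Get 43 14 43 ;; Rem 42 43 60 ;; Quot 60 60 0))
      st ((L + 1) * ((U2 + (U2 + (U2 + U2))) + 6 * U2)) ?R"
    if st: "case st of (s', l') \<Rightarrow> l' = l \<and> (\<forall>y. y \<notin> {60, 40} \<longrightarrow> s' y = s y) \<and> s' 60 = int p ^ L" for st
  proof -
    obtain s' where s': "st = (s', l)" "\<forall>y. y \<notin> {60, 40} \<longrightarrow> s' y = s y" "s' 60 = int p ^ L"
      using st by (cases st) auto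
    show ?thesis unfolding s'(1)
    proof (rule run_weaken[OF run_build[where m = L and Inv = "\<lambda>i v. v = int p ^ (L - i)"
          and P = "\<lambda>i r. r = l 14 ! (L - 1 - i) mod int p ^ (L - i)"]])
      fix i s1 X assume i: "i < L" and s1: "\<forall>y<40. s1 y = s' y" "s1 40 = int i" "s1 60 = int p ^ (L - i)"
      have e1: "s1 0 = int p" "s1 13 = int L - 1" using s1 s' es by auto
      have x: "0 \<le> l 14 ! (L - 1 - i)" "l 14 ! (L - 1 - i) < Q" using good_nth[OF l] i by auto
      hence xH: "\<bar>l 14 ! (L - 1 - i)\<bar> \<le> H" using QH by simp
      define r where "r = l 14 ! (L - 1 - i) mod int p ^ (L - i)"
      have "0 \<le> r" "r < int p ^ (L - i)" using p by (auto simp: r_def)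
      hence rH: "\<bar>r\<bar> \<le> H" using pH[of "L - i"] by simp
      have ix: "nat (int L - 1 - int i) = L - 1 - i" using i by auto
      have pw: "int p ^ (L - i) div int p = int p ^ (L - Suc i)"
      proof -
        have "L - i = Suc (L - Suc i)" using i by simp
        thus ?thesis using p by simp
      qed
      have B': "\<bar>int i\<bar> \<le> H" "\<bar>int L - 1 - int i\<bar> \<le> H" "\<bar>int p ^ (L - i)\<bar> \<le> H" "\<bar>int p\<bar> \<le> H"
        using B i pH[of "L - i"] pH[of 1] L by auto
      have len: "length (l 14) = L" using l by (simp add: good_def)
      show "run (Minus 43 13 40 ;; Get 43 14 43 ;; Rem 42 43 60 ;; Quot 60 60 0) (s1, l(0 := X))
        (U2 + (U2 + (U2 + U2)))
        (\<lambda>(s'', l''). (\<forall>y<42. s'' y = s1 y) \<and> s'' 60 = int p ^ (L - Suc i) \<and> \<bar>s'' 42\<bar> \<le> H \<and>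
          s'' 42 = l 14 ! (L - 1 - i) mod int p ^ (L - i) \<and> l'' = l(0 := X))"
        by (intro run_intros big)
           (use e1 s1 B B' xH rH[unfolded r_def] ix pw i len in auto)
    next
      fix st assume "case st of (s'', l') \<Rightarrow> (\<forall>y<40. s'' y = s' y) \<and>
        (\<exists>X. length X = L \<and> (\<forall>i<L. X ! i = l 14 ! (L - 1 - i) mod int p ^ (L - i)) \<and> l' = l(0 := X))"
      thus "?R st" by (cases st) auto
    qed (use s' es B in auto)
  qed
  have "run output_com (s, l) ((L + 1) * (5 * U2) + (L + 1) * ((U2 + (U2 + (U2 + U2))) + 6 * U2)) ?R"
    unfolding output_com_def
    by (rule run_Seq2[OF run_pow build]) (use es L in auto)
  thus ?thesis
  proof (rule run_mono)
    have "(L + 1) * (5 * U2) \<le> (L + 1) * (0 + 6 * U2)" by (intro mult_le_mono2) simp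
    also have "\<dots> \<le> U" by (rule U_ge_build) simp
    finally have "(L + 1) * (5 * U2) \<le> U" .
    moreover have "(L + 1) * ((U2 + (U2 + (U2 + U2))) + 6 * U2) \<le> U" by (rule U_ge_build) simp
    ultimately show "(L + 1) * (5 * U2) + (L + 1) * ((U2 + (U2 + (U2 + U2))) + 6 * U2) \<le> 2 * U" by linarith
  qed
qed

theorem run_sigma:
  assumes su: "fps_small p L 0 (sigma_unit E c)" and K: "L \<le> 2 ^ K"
  shows "run sigma_com (input_state p N E e) ((K + 1) * (80 * U))
    (\<lambda>(s', l'). length (l' 0) = L \<and> (\<forall>i<L. \<exists>z. l' 0 ! i = z mod int p ^ (L - i) \<and>
       rat_cong p L (of_int z) (sigma_unit E c $ i)))" (is "run _ _ _ ?R")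
proof -
  define m0 where "m0 = M - 12 - L"
  have LH: "\<bar>1\<bar> \<le> H" "\<bar>int L\<bar> \<le> H" "\<bar>0\<bar> \<le> H" using S_ge S_le_H by auto
  have es: "s 8 = 1" "s 9 = 0" "s 12 = int L" if "env s" for s using that by (auto simp: env_def)
  \<comment> \<open>A round starts only while \<open>2 ^ i < L\<close>, whence
    \<open>2 ^ i < 2 * L\<close> throughout; this keeps the accumulated loss
    \<open>2 * 2 ^ i\<close> below \<open>4 * L\<close>.\<close>
  define I where "I = (\<lambda>i (s', l'). env s' \<and> s' 21 = int (2 ^ i) \<and> s' 22 = int L - int (2 ^ i) \<and> tables l' \<and>
    approx L m0 (l' 13) (dlog_series E c) \<and>
    approx (min (2 ^ i) L) (m0 - 2 * 2 ^ i) (l' 14) (sigma_unit E c) \<and> l' 14 ! (L - 1) = 1 \<and> 2 ^ i < 2 * L)"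
  define J where "J = (\<lambda>(s', l' :: nat \<Rightarrow> int list). env s' \<and> approx L L (l' 14) (sigma_unit E c))"
  have loop: "run (WhilePos 22 sigma_step_com) st ((K - 0) * (6 * U + 1) + 1) J" if "I 0 st" for st
  proof (rule run_WhilePos[where I = I])
    fix i st assume I: "I i st" and i: "i \<le> K" and pos: "0 < fst st 22"
    obtain s' l' where st: "st = (s', l')" by (cases st)
    have *: "env s'" "s' 21 = int (2 ^ i)" "s' 22 = int L - int (2 ^ i)" "tables l'"
      "approx L m0 (l' 13) (dlog_series E c)"
      "approx (min (2 ^ i) L) (m0 - 2 * 2 ^ i) (l' 14) (sigma_unit E c)" "l' 14 ! (L - 1) = 1"
      using I by (auto simp: I_def st)
    have "int (2 ^ i) < int L" using pos * by (simp add: st)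
    hence iL: "2 ^ i < L" by (simp only: of_nat_less_iff)
    hence "(2::nat) ^ i < 2 ^ K" using K by (rule less_le_trans)
    hence "i < K" by (rule power_less_imp_less_exp[rotated]) simp
    have g: "approx (2 ^ i) (M - 12 - L - 2 * 2 ^ i) (l' 14) (sigma_unit E c)"
      using *(6) iL by (simp add: m0_def min_def)
    have "run sigma_step_com (s', l') (6 * U) (I (Suc i))"
      by (rule run_weaken[OF run_sigma_step[OF *(1,2,4) *(5)[unfolded m0_def] g *(7) _ iL su]])
         (use iL in \<open>auto simp: I_def m0_def\<close>)
    thus "i < K \<and> run sigma_step_com st (6 * U) (I (Suc i))" using \<open>i < K\<close> by (simp add: st)
  next
    fix i st assume I: "I i st" and le: "fst st 22 \<le> 0"
    obtain s' l' where st: "st = (s', l')" by (cases st)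
    have *: "env s'" "s' 22 = int L - int (2 ^ i)" "2 ^ i < 2 * L"
      "approx (min (2 ^ i) L) (m0 - 2 * 2 ^ i) (l' 14) (sigma_unit E c)"
      using I by (auto simp: I_def st)
    have "int L \<le> int (2 ^ i)" using le * by (simp add: st)
    hence "L \<le> 2 ^ i" by (simp only: of_nat_le_iff)
    moreover have "L \<le> m0 - 2 * 2 ^ i" using *(3) N by (simp add: m0_def M_def L_def)
    ultimately have "approx L L (l' 14) (sigma_unit E c)"
      using approx_weaken[OF *(4)] by simp
    thus "J st" using * by (simp add: J_def st)
  qed (use that in auto)
  have out: "run output_com st (2 * U) ?R" if st: "J st" for st
  proof -
    obtain s' l' where st: "st = (s', l')" "env s'" "approx L L (l' 14) (sigma_unit E c)"
      using st by (cases st) (auto simp: J_def)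
    show ?thesis unfolding st(1)
    proof (rule run_weaken[OF run_output[where l = l', OF st(2) approx_good[OF st(3)]]])
      fix st1 :: state assume "case st1 of (s1, l1) \<Rightarrow> length (l1 0) = L \<and>
        (\<forall>i<L. l1 0 ! i = l' 14 ! (L - 1 - i) mod int p ^ (L - i))"
      thus "?R st1" using approx_nth[OF st(3)] by (cases st1) blast
    qed
  qed
  have start: "run (lin_com 14 8 1 9 1 ;; Load 21 1 ;; Minus 22 12 21 ;; WhilePos 22 sigma_step_com ;; output_com)
      (s, l) (U + (U2 + (U2 + (((K - 0) * (6 * U + 1) + 1) + 2 * U)))) ?R"
    if s: "env s" and l: "tables l" "approx L m0 (l 13) (dlog_series E c)" for s l
  proof (rule run_Seq, rule run_lin_approx[where j = L and m = M and F = 1 and G = 1])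
    fix s1 X assume s1: "env s1" and "approx L M X (of_int (s 8) * 1 + of_int (s 9) * 1)"
    hence X: "approx L M X 1" using es[OF s] by simp
    have gX: "good X" using X by (rule approx_good)
    have "rat_cong p M (of_int (X ! (L - 1))) (of_int 1)" using approx_nth[OF X, of 0] L by simp
    hence "[X ! (L - 1) = 1] (mod Q)" unfolding Q_def by (simp only: rat_cong_of_int_iff[OF p(1)])
    moreover have "1 < Q" using p L by (auto simp: Q_def intro!: one_less_power)
    ultimately have X1: "X ! (L - 1) = 1" using good_nth[OF gX, of "L - 1"] L by (simp add: cong_def)
    have "approx 1 M X (sigma_unit E c)"
      by (rule approx_cong[OF approx_weaken[OF X]]) (use L p in \<open>auto intro: fps_small_0I\<close>)
    hence "approx 1 (m0 - 2) X (sigma_unit E c)" by (rule approx_weaken) (auto simp: m0_def)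
    hence "I 0 (s1(21 := 1, 22 := int L - 1), l(14 := X))"
      using s1 l X1 L by (auto simp: I_def env_upd tables_def min_def)
    note lp = run_Seq2[OF loop[OF this] out]
    show "run (Load 21 1 ;; Minus 22 12 21 ;; WhilePos 22 sigma_step_com ;; output_com) (s1, l(14 := X))
      (U2 + (U2 + (((K - 0) * (6 * U + 1) + 1) + 2 * U))) ?R"
      by (rule run_Seq, rule run_Load, rule big, rule LH, rule LH,
          rule run_Seq, rule run_Minus, rule big) (use lp es[OF s1] LH in auto)
  qed (use s l es[OF s] W_ge in \<open>auto simp: tables_def\<close>)
  let ?rest = "U + (U2 + (U2 + (((K - 0) * (6 * U + 1) + 1) + 2 * U)))"
  have zeta: "run (zeta_com ;; lin_com 14 8 1 9 1 ;; Load 21 1 ;; Minus 22 12 21 ;; WhilePos 22 sigma_step_com ;; output_com)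
      (s, l) (6 * U + ?rest) ?R"
    if "env s" "tables l" "approx L M (l 10) (w_unit E)" "approx L M (l 11) (omega_inv E)"
      "s 23 = - q" "0 \<le> q" "q < Q" "rat_cong p (M - 12) (of_int q) c"
      "0 \<le> s 24" "s 24 < Q" "rat_cong p (M - 2) (of_int (s 24)) (- of_int (a1 E) / 2)" for s l q
    by (rule run_Seq2[OF run_zeta[OF that su]]) (use start in \<open>auto simp: m0_def\<close>)
  have inp: "input_state p N E e = (fst (input_state p N E e), \<lambda>_. [])" by (simp add: input_state_def)
  have "run sigma_com (fst (input_state p N E e), \<lambda>_. [])
      (6 * U + (12 * U + ((K + 1) * (12 * U) + (9 * U + (9 * U + (6 * U + ?rest)))))) ?R"
    unfolding sigma_com_def
  proof (rule run_Seq2[OF run_setup], goal_cases)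
    case (10 st)
    then obtain s1 l1 where 1: "st = (s1, l1)" "env s1" by (cases st) auto
    show ?case unfolding 1(1)
    proof (rule run_Seq2[OF run_tables[OF 1(2)]], goal_cases)
      case (1 st)
      then obtain s2 l2 where 2: "st = (s2, l2)" "env s2" "tables l2" by (cases st) auto
      show ?case unfolding 2(1)
      proof (rule run_Seq2[OF run_w[OF 2(2,3) K]], goal_cases)
        case (1 st)
        then obtain s3 l3 where 3: "st = (s3, l3)" "env s3" "tables l3"
          "approx L M (l3 10) (w_unit E)" "approx L M (l3 11) (omega_inv E)" by (cases st) auto
        show ?case unfolding 3(1)
        proof (rule run_Seq2[OF run_c[OF 3(2)]], goal_cases)
          case (1 st)
          then obtain s4 q where 4: "st = (s4, l3)" "env s4"
            "s4 23 = - q" "0 \<le> q" "q < Q" "rat_cong p (M - 12) (of_int q) c" by (cases st) auto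
          show ?case unfolding 4(1)
          proof (rule run_Seq2[OF run_half[OF 4(2)]], goal_cases)
            case (1 st)
            then obtain s5 where 5: "st = (s5, l3)" "env s5" "s5 23 = s4 23" "0 \<le> s5 24" "s5 24 < Q"
              "rat_cong p (M - 2) (of_int (s5 24)) (- of_int (a1 E) / 2)" by (cases st) auto
            show ?case unfolding 5(1)
              by (rule zeta[OF 5(2) 3(3-5) _ 4(4-6) 5(4-6)]) (simp add: 5 4)
          qed
        qed
      qed
    qed
  qed (auto simp: input_state_def)
  hence "run sigma_com (input_state p N E e)
      (6 * U + (12 * U + ((K + 1) * (12 * U) + (9 * U + (9 * U + (6 * U + ?rest)))))) ?R"
    using inp by simp
  thus ?thesis
  proof (rule run_mono)
    have "K * (6 * U + 1) \<le> K * (7 * U)" using U_ge_U2 by (intro mult_le_mono2) simp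
    moreover have "(K + 1) * (12 * U) = 12 * (K * U) + 12 * U" "(K + 1) * (80 * U) = 80 * (K * U) + 80 * U"
      "K * (7 * U) = 7 * (K * U)" by simp_all
    ultimately show "6 * U + (12 * U + ((K + 1) * (12 * U) + (9 * U + (9 * U + (6 * U + ?rest))))) \<le>
      (K + 1) * (80 * U)"
      unfolding minus_nat.diff_0 using U_ge_U2 by linarith
  qed
qed

end

text \<open>The output follows the rational solution to \<open>N - 1\<close> digits, but that
  solution agrees with sigma only to \<open>N - 1 - i\<close> digits at position \<open>i\<close>.
  This is the precision kept in the output, and reduced residues that are congruent are
  equal.\<close>

lemma mod_I_eqI:
  assumes p: "prime p" "5 \<le> p" and N: "4 \<le> N" and e: "e \<in> Zp p" and sg: "is_padic_sigma p E e \<sigma>"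
    and len: "length X = N - 1"
    and X: "\<forall>i<N - 1. \<exists>z. X ! i = z mod int p ^ (N - 1 - i) \<and>
       rat_cong p (N - 1) (of_int z) (sigma_unit E (of_int ((a1 E)^2 + 4 * a2 E - e (N - 3)) / 12) $ i)"
  shows "X = mod_I N \<sigma>"
proof (rule nth_equalityI)
  show "length X = length (mod_I N \<sigma>)" by (simp add: len mod_I_def)
  fix i assume "i < length X"
  hence i: "i < N - 1" by (simp add: len)
  let ?g = "sigma_unit E (of_int ((a1 E)^2 + 4 * a2 E - e (N - 3)) / 12) $ i"
  obtain z where z: "X ! i = z mod int p ^ (N - 1 - i)" "rat_cong p (N - 1) (of_int z) ?g"
    using X i by blast
  have "rat_cong p (N - 1 - i) (of_int z) ?g" by (rule rat_cong_weaken[OF p(1) z(2)]) simp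
  moreover have "rat_cong p (N - 1 - i) (of_int (\<sigma> (i + 1) (N - 1 - i))) ?g"
    by (rule sigma_unit_cong[OF p N e sg i refl])
  ultimately have "[z = \<sigma> (i + 1) (N - 1 - i)] (mod int p ^ (N - 1 - i))"
    using rat_cong_trans[OF p(1)] rat_cong_sym[OF p(1)] rat_cong_of_int_iff[OF p(1)] by metis
  moreover have "\<sigma> (i + 1) (N - 1 - i) \<in> {0..<int p ^ (N - 1 - i)}"
    using sg by (simp add: is_padic_sigma_def Zp_def)
  ultimately have "X ! i = \<sigma> (i + 1) (N - 1 - i)" by (simp add: z cong_def)
  thus "X ! i = mod_I N \<sigma> ! i" using i by (simp add: mod_I_def)
qed

text \<open>A congruence with an integer modulo \<open>p^0\<close> already says that the difference
  is integral; sigma thus transfers its integrality to the first \<open>N - 1\<close>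
  coefficients.\<close>

lemma fps_small_sigma_unit:
  assumes p: "prime p" "5 \<le> p" and N: "4 \<le> N" and e: "e \<in> Zp p" and sg: "is_padic_sigma p E e \<sigma>"
  shows "fps_small p (N - 1) 0 (sigma_unit E (of_int ((a1 E)^2 + 4 * a2 E - e (N - 3)) / 12))"
  unfolding fps_small_def
proof (intro allI impI)
  fix i assume i: "i < N - 1"
  let ?g = "sigma_unit E (of_int ((a1 E)^2 + 4 * a2 E - e (N - 3)) / 12) $ i"
  have "rat_cong p 0 (of_int (\<sigma> (i + 1) (N - 1 - i))) ?g"
    by (rule rat_cong_weaken[OF p(1) sigma_unit_cong[OF p N e sg i refl]]) simp
  from p_integral_diff[OF p(1) p_integral_of_int[OF p(1), of "\<sigma> (i + 1) (N - 1 - i)"] this[unfolded rat_cong_def power_0 div_by_1]]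
  have "p_integral p ?g" by (simp only: diff_diff_eq2 add_diff_cancel_left')
  thus "p_integral p (?g / of_nat p ^ 0)" by simp
qed

section \<open>Running time\<close>

abbreviation lg :: "nat \<Rightarrow> nat \<Rightarrow> real" where
  "lg p N \<equiv> ln (real N ^ 2 * ln (real p))"

text \<open>The weight \<open>h\<close> varies while the logarithm is always that of
  \<open>N^2 ln p\<close>; bounds of different weights can thus be multiplied. The constants are
  uniform in \<open>p\<close> and \<open>N\<close>, and may depend on the curve through
  \<open>f\<close>.\<close>

definition soft_bound :: "(nat \<Rightarrow> nat \<Rightarrow> real) \<Rightarrow> (nat \<Rightarrow> nat \<Rightarrow> real) \<Rightarrow> bool" where
  "soft_bound h f \<longleftrightarrow> (\<exists>C k. 0 \<le> C \<and> (\<forall>p N. prime p \<longrightarrow> 5 \<le> p \<longrightarrow> 4 \<le> N \<longrightarrow>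
     f p N \<le> C * h p N * lg p N ^ k))"

lemma ln_prime_ge: "5 \<le> p \<Longrightarrow> 1 \<le> ln (real p)"
  using exp_le by (subst ln_ge_iff) auto

text \<open>For \<open>p \<ge> 5\<close> and \<open>N \<ge> 4\<close> the logarithm in the bounds is
  at least 1, so raising its exponent only weakens a bound and additive constants can be
  absorbed.\<close>

lemma parameter_bounds:
  assumes "5 \<le> p" "4 \<le> N"
  shows "16 \<le> real N ^ 2 * ln (real p)" "1 \<le> lg p N"
    "real N * ln (real p) \<le> real N ^ 2 * ln (real p)" "real N \<le> real N ^ 2 * ln (real p)"
    "1 \<le> real N * ln (real p)" "ln (real N) \<le> lg p N"
proof -
  have l: "1 \<le> ln (real p)" by (rule ln_prime_ge[OF assms(1)])
  have n: "4 ^ 2 \<le> real N ^ 2" using assms by (intro power_mono) auto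
  have "4 ^ 2 * 1 \<le> real N ^ 2 * ln (real p)" using l n by (intro mult_mono) auto
  thus g: "16 \<le> real N ^ 2 * ln (real p)" by simp
  have "exp 1 \<le> real N ^ 2 * ln (real p)" using g exp_le by linarith
  thus "1 \<le> lg p N" using g by (subst ln_ge_iff) auto
  have "real N ^ 1 \<le> real N ^ 2" using assms by (intro power_increasing) auto
  hence NN: "real N \<le> real N ^ 2" by simp
  show "real N * ln (real p) \<le> real N ^ 2 * ln (real p)" using NN l by (intro mult_right_mono) auto
  have "real N ^ 2 * 1 \<le> real N ^ 2 * ln (real p)" using l by (intro mult_left_mono) auto
  thus *: "real N \<le> real N ^ 2 * ln (real p)" using NN by linarith
  have "1 * 1 \<le> real N * ln (real p)" using l assms by (intro mult_mono) auto
  thus "1 \<le> real N * ln (real p)" by simp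
  show "ln (real N) \<le> lg p N" using * assms by simp
qed

lemma soft_boundI:
  assumes "0 \<le> C" "\<And>p N. prime p \<Longrightarrow> 5 \<le> p \<Longrightarrow> 4 \<le> N \<Longrightarrow>
    f p N \<le> C * h p N * lg p N ^ k"
  shows "soft_bound h f"
  using assms unfolding soft_bound_def by blast

lemma soft_bound_mono:
  assumes "soft_bound h f" "\<And>p N. prime p \<Longrightarrow> 5 \<le> p \<Longrightarrow> 4 \<le> N \<Longrightarrow> g p N \<le> f p N"
  shows "soft_bound h g"
  using assms unfolding soft_bound_def by (meson order_trans)

lemma soft_bound_add:
  assumes f: "soft_bound h f" and g: "soft_bound h g" and h: "\<And>p N. 5 \<le> p \<Longrightarrow> 4 \<le> N \<Longrightarrow> 0 \<le> h p N"
  shows "soft_bound h (\<lambda>p N. f p N + g p N)"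
proof -
  obtain C k where f: "0 \<le> C" "\<And>p N. prime p \<Longrightarrow> 5 \<le> p \<Longrightarrow> 4 \<le> N \<Longrightarrow>
      f p N \<le> C * h p N * lg p N ^ k" using f unfolding soft_bound_def by blast
  obtain C' k' where g: "0 \<le> C'" "\<And>p N. prime p \<Longrightarrow> 5 \<le> p \<Longrightarrow> 4 \<le> N \<Longrightarrow>
      g p N \<le> C' * h p N * lg p N ^ k'" using g unfolding soft_bound_def by blast
  show ?thesis
  proof (rule soft_boundI[where C = "C + C'" and k = "k + k'"])
    fix p N :: nat assume pN: "prime p" "5 \<le> p" "4 \<le> N"
    have l: "1 \<le> lg p N" by (rule parameter_bounds[OF pN(2,3)])
    have "C * h p N * lg p N ^ k \<le> C * h p N * lg p N ^ (k + k')"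
      using l f(1) h[OF pN(2,3)] by (intro mult_left_mono power_increasing) auto
    moreover have "C' * h p N * lg p N ^ k' \<le> C' * h p N * lg p N ^ (k + k')"
      using l g(1) h[OF pN(2,3)] by (intro mult_left_mono power_increasing) auto
    ultimately show "f p N + g p N \<le> (C + C') * h p N * lg p N ^ (k + k')"
      using f(2)[OF pN] g(2)[OF pN] by (simp add: algebra_simps)
  qed (use f g in auto)
qed

lemma soft_bound_mult:
  assumes f: "soft_bound h f" and g: "soft_bound h' g"
    and nn: "\<And>p N. 5 \<le> p \<Longrightarrow> 4 \<le> N \<Longrightarrow> 0 \<le> f p N \<and> 0 \<le> g p N \<and> 0 \<le> h p N"
  shows "soft_bound (\<lambda>p N. h p N * h' p N) (\<lambda>p N. f p N * g p N)"
proof -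
  obtain C k where f: "0 \<le> C" "\<And>p N. prime p \<Longrightarrow> 5 \<le> p \<Longrightarrow> 4 \<le> N \<Longrightarrow>
      f p N \<le> C * h p N * lg p N ^ k" using f unfolding soft_bound_def by blast
  obtain C' k' where g: "0 \<le> C'" "\<And>p N. prime p \<Longrightarrow> 5 \<le> p \<Longrightarrow> 4 \<le> N \<Longrightarrow>
      g p N \<le> C' * h' p N * lg p N ^ k'" using g unfolding soft_bound_def by blast
  show ?thesis
  proof (rule soft_boundI[where C = "C * C'" and k = "k + k'"])
    fix p N :: nat assume pN: "prime p" "5 \<le> p" "4 \<le> N"
    have "1 \<le> lg p N" by (rule parameter_bounds[OF pN(2,3)])
    hence "f p N * g p N \<le> (C * h p N * lg p N ^ k) * (C' * h' p N * lg p N ^ k')"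
      using f(1) f(2)[OF pN] g(2)[OF pN] nn[OF pN(2,3)]
      by (intro mult_mono) auto
    thus "f p N * g p N \<le> C * C' * (h p N * h' p N) * lg p N ^ (k + k')"
      by (simp add: power_add mult_ac)
  qed (use f g in auto)
qed

lemma soft_bound_const: "0 \<le> C \<Longrightarrow> soft_bound (\<lambda>_ _. 1) (\<lambda>_ _. C)"
  by (rule soft_boundI[where C = C and k = 0]) auto

text \<open>The cost of an operation need not be monotone in the length of the operands.\<close>

definition cost_max :: "(nat \<Rightarrow> nat) \<Rightarrow> nat \<Rightarrow> nat" where
  "cost_max tI n = n + Max (insert 0 (tI ` {2..n}))"

lemma cost_max: "m \<le> n \<Longrightarrow> 2 \<le> m \<Longrightarrow> m \<le> cost_max tI n \<and> tI m \<le> cost_max tI n"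
  unfolding cost_max_def by (auto intro!: trans_le_add2 Max_ge)

lemma cost_max_bound:
  assumes "soft_O {2..} tI real"
  shows "\<exists>C k. 0 \<le> C \<and> (\<forall>n\<ge>2. real (cost_max tI n) \<le> C * real n * (1 + ln (real n)) ^ k)"
proof -
  obtain k where "(\<lambda>x. real (tI x)) \<in> O[principal {2..}](\<lambda>x. real x * ln (real x) ^ k)"
    using assms unfolding soft_O_def by blast
  then obtain C where C: "0 < C" "\<And>m. 2 \<le> m \<Longrightarrow> real (tI m) \<le> C * (real m * ln (real m) ^ k)"
    unfolding bigo_def by (auto simp: eventually_principal)
  have "real (cost_max tI n) \<le> (C + 1) * real n * (1 + ln (real n)) ^ k" if n: "2 \<le> n" for n
  proof -
    have l: "0 \<le> ln (real n)" using n by simp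
    have t: "real (tI m) \<le> C * real n * (1 + ln (real n)) ^ k" if m: "2 \<le> m" "m \<le> n" for m
    proof -
      have "real (tI m) \<le> C * (real m * ln (real m) ^ k)" by (rule C(2)[OF m(1)])
      also have "\<dots> \<le> C * (real n * (1 + ln (real n)) ^ k)"
        using m C(1) by (intro mult_left_mono mult_mono power_mono) (auto simp: add_increasing)
      finally show ?thesis by simp
    qed
    have "0 \<le> C * real n * (1 + ln (real n)) ^ k" using C l by simp
    hence "real x \<le> C * real n * (1 + ln (real n)) ^ k" if "x \<in> insert 0 (tI ` {2..n})" for x
      using that t by auto
    hence "real (Max (insert 0 (tI ` {2..n}))) \<le> C * real n * (1 + ln (real n)) ^ k"
      by (metis Max_in finite.insertI finite_atLeastAtMost finite_imageI insert_not_empty)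
    moreover have "real n * 1 \<le> real n * (1 + ln (real n)) ^ k"
      using l by (intro mult_left_mono one_le_power) auto
    ultimately show ?thesis by (simp add: cost_max_def algebra_simps)
  qed
  thus ?thesis using C(1) by (intro exI[of _ "C + 1"] exI[of _ k]) auto
qed

text \<open>Soft bounds compose: a length bounded by \<open>h\<close> times powers of the logarithm,
  with \<open>h\<close> at most \<open>N^2 ln p\<close>, has itself a logarithm of order
  \<open>lg p N\<close>.\<close>

lemma soft_bound_cost_max:
  assumes tI: "soft_O {2..} tI real" and F: "soft_bound h (\<lambda>p N. real (F p N))"
    and F2: "\<And>p N. 2 \<le> F p N"
    and h: "\<And>p N. 5 \<le> p \<Longrightarrow> 4 \<le> N \<Longrightarrow> 1 \<le> h p N \<and> h p N \<le> real N ^ 2 * ln (real p)"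
  shows "soft_bound h (\<lambda>p N. real (cost_max tI (F p N)))"
proof -
  obtain C k where C: "0 \<le> C" "\<And>n. 2 \<le> n \<Longrightarrow> real (cost_max tI n) \<le> C * real n * (1 + ln (real n)) ^ k"
    using cost_max_bound[OF tI] by blast
  obtain B0 j where B0: "0 \<le> B0" "\<And>p N. prime p \<Longrightarrow> 5 \<le> p \<Longrightarrow> 4 \<le> N \<Longrightarrow>
      real (F p N) \<le> B0 * h p N * lg p N ^ j" using F unfolding soft_bound_def by blast
  define B where "B = max B0 1"
  have B: "1 \<le> B" "B0 \<le> B" by (auto simp: B_def)
  define A where "A = 2 + ln B + real j"
  have lB: "0 \<le> ln B" using B by simp
  show ?thesis
  proof (rule soft_boundI[where C = "C * B * A ^ k" and k = "j + k"])
    fix p N :: nat assume pN: "prime p" "5 \<le> p" "4 \<le> N"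
    define l where "l = lg p N"
    have l: "1 \<le> l" unfolding l_def by (rule parameter_bounds[OF pN(2,3)])
    have hh: "1 \<le> h p N" "h p N \<le> real N ^ 2 * ln (real p)" using h[OF pN(2,3)] by auto
    have "B0 * h p N * l ^ j \<le> B * h p N * l ^ j"
      using B hh l by (intro mult_right_mono) auto
    hence Fb: "real (F p N) \<le> B * h p N * l ^ j" using B0(2)[OF pN] by (simp add: l_def)
    have F0: "2 \<le> real (F p N)" using F2[of p N] by linarith
    have "ln (real (F p N)) \<le> ln (B * h p N * l ^ j)"
      using Fb F0 by (subst ln_le_cancel_iff) auto
    also have "\<dots> = ln B + ln (h p N) + real j * ln l"
      using B hh l by (simp add: ln_mult ln_realpow)
    also have "\<dots> \<le> ln B * l + l + real j * l"
    proof (intro add_mono mult_left_mono)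
      show "ln B \<le> ln B * l" using l lB by (simp add: mult_le_cancel_left1)
      show "ln (h p N) \<le> l" unfolding l_def using hh by (subst ln_le_cancel_iff) auto
      show "ln l \<le> l" using l ln_le_minus_one[of l] by linarith
    qed auto
    finally have "1 + ln (real (F p N)) \<le> A * l" using l by (simp add: A_def algebra_simps)
    hence "(1 + ln (real (F p N))) ^ k \<le> (A * l) ^ k" using F0 by (intro power_mono) auto
    hence "C * real (F p N) * (1 + ln (real (F p N))) ^ k \<le> C * (B * h p N * l ^ j) * (A * l) ^ k"
      using C(1) Fb F0 hh l B by (intro mult_mono mult_left_mono) auto
    hence "real (cost_max tI (F p N)) \<le> C * (B * h p N * l ^ j) * (A * l) ^ k"
      using C(2)[OF F2] by (meson order_trans)
    thus "real (cost_max tI (F p N)) \<le> C * B * A ^ k * h p N * lg p N ^ (j + k)"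
      by (simp add: l_def power_add power_mult_distrib mult_ac)
  qed (use C B lB in \<open>auto simp: A_def\<close>)
qed

text \<open>With \<open>d \<le> 2 N\<close> and \<open>r = 16 N\<close> the size
  \<open>d r ln p\<close> is at most \<open>32 N^2 ln p\<close>; the factor 32 inside the logarithm
  is absorbed into the constant.\<close>

lemma soft_bound_poly_cost:
  assumes t: "soft_O {(d, p, r). 1 \<le> d \<and> prime p \<and> 5 \<le> p \<and> 1 \<le> r}
           (\<lambda>(d, p, r). t d p r) (\<lambda>(d, p, r). real d * real r * ln (real p))"
    and d: "\<And>N. 4 \<le> N \<Longrightarrow> 1 \<le> d N \<and> d N \<le> 2 * N"
  shows "soft_bound (\<lambda>p N. real N ^ 2 * ln (real p)) (\<lambda>p N. real (t (d N) p (16 * N)))"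
proof -
  obtain k where "(\<lambda>x. real (case x of (d, p, r) \<Rightarrow> t d p r)) \<in>
      O[principal {(d, p, r). 1 \<le> d \<and> prime p \<and> 5 \<le> p \<and> 1 \<le> r}](\<lambda>x. (case x of (d, p, r) \<Rightarrow> real d * real r * ln (real p)) *
        ln (case x of (d, p, r) \<Rightarrow> real d * real r * ln (real p)) ^ k)"
    using t unfolding soft_O_def by blast
  then obtain C where C: "0 < C" "\<And>d p r. 1 \<le> d \<Longrightarrow> prime p \<Longrightarrow> 5 \<le> p \<Longrightarrow> 1 \<le> r \<Longrightarrow>
      real (t d p r) \<le> C * \<bar>real d * real r * ln (real p) * ln (real d * real r * ln (real p)) ^ k\<bar>"
    unfolding bigo_def by (auto simp: eventually_principal)
  show ?thesis
  proof (rule soft_boundI[where C = "C * 32 * (ln 32 + 1) ^ k" and k = k])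
    fix p N :: nat assume pN: "prime p" "5 \<le> p" "4 \<le> N"
    define g l v where "g = real N ^ 2 * ln (real p)" and "l = lg p N"
      and "v = real (d N) * real (16 * N) * ln (real p)"
    have g: "16 \<le> g" "1 \<le> l" "l = ln g"
      using parameter_bounds[OF pN(2,3)] by (auto simp: g_def l_def)
    have lp: "1 \<le> ln (real p)" by (rule ln_prime_ge[OF pN(2)])
    have dN: "1 \<le> real (d N)" "real (d N) \<le> 2 * real N" using d[OF pN(3)] by (auto simp flip: of_nat_mult)
    have "1 * 1 * 1 \<le> v" unfolding v_def using dN lp pN by (intro mult_mono) auto
    hence v1: "1 \<le> v" by simp
    have "v \<le> (2 * real N) * real (16 * N) * ln (real p)"
      unfolding v_def using dN lp by (intro mult_right_mono) auto
    hence v: "v \<le> 32 * g" by (simp add: g_def power2_eq_square)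
    have "ln v \<le> ln (32 * g)" using v v1 g by (subst ln_le_cancel_iff) auto
    also have "\<dots> = ln 32 + l" using g by (simp add: ln_mult)
    also have "\<dots> \<le> ln 32 * l + l" using g(2) by (simp add: mult_le_cancel_left1)
    finally have lv: "ln v \<le> (ln 32 + 1) * l" by (simp add: algebra_simps)
    have "real (t (d N) p (16 * N)) \<le> C * \<bar>v * ln v ^ k\<bar>"
      unfolding v_def by (rule C(2)) (use d[OF pN(3)] pN in auto)
    also have "\<dots> = C * (v * ln v ^ k)" using v1 by simp
    also have "\<dots> \<le> C * ((32 * g) * ((ln 32 + 1) * l) ^ k)"
      using C(1) v v1 lv g by (intro mult_left_mono mult_mono power_mono) auto
    finally show "real (t (d N) p (16 * N)) \<le> C * 32 * (ln 32 + 1) ^ k *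
        (real N ^ 2 * ln (real p)) * lg p N ^ k"
      by (simp add: g_def l_def power_mult_distrib mult_ac)
  qed (use C in auto)
qed

section \<open>Binary lengths of the operands and the total cost\<close>

lemma ilen_bound: "1 \<le> x \<Longrightarrow> real (ilen x) \<le> 2 + ln (real_of_int x) / ln 2"
proof -
  assume x: "1 \<le> x"
  have "bitlen x = \<lfloor>log 2 (real_of_int x)\<rfloor> + 1" using x by (simp add: bitlen_alt_def)
  moreover have "0 \<le> log 2 (real_of_int x)" using x by simp
  ultimately have "real (nat (bitlen \<bar>x\<bar>)) \<le> log 2 (real_of_int x) + 1"
    using x of_int_floor_le[of "log 2 (real_of_int x)"] by simp
  thus ?thesis by (simp add: ilen_def log_def)
qed

lemma ilen_mono: "\<bar>x\<bar> \<le> y \<Longrightarrow> ilen x \<le> ilen y"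
  unfolding ilen_def bitlen_def by (intro add_left_mono nat_mono) (auto intro!: floorlog_mono)

lemma ilen_pos: "1 \<le> ilen x" by (simp add: ilen_def)

lemma affordable_cost_max:
  assumes "\<bar>x\<bar> \<le> B" "\<bar>y\<bar> \<le> B"
  shows "machine.affordable tI (cost_max tI (2 * ilen B)) x y"
  unfolding machine.affordable_def
  using cost_max[of "ilen x + ilen y" "2 * ilen B" tI] ilen_mono[OF assms(1)] ilen_mono[OF assms(2)]
    ilen_pos[of x] ilen_pos[of y] by simp


lemma soft_bound_weight:
  assumes "soft_bound h f" "\<And>p N. 5 \<le> p \<Longrightarrow> 4 \<le> N \<Longrightarrow> h p N \<le> h' p N"
  shows "soft_bound h' f"
proof -
  obtain C k where C: "0 \<le> C" "\<And>p N. prime p \<Longrightarrow> 5 \<le> p \<Longrightarrow> 4 \<le> N \<Longrightarrow>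
      f p N \<le> C * h p N * lg p N ^ k"
    using assms(1) unfolding soft_bound_def by blast
  show ?thesis
  proof (rule soft_boundI[OF C(1)])
    fix p N :: nat assume pN: "prime p" "5 \<le> p" "4 \<le> N"
    have "C * h p N * lg p N ^ k \<le> C * h' p N * lg p N ^ k"
      using C(1) assms(2)[OF pN(2,3)] parameter_bounds[OF pN(2,3)]
      by (intro mult_right_mono mult_left_mono) auto
    thus "f p N \<le> C * h' p N * lg p N ^ k"
      using C(2)[OF pN] by linarith
  qed
qed

definition operand_bound :: "weierstrass \<Rightarrow> nat \<Rightarrow> nat \<Rightarrow> int" where
  "operand_bound E p N =
     4 * (int p ^ (16 * N) + 64 * int N + \<bar>a1 E\<bar> + \<bar>a2 E\<bar> + \<bar>a3 E\<bar> + \<bar>a4 E\<bar> + \<bar>a6 E\<bar>)^2"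

text \<open>\<open>ilen (int N)\<close> bounds one plus the number of doublings, 80 is the number of
  passes charged for each, and the rest is the price \<open>U\<close> of a pass.\<close>

definition sigma_time ::
    "(nat \<Rightarrow> nat) \<Rightarrow> (nat \<Rightarrow> nat \<Rightarrow> nat \<Rightarrow> nat) \<Rightarrow> (nat \<Rightarrow> nat \<Rightarrow> nat \<Rightarrow> nat) \<Rightarrow> weierstrass \<Rightarrow> nat \<Rightarrow> nat \<Rightarrow> nat" where
  "sigma_time tI tM tD E p N = ilen (int N) * (80 * (20 *
     (tM (N - 1) p (16 * N) + tD (2 * (N - 1) - 1) p (16 * N) +
      (N - 1 + 1) * (cost_max tI (2 * ilen (operand_bound E p N)) +
         (N - 1) * cost_max tI (2 * ilen (64 * int N))))))"

lemma soft_bound_ilen: "soft_bound (\<lambda>_ _. 1) (\<lambda>p N. real (2 * ilen (64 * int N)))"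
proof (rule soft_boundI[where C = "4 + 2 * (ln 64 + 1) / ln 2" and k = 1])
  fix p N :: nat assume pN: "prime p" "5 \<le> p" "4 \<le> N"
  have l: "1 \<le> lg p N" "ln (real N) \<le> lg p N" using parameter_bounds[OF pN(2,3)] by auto
  have "real (ilen (64 * int N)) \<le> 2 + ln (real_of_int (64 * int N)) / ln 2"
    using pN by (intro ilen_bound) simp
  also have "\<dots> = 2 + (ln 64 + ln (real N)) / ln 2" using pN by (simp add: ln_mult)
  also have "\<dots> \<le> 2 * lg p N + (ln 64 * lg p N + lg p N) / ln 2"
    using l by (intro add_mono divide_right_mono) (auto simp: mult_le_cancel_left1)
  finally show "real (2 * ilen (64 * int N)) \<le> (4 + 2 * (ln 64 + 1) / ln 2) * 1 * lg p N ^ 1"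
    by (simp add: field_simps)
qed auto

text \<open>Only here do the coefficients of the curve enter the estimate: they multiply the
  operands by the fixed number \<open>A\<close>, which adds a constant to the binary length.\<close>

lemma soft_bound_operand: "soft_bound (\<lambda>p N. real N * ln (real p)) (\<lambda>p N. real (2 * ilen (operand_bound E p N)))"
proof -
  define A where "A = 65 + \<bar>a1 E\<bar> + \<bar>a2 E\<bar> + \<bar>a3 E\<bar> + \<bar>a4 E\<bar> + \<bar>a6 E\<bar>"
  have A: "1 \<le> A" by (simp add: A_def)
  define c where "c = 4 + 2 * (ln 4 + 2 * ln (real_of_int A) + 32) / ln 2"
  have lA: "0 \<le> ln (real_of_int A)" using A by simp
  show ?thesis
  proof (rule soft_boundI[where C = c and k = 0])
    fix p N :: nat assume pN: "prime p" "5 \<le> p" "4 \<le> N"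
    define P where "P = int p ^ (16 * N)"
    define h where "h = real N * ln (real p)"
    have h: "1 \<le> h" using parameter_bounds[OF pN(2,3)] by (simp add: h_def)
    have "N < 2 ^ N" by (rule less_exp)
    also have "(2::nat) ^ N \<le> p ^ N" using pN by (intro power_mono) auto
    also have "p ^ N \<le> p ^ (16 * N)" using pN by (intro power_increasing) auto
    finally have "int N \<le> P" unfolding P_def by (metis less_imp_le of_nat_le_iff of_nat_power)
    moreover have P1: "1 \<le> P" using pN by (simp add: P_def)
    moreover have "x \<le> x * P" if "0 \<le> x" for x using that P1 by (simp add: mult_le_cancel_left1)
    from this[of "\<bar>a1 E\<bar> + \<bar>a2 E\<bar> + \<bar>a3 E\<bar> + \<bar>a4 E\<bar> + \<bar>a6 E\<bar>"]
    have "\<bar>a1 E\<bar> + \<bar>a2 E\<bar> + \<bar>a3 E\<bar> + \<bar>a4 E\<bar> + \<bar>a6 E\<bar> \<le>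
        (\<bar>a1 E\<bar> + \<bar>a2 E\<bar> + \<bar>a3 E\<bar> + \<bar>a4 E\<bar> + \<bar>a6 E\<bar>) * P" by simp
    ultimately have "P + 64 * int N + \<bar>a1 E\<bar> + \<bar>a2 E\<bar> + \<bar>a3 E\<bar> + \<bar>a4 E\<bar> + \<bar>a6 E\<bar> \<le> A * P"
      unfolding A_def distrib_right by linarith
    hence ob: "operand_bound E p N \<le> 4 * (A * P)^2"
      unfolding operand_bound_def P_def[symmetric] using P1 by (intro mult_left_mono power_mono) auto
    have "1 * 1 \<le> A * P" using A P1 by (intro mult_mono) auto
    hence AP: "1 \<le> A * P" by simp
    hence "1 \<le> (A * P)^2" by (rule one_le_power)
    moreover have "\<bar>operand_bound E p N\<bar> \<le> 4 * (A * P)^2" using ob by (simp add: operand_bound_def)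
    ultimately have "real (ilen (operand_bound E p N)) \<le> 2 + ln (real_of_int (4 * (A * P)^2)) / ln 2"
      using ilen_mono[of "operand_bound E p N" "4 * (A * P)^2"] ilen_bound[of "4 * (A * P)^2"] by linarith
    also have "ln (real_of_int (4 * (A * P)^2)) = ln 4 + 2 * (ln (real_of_int A) + ln (real_of_int P))"
      using A P1 by (simp add: ln_mult ln_realpow)
    also have "ln (real_of_int P) = 16 * h"
      using pN by (simp add: P_def ln_realpow h_def)
    also have "2 + (ln 4 + 2 * (ln (real_of_int A) + 16 * h)) / ln 2 \<le>
        2 * h + (ln 4 * h + 2 * (ln (real_of_int A) * h + 16 * h)) / ln 2"
      using h lA by (intro add_mono divide_right_mono mult_left_mono) (auto simp: mult_le_cancel_left1)
    finally show "real (2 * ilen (operand_bound E p N)) \<le>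
        c * (real N * ln (real p)) * lg p N ^ 0"
      by (simp add: c_def field_simps flip: h_def)
  qed (use lA in \<open>auto simp: c_def\<close>)
qed

text \<open>Three contributions of the same soft order: polynomial operations, \<open>N\<close>
  full-size operations on \<open>O(N log p)\<close> bits, and \<open>N^2\<close> operations on
  numbers of size \<open>O(N)\<close>. The number of doublings adds one logarithm.\<close>

lemma soft_bound_sigma_time:
  assumes tI: "soft_O {2..} tI real"
    and tM: "soft_O {(d, p, r). 1 \<le> d \<and> prime p \<and> 5 \<le> p \<and> 1 \<le> r}
           (\<lambda>(d, p, r). tM d p r) (\<lambda>(d, p, r). real d * real r * ln (real p))"
    and tD: "soft_O {(d, p, r). 1 \<le> d \<and> prime p \<and> 5 \<le> p \<and> 1 \<le> r}
           (\<lambda>(d, p, r). tD d p r) (\<lambda>(d, p, r). real d * real r * ln (real p))"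
  shows "soft_bound (\<lambda>p N. real N ^ 2 * ln (real p)) (\<lambda>p N. real (sigma_time tI tM tD E p N))"
proof -
  let ?g = "\<lambda>p N. real N ^ 2 * ln (real p)" and ?h = "\<lambda>p N. real N * ln (real p)"
  define u1 where "u1 = (\<lambda>(p::nat) N. real (cost_max tI (2 * ilen (64 * int N))))"
  define u2 where "u2 = (\<lambda>p N. real (cost_max tI (2 * ilen (operand_bound E p N))))"
  define u3 where "u3 = (\<lambda>p N. real (tM (N - 1) p (16 * N)) + real (tD (2 * (N - 1) - 1) p (16 * N)))"
  define u0 where "u0 = (\<lambda>(p::nat) N. real (ilen (int N)))"
  have g0: "0 \<le> ?g p N" "0 \<le> ?h p N" "real N \<le> ?h p N" if "5 \<le> p" "4 \<le> N" for p N
    using that parameter_bounds(1,5)[OF that] ln_prime_ge[OF that(1)] by (auto simp: mult_le_cancel_left1)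
  have il: "2 \<le> 2 * ilen x" for x using ilen_pos[of x] by simp
  have u1: "soft_bound (\<lambda>_ _. 1) u1"
    unfolding u1_def
  proof (rule soft_bound_cost_max[OF tI soft_bound_ilen il])
    fix p N :: nat assume "5 \<le> p" "4 \<le> N"
    thus "1 \<le> (1::real) \<and> 1 \<le> ?g p N" using parameter_bounds(1) by fastforce
  qed
  have u2: "soft_bound ?h u2"
    unfolding u2_def
    by (rule soft_bound_cost_max[OF tI soft_bound_operand il]) (use parameter_bounds in blast)
  have u3: "soft_bound ?g u3"
    unfolding u3_def by (intro soft_bound_add soft_bound_poly_cost tM tD g0) auto
  have u0: "soft_bound (\<lambda>_ _. 1) u0"
    unfolding u0_def
  proof (rule soft_bound_mono[OF soft_bound_ilen])
    fix p N :: nat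
    have "ilen (int N) \<le> ilen (64 * int N)" by (rule ilen_mono) simp
    thus "real (ilen (int N)) \<le> real (2 * ilen (64 * int N))" by simp
  qed
  have n: "soft_bound (\<lambda>_ N. real N) (\<lambda>_ N. real N)"
    by (rule soft_boundI[where C = 1 and k = 0]) auto
  have n1: "soft_bound (\<lambda>_ N. real N) (\<lambda>_ N. real (N - 1))"
    by (rule soft_bound_mono[OF n]) auto
  have "soft_bound (\<lambda>_ N. real N * 1) (\<lambda>p N. real (N - 1) * u1 p N)"
    by (rule soft_bound_mult[OF n1 u1]) (auto simp: u1_def)
  hence "soft_bound ?h (\<lambda>p N. real (N - 1) * u1 p N)"
    by (rule soft_bound_weight) (use g0 in auto)
  hence "soft_bound ?h (\<lambda>p N. u2 p N + real (N - 1) * u1 p N)"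
    by (rule soft_bound_add[OF u2]) (use g0 in auto)
  hence "soft_bound (\<lambda>p N. real N * ?h p N) (\<lambda>p N. real N * (u2 p N + real (N - 1) * u1 p N))"
    by (rule soft_bound_mult[OF n]) (auto simp: u1_def u2_def)
  hence "soft_bound ?g (\<lambda>p N. real N * (u2 p N + real (N - 1) * u1 p N))"
    by (simp add: power2_eq_square mult.assoc)
  hence "soft_bound ?g (\<lambda>p N. u3 p N + real N * (u2 p N + real (N - 1) * u1 p N))"
    by (rule soft_bound_add[OF u3]) (use g0 in auto)
  hence "soft_bound (\<lambda>p N. 1 * ?g p N) (\<lambda>p N. 1600 * (u3 p N + real N * (u2 p N + real (N - 1) * u1 p N)))"
    by (intro soft_bound_mult soft_bound_const) (auto simp: u1_def u2_def u3_def)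
  hence "soft_bound (\<lambda>p N. 1 * (1 * ?g p N))
      (\<lambda>p N. u0 p N * (1600 * (u3 p N + real N * (u2 p N + real (N - 1) * u1 p N))))"
    by (rule soft_bound_mult[OF u0]) (auto simp: u0_def u1_def u2_def u3_def)
  hence "soft_bound ?g (\<lambda>p N. u0 p N * (1600 * (u3 p N + real N * (u2 p N + real (N - 1) * u1 p N))))"
    by simp
  thus ?thesis
  proof (rule soft_bound_mono)
    fix p N :: nat assume "4 \<le> N"
    hence "N - 1 + 1 = N" by simp
    thus "real (sigma_time tI tM tD E p N) \<le>
        u0 p N * (1600 * (u3 p N + real N * (u2 p N + real (N - 1) * u1 p N)))"
      unfolding sigma_time_def u0_def u1_def u2_def u3_def by simp
  qed
qed

lemma soft_bound_imp_soft_O: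
  assumes "soft_bound (\<lambda>p N. real N ^ 2 * ln (real p)) (\<lambda>p N. real (T p N))"
    and S: "\<And>p N. (p, N) \<in> S \<Longrightarrow> prime p \<and> 5 \<le> p \<and> 4 \<le> N"
  shows "soft_O S (\<lambda>(p, N). T p N) (\<lambda>(p, N). real N ^ 2 * ln (real p))"
proof -
  obtain C k where C: "0 \<le> C" "\<And>p N. prime p \<Longrightarrow> 5 \<le> p \<Longrightarrow> 4 \<le> N \<Longrightarrow>
      real (T p N) \<le> C * (real N ^ 2 * ln (real p)) * lg p N ^ k"
    using assms(1) unfolding soft_bound_def by blast
  have "norm (real (case x of (p, N) \<Rightarrow> T p N)) \<le> C * norm ((case x of (p, N) \<Rightarrow> real N ^ 2 * ln (real p)) *
      ln (case x of (p, N) \<Rightarrow> real N ^ 2 * ln (real p)) ^ k)" if "x \<in> S" for x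
  proof -
    obtain p N where x: "x = (p, N)" by (cases x)
    have pN: "prime p" "5 \<le> p" "4 \<le> N" using S[of p N] that x by auto
    have "0 \<le> real N ^ 2 * ln (real p) * lg p N ^ k"
      using parameter_bounds(1,2)[OF pN(2,3)] by (intro mult_nonneg_nonneg[OF _ zero_le_power]) linarith+
    thus ?thesis using C(2)[OF pN] by (simp add: x mult.assoc)
  qed
  hence "(\<lambda>x. real (case x of (p, N) \<Rightarrow> T p N)) \<in> O[principal S](\<lambda>x. (case x of (p, N) \<Rightarrow> real N ^ 2 * ln (real p)) *
      ln (case x of (p, N) \<Rightarrow> real N ^ 2 * ln (real p)) ^ k)"
    by (intro bigoI[where c = C]) (simp add: eventually_principal)
  thus ?thesis unfolding soft_O_def by blast
qed

theorem theorem1p2: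
  fixes tI :: "nat \<Rightarrow> nat" and tM tD :: "nat \<Rightarrow> nat \<Rightarrow> nat \<Rightarrow> nat"
  assumes "soft_O {2..} tI real"
    and "soft_O {(d, p, r). 1 \<le> d \<and> prime p \<and> 5 \<le> p \<and> 1 \<le> r}
           (\<lambda>(d, p, r). tM d p r) (\<lambda>(d, p, r). real d * real r * ln (real p))"
    and "soft_O {(d, p, r). 1 \<le> d \<and> prime p \<and> 5 \<le> p \<and> 1 \<le> r}
           (\<lambda>(d, p, r). tD d p r) (\<lambda>(d, p, r). real d * real r * ln (real p))"
  shows "\<exists>prog. \<forall>E. discr E \<noteq> 0 \<longrightarrow>
    (\<exists>T. soft_O {(p, N). prime p \<and> 5 \<le> p \<and> good_ordinary p E \<and> 4 \<le> N} T
           (\<lambda>(p, N). real N ^ 2 * ln (real p)) \<and>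
      (\<forall>p N e \<sigma>. prime p \<and> 5 \<le> p \<and> good_ordinary p E \<and> 4 \<le> N \<and>
          katz_E2 p E e \<and> is_padic_sigma p E e \<sigma> \<longrightarrow>
        (\<exists>t s l. exec tI tM tD prog (input_state p N E (e (N - 3))) t (s, l) \<and>
           l 0 = mod_I N \<sigma> \<and> t \<le> T (p, N))))"
proof (intro exI[of _ sigma_com] allI impI)
  fix E
  \<comment> \<open>The program was fixed before the curve; the time bound is chosen after it and
    depends on it through the operand sizes.\<close>
  let ?T = "\<lambda>(p, N). sigma_time tI tM tD E p N"
  have "soft_O {(p, N). prime p \<and> 5 \<le> p \<and> good_ordinary p E \<and> 4 \<le> N} ?T
           (\<lambda>(p, N). real N ^ 2 * ln (real p))"
    by (rule soft_bound_imp_soft_O[OF soft_bound_sigma_time[OF assms]]) auto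
  moreover have "\<exists>t s l. exec tI tM tD sigma_com (input_state p N E (e (N - 3))) t (s, l) \<and>
      l 0 = mod_I N \<sigma> \<and> t \<le> ?T (p, N)"
    if *: "prime p \<and> 5 \<le> p \<and> good_ordinary p E \<and> 4 \<le> N \<and> katz_E2 p E e \<and> is_padic_sigma p E e \<sigma>"
    for p N e \<sigma>
  proof -
    have p: "prime p" "5 \<le> p" and N: "4 \<le> N" and eZ: "e \<in> Zp p" and sg: "is_padic_sigma p E e \<sigma>"
      using * by (auto simp: katz_E2_def)
    have "e (N - 3) \<in> {0..<int p ^ (N - 3)}" using eZ by (simp add: Zp_def)
    moreover have "int p ^ (N - 3) \<le> int p ^ (16 * N)" using p by (intro power_increasing) auto
    ultimately have eb: "0 \<le> e (N - 3)" "e (N - 3) < int p ^ (16 * N)" by auto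
    \<comment> \<open>The residue \<open>e (N - 3)\<close> is treated as an exact integer; its being
      below \<open>p^(16 N)\<close> makes it an admissible operand.\<close>
    interpret sigma_machine tI tM tD p N E "e (N - 3)" "64 * int N" "operand_bound E p N"
      "cost_max tI (2 * ilen (64 * int N))" "cost_max tI (2 * ilen (operand_bound E p N))"
      "tM (N - 1) p (16 * N) + tD (2 * (N - 1) - 1) p (16 * N)"
      by unfold_locales
         (use p N eb in \<open>auto simp: operand_bound_def intro: affordable_cost_max\<close>)
    \<comment> \<open>The binary length of \<open>N\<close> bounds the number of doublings, and
      \<open>K + 1\<close> is then the leading factor of \<open>sigma_time\<close>.\<close>
    define K where "K = nat (bitlen (int N))"
    have "int N < 2 ^ K" using bitlen_bounds[of "int N"] N by (simp add: K_def)
    hence "N < 2 ^ K" by (metis of_nat_less_iff of_nat_numeral of_nat_power)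
    hence K: "L \<le> 2 ^ K" by (simp add: L_def)
    have "fps_small p L 0 (sigma_unit E c)"
      unfolding L_def c_def by (rule fps_small_sigma_unit[OF p N eZ sg])
    from run_sigma[OF this K] obtain t s l where
      r: "exec tI tM tD sigma_com (input_state p N E (e (N - 3))) t (s, l)" "t \<le> (K + 1) * (80 * U)"
        "length (l 0) = L" "\<forall>i<L. \<exists>z. l 0 ! i = z mod int p ^ (L - i) \<and>
           rat_cong p L (of_int z) (sigma_unit E c $ i)"
      unfolding run_def by auto
    have "l 0 = mod_I N \<sigma>"
      using mod_I_eqI[OF p N eZ sg, of "l 0"] r(3,4) unfolding L_def c_def by blast
    moreover have "K + 1 = ilen (int N)" by (simp add: K_def ilen_def)
    hence "(K + 1) * (80 * U) = ?T (p, N)"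
      by (simp only: prod.case sigma_time_def U_def L_def)
    ultimately show ?thesis using r(1,2) by metis
  qed
  ultimately show "\<exists>T. soft_O {(p, N). prime p \<and> 5 \<le> p \<and> good_ordinary p E \<and> 4 \<le> N} T
           (\<lambda>(p, N). real N ^ 2 * ln (real p)) \<and>
      (\<forall>p N e \<sigma>. prime p \<and> 5 \<le> p \<and> good_ordinary p E \<and> 4 \<le> N \<and>
          katz_E2 p E e \<and> is_padic_sigma p E e \<sigma> \<longrightarrow>
        (\<exists>t s l. exec tI tM tD sigma_com (input_state p N E (e (N - 3))) t (s, l) \<and>
           l 0 = mod_I N \<sigma> \<and> t \<le> T (p, N)))"
    by blast
qed

end
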